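(* Let $s\in(0,1)$, let $I=[0,1]$ with Lebesgue measure $\nu$, and let $$D_s=\Big(\big[\tfrac12,1-\tfrac s2\big)\times\big(\tfrac s2,\tfrac12\big]\Big)\cup\Big(\big(\tfrac s2,\tfrac12\big]\times\big[\tfrac12,1-\tfrac s2\big)\Big),\qquad N_s=\bigcup_{w\in W_*}\varphi_w(D_s).$$ Assume that a measurable function $J(x,y)$, defined for $x\neq y$ in $[0,1]$, satisfies $J(x,y)=J(y,x)$, $0\le J(x,y)\le J_*(x,y)$ if $(x,y)\in N_s$, and $J(x,y)=J_*(x,y)$ otherwise. Define $$\mathcal F_J=\Big\{u\in L^2(I,\nu):\int_{I^2}(u(x)-u(y))^2J(x,y)\,\nu(dx)\nu(dy)<+\infty\Big\},$$ $$\mathcal E_J(u,v)=\int_{I^2}(u(x)-u(y))(v(x)-v(y))J(x,y)\,\nu(dx)\nu(dy),\quad u,v\in\mathcal F_J.$$ Then $\mathcal F_J=\mathcal F|_I$ and there exist $c_1,c_2>0$ such that $$c_1\,\mathcal E|_I(u,u)\ \le\ \mathcal E_J(u,u)\ \le\ c_2\,\mathcal E|_I(u,u)\qquad\text{for any }u\in\mathcal F|_I.$$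
   Context: Maps $\varphi_w$: for $a\in\mathbb R$ let $\varphi_a:\mathbb R^2\to\mathbb R^2$, $\varphi_a(x,y)=(\frac12(x-a)+a,\frac12(y-a)+a)$. Let $W_m=\{0,1\}^m$ for $m\ge1$, $W_0=\{\emptyset\}$, $W_*=\bigcup_{m\ge0}W_m$, $\varphi_\emptyset={\rm id}$, and $\varphi_{i_1\ldots i_m}=\varphi_{i_1}\circ\cdots\circ\varphi_{i_m}$. Kernel $J_*$: let $\Sigma=\{0,1\}^{\mathbb N}$, $\pi:\Sigma\to I$, $\pi(i_1i_2\ldots)=\sum_{j\ge1}i_j2^{-j}$, and $n_*(\omega,\xi)=\min\{j:\omega_j\ne\xi_j\}-1$ for $\omega\neq\xi$ in $\Sigma$. For $x\ne y$ in $I$, $J_*(x,y)=\frac{35}{16}\big(\frac{14}{17}(\frac{20}3)^{n_*(\pi^{-1}(x),\pi^{-1}(y))}+\frac3{17}\big)$, where $n_*(\pi^{-1}(x),\pi^{-1}(y))=\max\{n_*(\omega,\xi):\omega\in\pi^{-1}(x),\xi\in\pi^{-1}(y)\}$. Trace form $(\mathcal E|_I,\mathcal F|_I)$: let $p_0=(0,0)$, $p_1=(1,0)$, $p_2=(\frac12,\frac{\sqrt3}2)$, $F_i(z)=\frac12(z-p_i)+p_i$, and let $K$ be the Sierpinski gasket, i.e. the unique non-empty compact set with $K=F_0(K)\cup F_1(K)\cup F_2(K)$. Let $V_0=\{p_0,p_1,p_2\}$, $E_0=\{(p_i,p_j):i,j\in\{0,1,2\}\}$, $V_{m+1}=\bigcup_{i=0}^2F_i(V_m)$,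 $E_{m+1}=\{(F_k(p),F_k(q)):(p,q)\in E_m,k\in\{0,1,2\}\}$, $\mathcal E_m(u)=\frac12(\frac53)^m\sum_{(p,q)\in E_m}|u(p)-u(q)|^2$; $\mathcal F=\{u\in C(K):\mathcal E_m(u|_{V_m})\text{ converges as }m\to\infty\}$, $\mathcal E(u,u)=\lim_{m\to\infty}\mathcal E_m(u|_{V_m})$. With $I=[0,1]\times\{0\}\subseteq K$ identified with $[0,1]$, $\mathcal F|_I=\{u|_I:u\in\mathcal F\}$ and $\mathcal E|_I(v,v)=\min\{\mathcal E(u,u):u\in\mathcal F,u|_I=v\}$ for $v\in\mathcal F|_I$. It is known (cited by the paper from earlier work) that $\mathcal F|_I=\{u\in C(I):\int_{I^2}J_*(x,y)(u(x)-u(y))^2\nu(dx)\nu(dy)<\infty\}$ and $\mathcal E|_I(u,v)=\int_{I^2}J_*(x,y)(u(x)-u(y))(v(x)-v(y))\nu(dx)\nu(dy)$ for $u,v\in\mathcal F|_I$.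
   Formalization: The equality is proved as F_J ∩ C(I) = F|_I, since F_J = F|_I is false with all of L^2: the indicator of [0,1/2) lies in F_J for every admissible J (J_* = 35/16 for x < 1/2 < y) but has no continuous version. *)

theory Defs
  imports "HOL-Analysis.Analysis"
begin

subsection \<open>The maps \<open>\<phi>\<^sub>w\<close> and the set \<open>N\<^sub>s\<close>\<close>

definition half_map :: "real \<Rightarrow> real \<times> real \<Rightarrow> real \<times> real" where
  "half_map a = (\<lambda>(x, y). (1 / 2 * (x - a) + a, 1 / 2 * (y - a) + a))"

definition word_map :: "real list \<Rightarrow> real \<times> real \<Rightarrow> real \<times> real" where
  "word_map w = foldr (\<lambda>a f. half_map a \<circ> f) w id"

definition D_set :: "real \<Rightarrow> (real \<times> real) set" where
  "D_set s = {1 / 2 ..< 1 - s / 2} \<times> {s / 2 <.. 1 / 2} \<union>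
             {s / 2 <.. 1 / 2} \<times> {1 / 2 ..< 1 - s / 2}"

definition N_set :: "real \<Rightarrow> (real \<times> real) set" where
  "N_set s = (\<Union>w\<in>lists {0, 1}. word_map w ` D_set s)"


subsection \<open>The kernel \<open>J\<^sub>*\<close>\<close>

text \<open>Digit sequences are indexed from 0 here, so the digit \<open>i\<^sub>j\<close> of the usual binary
  expansion (\<open>j \<ge> 1\<close>) is \<open>\<omega> (j - 1)\<close>.  With this shift the number
  \<open>min {j \<ge> 1. \<omega>\<^sub>j \<noteq> \<xi>\<^sub>j} - 1\<close> is the least index at which the two functions differ.\<close>

definition binary_val :: "(nat \<Rightarrow> real) \<Rightarrow> real" where
  "binary_val \<omega> = (\<Sum>j. \<omega> j / 2 ^ Suc j)"

definition binary_expansions :: "real \<Rightarrow> (nat \<Rightarrow> real) set" where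
  "binary_expansions x = {\<omega>. (\<forall>j. \<omega> j \<in> {0, 1}) \<and> binary_val \<omega> = x}"

definition common_prefix :: "(nat \<Rightarrow> real) \<Rightarrow> (nat \<Rightarrow> real) \<Rightarrow> nat" where
  "common_prefix \<omega> \<xi> = (LEAST j. \<omega> j \<noteq> \<xi> j)"

text \<open>A real number has at most two binary expansions, so the maximum is over a finite set,
  which is nonempty for \<open>x, y \<in> [0,1]\<close>.\<close>

definition n_star :: "real \<Rightarrow> real \<Rightarrow> nat" where
  "n_star x y = Max {common_prefix \<omega> \<xi> | \<omega> \<xi>. \<omega> \<in> binary_expansions x \<and> \<xi> \<in> binary_expansions y}"

definition J_star :: "real \<Rightarrow> real \<Rightarrow> real" where
  "J_star x y = 35 / 16 * (14 / 17 * (20 / 3) ^ n_star x y + 3 / 17)"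


subsection \<open>The standard resistance form on the Sierpinski gasket\<close>

definition sg_vertex :: "nat \<Rightarrow> real \<times> real" where
  "sg_vertex i = (if i = 0 then (0, 0) else if i = 1 then (1, 0) else (1 / 2, sqrt 3 / 2))"

definition sg_map :: "nat \<Rightarrow> real \<times> real \<Rightarrow> real \<times> real" where
  "sg_map i z = (1 / 2) *\<^sub>R (z - sg_vertex i) + sg_vertex i"

definition sierpinski_gasket :: "(real \<times> real) set" where
  "sierpinski_gasket = (THE K. K \<noteq> {} \<and> compact K \<and> K = (\<Union>i\<in>{0, 1, 2}. sg_map i ` K))"

primrec sg_verts :: "nat \<Rightarrow> (real \<times> real) set" where
  "sg_verts 0 = sg_vertex ` {0, 1, 2}"
| "sg_verts (Suc m) = (\<Union>i\<in>{0, 1, 2}. sg_map i ` sg_verts m)"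

text \<open>Ordered pairs: every undirected edge occurs in both directions, which accounts for the
  factor \<open>1/2\<close> in the energy; the pairs \<open>(p, p)\<close> are included and contribute nothing.\<close>

primrec sg_edges :: "nat \<Rightarrow> ((real \<times> real) \<times> (real \<times> real)) set" where
  "sg_edges 0 = {(sg_vertex i, sg_vertex j) | i j. i \<in> {0, 1, 2} \<and> j \<in> {0, 1, 2}}"
| "sg_edges (Suc m) = {(sg_map k p, sg_map k q) | k p q. (p, q) \<in> sg_edges m \<and> k \<in> {0, 1, 2}}"

definition sg_level_energy :: "nat \<Rightarrow> (real \<times> real \<Rightarrow> real) \<Rightarrow> real" where
  "sg_level_energy m u = 1 / 2 * (5 / 3) ^ m * (\<Sum>(p, q)\<in>sg_edges m. \<bar>u p - u q\<bar>\<^sup>2)"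

definition sg_dom :: "(real \<times> real \<Rightarrow> real) set" where
  "sg_dom = {u. continuous_on sierpinski_gasket u \<and> convergent (\<lambda>m. sg_level_energy m u)}"

definition sg_energy :: "(real \<times> real \<Rightarrow> real) \<Rightarrow> real" where
  "sg_energy u = lim (\<lambda>m. sg_level_energy m u)"


subsection \<open>Its trace on the bottom edge\<close>

text \<open>The bottom edge \<open>[0,1] \<times> {0}\<close> is identified with \<open>[0,1]\<close>.  Functions on \<open>[0,1]\<close> are
  represented by functions on the reals whose values outside \<open>[0,1]\<close> are arbitrary.\<close>

definition sg_extensions :: "(real \<Rightarrow> real) \<Rightarrow> (real \<times> real \<Rightarrow> real) set" where
  "sg_extensions v = {u \<in> sg_dom. \<forall>x\<in>{0..1}. u (x, 0) = v x}"

definition trace_dom :: "(real \<Rightarrow> real) set" where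
  "trace_dom = {v. sg_extensions v \<noteq> {}}"

text \<open>The set of energies is nonempty for \<open>v \<in> trace_dom\<close> and bounded below by 0, and the
  infimum coincides with the minimum, which is attained by the harmonic extension.\<close>

definition trace_energy :: "(real \<Rightarrow> real) \<Rightarrow> real" where
  "trace_energy v = Inf (sg_energy ` sg_extensions v)"


subsection \<open>The form with jump kernel \<open>J\<close>\<close>

text \<open>All integrals are with respect to Lebesgue measure on \<open>[0,1]\<close> and on its square.  The
  integrands vanish on the diagonal, so the values \<open>J x x\<close> play no role.

  The elements of \<open>jump_dom J\<close> are representatives of classes in \<open>L\<^sup>2\<close>.  Not every such class
  has a continuous representative: for \<open>x < 1/2 < y\<close> in \<open>[0,1]\<close> no binary expansions of \<open>x\<close>
  and \<open>y\<close> share a first digit, so \<open>J_star x y = 35/16\<close>, and the indicator function of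
  \<open>[0, 1/2)\<close> belongs to \<open>jump_dom J\<close> whenever \<open>0 \<le> J \<le> J_star\<close> off the diagonal.  A comparison
  with \<open>trace_dom\<close>, all of whose elements are continuous on \<open>[0,1]\<close>, therefore has to be made
  inside the continuous functions.\<close>

definition jump_dom :: "(real \<Rightarrow> real \<Rightarrow> real) \<Rightarrow> (real \<Rightarrow> real) set" where
  "jump_dom J = {u. u \<in> borel_measurable (lebesgue_on {0..1}) \<and>
      integrable (lebesgue_on {0..1}) (\<lambda>x. (u x)\<^sup>2) \<and>
      (\<integral>\<^sup>+ (x, y). ennreal ((u x - u y)\<^sup>2 * J x y) \<partial>lebesgue_on ({0..1} \<times> {0..1})) < \<infinity>}"

definition jump_form :: "(real \<Rightarrow> real \<Rightarrow> real) \<Rightarrow> (real \<Rightarrow> real) \<Rightarrow> (real \<Rightarrow> real) \<Rightarrow> real" where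
  "jump_form J u v =
     (\<integral> (x, y). (u x - u y) * (v x - v y) * J x y \<partial>lebesgue_on ({0..1} \<times> {0..1}))"

end

theory Submission
  imports Defs
begin

text \<open>
  Write \<open>u\<^sub>0 = dyadic_half 0 u\<close> and \<open>u\<^sub>1 = dyadic_half 1 u\<close> for the restrictions of \<open>u\<close> to the two
  halves of the unit interval, rescaled to the unit interval, and \<open>cross u\<close> for the integral of
  \<open>(u x - u y)\<^sup>2\<close> over \<open>x < 1/2 < y\<close>.  Everything is compared with one quantity, \<open>dyadic_form u\<close>:
  the sum over all dyadic intervals, of length \<open>2\<^sup>-\<^sup>n\<close> say, of \<open>(5/3)\<^sup>n\<close> times \<open>cross\<close> of \<open>u\<close> rescaled
  from that interval.  It satisfies \<open>dyadic_form u = cross u + 5/3 (dyadic_form u\<^sub>0 + dyadic_form u\<^sub>1)\<close>,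
  which matches the self-similarity \<open>E(U) = 5/3 (E(U \<circ> F\<^sub>0) + E(U \<circ> F\<^sub>1) + E(U \<circ> F\<^sub>2))\<close> of the energy
  on the gasket, so that all estimates become inductions on the level.

  The jump form.  Up to a null set and a reflection, the square is the disjoint union of the blocks
  of pairs \<open>x < y\<close> that are separated by the midpoint of their smallest common dyadic interval, of length
  \<open>2\<^sup>-\<^sup>n\<close>.  There \<open>n_star\<close> equals \<open>n\<close>, so \<open>J_star\<close> is comparable with \<open>(20/3)\<^sup>n\<close>, and after rescaling
  (a factor \<open>4\<^sup>-\<^sup>n\<close>) the contribution of a block is comparable with \<open>(5/3)\<^sup>n\<close> times \<open>cross\<close>.  This
  bounds the jump form by \<open>dyadic_form\<close> (\<open>jump_integral_upper\<close>).  In the other direction, \<open>J\<close> is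
  unknown on \<open>N_set s\<close>, but in every block it equals \<open>J_star\<close> at the pairs for which \<open>x\<close> lies in the
  leftmost or \<open>y\<close> in the rightmost part of relative length \<open>s/2\<close>.  These pairs suffice: for a
  left half \<open>A\<close>, a right half \<open>B\<close>, and the outer ends \<open>L\<close> of \<open>A\<close> and \<open>R\<close> of \<open>B\<close>, one passes from
  \<open>x \<in> A\<close> to a point of \<open>R\<close>, from there to a point of \<open>L\<close>, and from there to \<open>y \<in> B\<close>, and averages
  over the two intermediate points (\<open>mean_sqdiff_triangle\<close>, \<open>top_le_visible\<close>,
  \<open>jump_integral_lower\<close>).

  The trace.  A continuous \<open>u\<close> with finite \<open>dyadic_form\<close> is extended to the gasket by giving the top
  vertex of each cell on the bottom edge the mean of \<open>u\<close> over the base of that cell, and by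
  interpolating harmonically in the remaining cells.  The harmonic cells cost at most a multiple of
  \<open>cross\<close> each, and the values at the end points of an interval differ from the mean by at most a
  geometric series, because each halving multiplies the energy by at most \<open>3/5\<close>
  (\<open>trace_extension\<close>).  Conversely, if \<open>u\<close> is the restriction of \<open>U\<close>, then the sum of
  \<open>dyadic_form u\<close> and a multiple of the integral of \<open>(u - U(p\<^sub>2))\<^sup>2\<close> is bounded by a multiple of \<open>E(U)\<close>
  by induction on the number of levels: the step from \<open>p\<^sub>2\<close> to the top vertices of the two lower
  cells is paid for by the energy in the upper cell (\<open>restriction_partial_bound\<close>,
  \<open>trace_restriction\<close>).
\<close>

section \<open>The gasket as a self-similar set\<close>

text \<open>The barycentric coordinates with respect to the three corners.  In them \<open>sg_map i\<close> halves
  every coordinate and adds \<open>1/2\<close> to the \<open>i\<close>-th one, and the image of the triangle under \<open>sg_map i\<close>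
  is the part where the \<open>i\<close>-th coordinate is at least \<open>1/2\<close>.\<close>

definition bary :: "nat \<Rightarrow> real \<times> real \<Rightarrow> real" where
  "bary i z = (if i = 0 then 1 - fst z - snd z / sqrt 3
     else if i = 1 then fst z - snd z / sqrt 3 else 2 * snd z / sqrt 3)"

definition triangle :: "(real \<times> real) set" where
  "triangle = {z. \<forall>i\<in>{0, 1, 2}. 0 \<le> bary i z}"

lemma bary_sg_map:
  assumes "i \<in> {0, 1, 2}" "j \<in> {0, 1, 2}"
  shows "bary j (sg_map i z) = (bary j z + of_bool (i = j)) / 2"
  using assms by (auto simp: bary_def sg_map_def sg_vertex_def field_simps)

lemma bary_sg_vertex:
  assumes "i \<in> {0, 1, 2}" "j \<in> {0, 1, 2}"
  shows "bary j (sg_vertex i) = of_bool (i = j)"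
  using assms by (auto simp: bary_def sg_vertex_def field_simps)

lemma bary_sum: "bary 0 z + bary 1 z + bary 2 z = 1"
  by (simp add: bary_def)

lemma bary_eqI:
  assumes "\<And>i. i \<in> {0, 1, 2} \<Longrightarrow> bary i z = bary i z'"
  shows "z = z'"
proof -
  have "snd z = snd z'" using assms[of 2] by (simp add: bary_def)
  moreover from this have "fst z = fst z'" using assms[of 1] by (simp add: bary_def)
  ultimately show ?thesis by (simp add: prod_eq_iff)
qed

lemma continuous_on_bary: "continuous_on S (bary i)"
  unfolding bary_def by (cases "i = 0"; cases "i = 1") (auto intro!: continuous_intros)

lemma sg_map_eq: "sg_map i z = (1 / 2) *\<^sub>R (z + sg_vertex i)"
  by (simp add: sg_map_def prod_eq_iff field_simps)

lemma sg_map_vertex_swap: "sg_map i (sg_vertex j) = sg_map j (sg_vertex i)"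
  by (simp add: sg_map_eq add.commute)

lemma sg_map_vertex_self: "sg_map i (sg_vertex i) = sg_vertex i"
  by (simp add: sg_map_def)

lemma dist_sg_map: "dist (sg_map i z) (sg_map i z') = dist z z' / 2"
proof -
  have "sg_map i z - sg_map i z' = (1 / 2) *\<^sub>R (z - z')"
    by (simp add: sg_map_eq scaleR_diff_right scaleR_add_right)
  then show ?thesis by (simp add: dist_norm)
qed

lemma continuous_on_sg_map: "continuous_on S (sg_map i)"
  unfolding sg_map_def by (intro continuous_intros)

lemma sg_map_triangle:
  assumes "i \<in> {0, 1, 2}" "z \<in> triangle"
  shows "sg_map i z \<in> triangle"
  using assms by (auto simp: triangle_def bary_sg_map)

text \<open>Two cells of the same level meet in a single vertex: at a common point both of the
  coordinates \<open>i\<close> and \<open>j\<close> are at least \<open>1/2\<close>, hence equal to \<open>1/2\<close>.\<close>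

lemma sg_map_overlap:
  assumes "i \<in> {0, 1, 2}" "j \<in> {0, 1, 2}" "i \<noteq> j" "z \<in> triangle" "z' \<in> triangle"
    and eq: "sg_map i z = sg_map j z'"
  shows "z = sg_vertex j \<and> z' = sg_vertex i"
proof -
  have e: "bary k z + of_bool (i = k) = bary k z' + of_bool (j = k)" if "k \<in> {0, 1, 2}" for k
    using arg_cong[OF eq, of "bary k"]
    unfolding bary_sg_map[OF assms(1) that] bary_sg_map[OF assms(2) that] divide_cancel_right by simp
  have nn: "bary k z \<ge> 0" "bary k z' \<ge> 0" if "k \<in> {0, 1, 2}" for k
    using assms that by (auto simp: triangle_def)
  note facts = e[of 0] e[of 1] e[of 2] nn[of 0] nn[of 1] nn[of 2] bary_sum[of z] bary_sum[of z']
  have b: "bary k z = of_bool (j = k) \<and> bary k z' = of_bool (i = k)" if "k \<in> {0, 1, 2}" for k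
    using assms(1,2,3) that facts[simplified] by (elim insertE emptyE; simp)
  show ?thesis
  proof
    show "z = sg_vertex j" by (rule bary_eqI) (use b assms(2) in \<open>simp only: bary_sg_vertex\<close>)
    show "z' = sg_vertex i" by (rule bary_eqI) (use b assms(1) in \<open>simp only: bary_sg_vertex\<close>)
  qed
qed

lemma bounded_triangle: "bounded triangle"
proof -
  have "z \<in> {0..1} \<times> {0..2}" if "z \<in> triangle" for z
  proof -
    have *: "bary 0 z \<ge> 0" "bary 1 z \<ge> 0" "bary 2 z \<ge> 0" using that by (auto simp: triangle_def)
    have "bary 1 z + bary 2 z / 2 = fst z" "snd z = bary 2 z * sqrt 3 / 2"
      by (auto simp: bary_def)
    moreover have "sqrt 3 \<le> 2" using real_sqrt_le_mono[of 3 4] by simp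
    moreover from this have "bary 2 z * sqrt 3 \<le> 1 * 2" using * bary_sum[of z] by (intro mult_mono) auto
    moreover have "0 \<le> bary 2 z * (sqrt 3 / 2)" using * by (intro mult_nonneg_nonneg) auto
    then have "0 \<le> snd z" by (simp add: bary_def)
    ultimately show ?thesis using * bary_sum[of z] by (auto simp: mem_Times_iff)
  qed
  then have "triangle \<subseteq> {0..1} \<times> {0..2}" by blast
  moreover have "bounded ({0..1::real} \<times> {0..2::real})" by (intro bounded_Times) auto
  ultimately show ?thesis using bounded_subset by blast
qed

lemma closed_triangle: "closed triangle"
proof -
  have eq: "triangle = (\<Inter>i\<in>{0, 1, 2}. {z. 0 \<le> bary i z})" by (auto simp: triangle_def)
  have "closed {z. 0 \<le> bary i z}" for i
    by (intro closed_Collect_le continuous_on_bary continuous_intros)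
  then show ?thesis unfolding eq by (intro closed_INT) auto
qed

text \<open>Every point of \<open>A\<close> is the image of another point of \<open>A\<close> under one of the contractions, which
  halves its distance to \<open>K\<close>; iterating shows that the distance vanishes.  The lemma yields both
  the uniqueness of the gasket and the inclusion of the bottom edge.\<close>

lemma subset_of_sg_invariant:
  assumes "closed K" "K \<noteq> {}" and inv: "\<And>i. i \<in> {0, 1, 2} \<Longrightarrow> sg_map i ` K \<subseteq> K"
    and "bounded A" and A: "A \<subseteq> (\<Union>i\<in>{0, 1, 2}. sg_map i ` A)"
  shows "A \<subseteq> K"
proof
  obtain k where "k \<in> K" using assms by blast
  obtain M where M: "\<forall>a\<in>A. dist k a \<le> M" using \<open>bounded A\<close> bounded_any_center by blast
  have *: "\<exists>k\<in>K. dist k a \<le> M / 2 ^ n" if "a \<in> A" for a n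
    using that
  proof (induction n arbitrary: a)
    case 0
    then show ?case using M \<open>k \<in> K\<close> by auto
  next
    case (Suc n)
    obtain i a' where i: "i \<in> {0, 1, 2}" "a' \<in> A" "a = sg_map i a'" using A Suc.prems by blast
    obtain k' where "k' \<in> K" "dist k' a' \<le> M / 2 ^ n" using Suc.IH i by blast
    then show ?case using inv[OF i(1)] i by (intro bexI[of _ "sg_map i k'"]) (auto simp: dist_sg_map)
  qed
  fix a assume "a \<in> A"
  have "\<exists>k\<in>K. dist k a < e" if "e > 0" for e
  proof -
    have "(\<lambda>n. M / 2 ^ n) \<longlonglongrightarrow> 0" by real_asymp
    then have "eventually (\<lambda>n. M / 2 ^ n < e) sequentially" using \<open>e > 0\<close> order_tendstoD(2) by blast
    then obtain n where "M / 2 ^ n < e" by (auto simp: eventually_sequentially)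
    then show ?thesis using *[OF \<open>a \<in> A\<close>, of n] le_less_trans by blast
  qed
  then have "a \<in> closure K" by (auto simp: closure_approachable)
  then show "a \<in> K" using \<open>closed K\<close> by simp
qed

lemma sg_verts_subset_triangle: "sg_verts m \<subseteq> triangle"
proof (induction m)
  case 0
  then show ?case by (auto simp: triangle_def bary_sg_vertex)
next
  case (Suc m)
  then show ?case using sg_map_triangle by auto
qed

lemma sg_verts_mono_Suc: "sg_verts m \<subseteq> sg_verts (Suc m)"
proof (induction m)
  case 0
  have "sg_vertex i \<in> sg_verts (Suc 0)" if "i \<in> {0, 1, 2}" for i
    using that sg_map_vertex_self[of i] by force
  then show ?case by auto
next
  case (Suc m)
  then show ?case by auto
qed

text \<open>The closure of the vertex set is invariant since continuous images of compact sets are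
  closed.\<close>

lemma sierpinski_gasket_exists:
  defines "C \<equiv> closure (\<Union>m. sg_verts m)"
  shows "C \<noteq> {} \<and> compact C \<and> C = (\<Union>i\<in>{0, 1, 2}. sg_map i ` C)"
proof -
  define V where "V = (\<Union>m. sg_verts m)"
  have "V \<subseteq> triangle" using sg_verts_subset_triangle by (auto simp: V_def)
  then have "compact C"
    using bounded_triangle bounded_subset compact_closure unfolding C_def V_def[symmetric] by blast
  have "sg_vertex 0 \<in> V" by (auto simp: V_def intro!: exI[of _ 0])
  then have "C \<noteq> {}" using closure_subset by (auto simp: C_def V_def[symmetric])
  have "V \<subseteq> C" by (simp add: C_def V_def closure_subset)
  have step: "sg_map i ` V \<subseteq> V" if "i \<in> {0, 1, 2}" for i
  proof
    fix z assume "z \<in> sg_map i ` V"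
    then obtain m where "z \<in> sg_map i ` sg_verts m" by (auto simp: V_def)
    then have "z \<in> sg_verts (Suc m)" using that by auto
    then show "z \<in> V" unfolding V_def by blast
  qed
  have "(\<Union>i\<in>{0, 1, 2}. sg_map i ` C) \<subseteq> C"
  proof (intro UN_least)
    fix i :: nat assume "i \<in> {0, 1, 2}"
    then have "sg_map i ` V \<subseteq> C" using step \<open>V \<subseteq> C\<close> by blast
    then show "sg_map i ` C \<subseteq> C"
      unfolding C_def V_def[symmetric]
      by (intro image_closure_subset continuous_on_sg_map) auto
  qed
  moreover have "C \<subseteq> (\<Union>i\<in>{0, 1, 2}. sg_map i ` C)"
  proof -
    have "V \<subseteq> (\<Union>i\<in>{0, 1, 2}. sg_map i ` V)"
    proof
      fix z assume "z \<in> V"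
      then obtain m where "z \<in> sg_verts m" by (auto simp: V_def)
      then have "z \<in> sg_verts (Suc m)" by (rule subsetD[OF sg_verts_mono_Suc])
      then obtain i z' where "i \<in> {0, 1, 2}" "z' \<in> sg_verts m" "z = sg_map i z'"
        unfolding sg_verts.simps by blast
      then show "z \<in> (\<Union>i\<in>{0, 1, 2}. sg_map i ` V)" unfolding V_def by blast
    qed
    also have "\<dots> \<subseteq> (\<Union>i\<in>{0, 1, 2}. sg_map i ` C)" using \<open>V \<subseteq> C\<close> by blast
    finally have "V \<subseteq> (\<Union>i\<in>{0, 1, 2}. sg_map i ` C)" .
    moreover have "closed (\<Union>i\<in>{0, 1, 2}. sg_map i ` C)"
      by (intro closed_UN ballI compact_imp_closed compact_continuous_image continuous_on_sg_map \<open>compact C\<close>) simp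
    ultimately show ?thesis unfolding C_def V_def[symmetric] by (rule closure_minimal)
  qed
  ultimately show ?thesis using \<open>compact C\<close> \<open>C \<noteq> {}\<close> by blast
qed

lemma sierpinski_gasket_unique:
  assumes "K \<noteq> {}" "compact K" "K = (\<Union>i\<in>{0, 1, 2}. sg_map i ` K)"
    and "K' \<noteq> {}" "compact K'" "K' = (\<Union>i\<in>{0, 1, 2}. sg_map i ` K')"
  shows "K = K'"
proof -
  have sub: "A \<subseteq> B"
    if A: "compact A" "A = (\<Union>i\<in>{0, 1, 2}. sg_map i ` A)"
      and B: "B \<noteq> {}" "compact B" "B = (\<Union>i\<in>{0, 1, 2}. sg_map i ` B)" for A B
  proof (rule subset_of_sg_invariant)
    show "closed B" by (rule compact_imp_closed) (rule B)
    show "B \<noteq> {}" by (rule B)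
    show "bounded A" by (rule compact_imp_bounded) (rule A)
    show "A \<subseteq> (\<Union>i\<in>{0, 1, 2}. sg_map i ` A)" by (rule equalityD1) (rule A)
    fix i :: nat assume "i \<in> {0, 1, 2}"
    then have "sg_map i ` B \<subseteq> (\<Union>i\<in>{0, 1, 2}. sg_map i ` B)" by (rule UN_upper)
    also have "\<dots> = B" by (rule B(3)[symmetric])
    finally show "sg_map i ` B \<subseteq> B" .
  qed
  show ?thesis
    by (rule subset_antisym; rule sub) (rule assms)+
qed

lemma sierpinski_gasket_eq: "sierpinski_gasket = closure (\<Union>m. sg_verts m)"
  unfolding sierpinski_gasket_def
proof (rule the_equality, rule sierpinski_gasket_exists)
  fix K :: "(real \<times> real) set"
  assume K: "K \<noteq> {} \<and> compact K \<and> K = (\<Union>i\<in>{0, 1, 2}. sg_map i ` K)"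
  note C = sierpinski_gasket_exists
  show "K = closure (\<Union>m. sg_verts m)"
    by (rule sierpinski_gasket_unique)
      (rule K[THEN conjunct1] K[THEN conjunct2, THEN conjunct1] K[THEN conjunct2, THEN conjunct2]
        C[THEN conjunct1] C[THEN conjunct2, THEN conjunct1] C[THEN conjunct2, THEN conjunct2])+
qed

lemma compact_gasket: "compact sierpinski_gasket"
  and gasket_decomp: "sierpinski_gasket = (\<Union>i\<in>{0, 1, 2}. sg_map i ` sierpinski_gasket)"
  unfolding sierpinski_gasket_eq
  by (rule sierpinski_gasket_exists[THEN conjunct2, THEN conjunct1]
      sierpinski_gasket_exists[THEN conjunct2, THEN conjunct2])+

lemma sg_verts_subset_gasket: "sg_verts m \<subseteq> sierpinski_gasket"
  unfolding sierpinski_gasket_eq by (rule order_trans[OF UN_upper closure_subset]) simp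

lemma sg_vertex_in_gasket: "i \<in> {0, 1, 2} \<Longrightarrow> sg_vertex i \<in> sierpinski_gasket"
  using sg_verts_subset_gasket[of 0] by auto

lemma gasket_subset_triangle: "sierpinski_gasket \<subseteq> triangle"
  unfolding sierpinski_gasket_eq
  by (intro closure_minimal closed_triangle) (use sg_verts_subset_triangle in blast)

lemma sg_map_in_gasket:
  "i \<in> {0, 1, 2} \<Longrightarrow> z \<in> sierpinski_gasket \<Longrightarrow> sg_map i z \<in> sierpinski_gasket"
  using gasket_decomp by blast

lemma gasket_cases:
  assumes "z \<in> sierpinski_gasket"
  obtains i z' where "i \<in> {0, 1, 2}" "z' \<in> sierpinski_gasket" "z = sg_map i z'"
  using assms gasket_decomp by blast

lemma sg_map_bottom:
  "sg_map 0 (x, 0) = (x / 2, 0)" "sg_map (Suc 0) (x, 0) = ((x + 1) / 2, 0)"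
  by (auto simp: sg_map_eq sg_vertex_def)

lemma bottom_in_gasket:
  assumes "x \<in> {0..1}"
  shows "(x, 0) \<in> sierpinski_gasket"
proof -
  have "{0..1} \<times> {0} \<subseteq> sierpinski_gasket"
  proof (rule subset_of_sg_invariant)
    show "{0..1::real} \<times> {0::real} \<subseteq> (\<Union>i\<in>{0, 1, 2}. sg_map i ` ({0..1} \<times> {0}))"
    proof clarify
      fix x :: real assume x: "x \<in> {0..1}"
      show "(x, 0) \<in> (\<Union>i\<in>{0, 1, 2}. sg_map i ` ({0..1} \<times> {0}))"
      proof (cases "x \<le> 1 / 2")
        case True
        then have "(x, 0) = sg_map 0 (2 * x, 0)" by (simp add: sg_map_bottom)
        then show ?thesis using x True by (intro UN_I[of 0] image_eqI) auto
      next
        case False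
        then have "(x, 0) = sg_map 1 (2 * x - 1, 0)" by (simp add: sg_map_bottom)
        then show ?thesis using x False by (intro UN_I[of 1] image_eqI) auto
      qed
    qed
    show "closed sierpinski_gasket" by (rule compact_imp_closed) (rule compact_gasket)
    show "sierpinski_gasket \<noteq> {}" using sg_vertex_in_gasket[of 0] by auto
    show "bounded ({0..1::real} \<times> {0::real})" by (intro bounded_Times) auto
  qed (use sg_map_in_gasket in blast)
  then show ?thesis using assms by auto
qed

section \<open>Energies on the gasket\<close>

definition triangle_energy :: "real \<Rightarrow> real \<Rightarrow> real \<Rightarrow> real" where
  "triangle_energy a b c = (a - b)\<^sup>2 + (b - c)\<^sup>2 + (c - a)\<^sup>2"

lemma triangle_energy_nonneg: "0 \<le> triangle_energy a b c"
  by (simp add: triangle_energy_def)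

lemma sg_edges_Suc: "sg_edges (Suc m) = (\<Union>i\<in>{0, 1, 2}. map_prod (sg_map i) (sg_map i) ` sg_edges m)"
proof
  show "sg_edges (Suc m) \<subseteq> (\<Union>i\<in>{0, 1, 2}. map_prod (sg_map i) (sg_map i) ` sg_edges m)"
  proof
    fix e assume "e \<in> sg_edges (Suc m)"
    then obtain k p q where "e = map_prod (sg_map k) (sg_map k) (p, q)" "(p, q) \<in> sg_edges m" "k \<in> {0, 1, 2}"
      unfolding sg_edges.simps map_prod_simp by blast
    then show "e \<in> (\<Union>i\<in>{0, 1, 2}. map_prod (sg_map i) (sg_map i) ` sg_edges m)" by blast
  qed
  show "(\<Union>i\<in>{0, 1, 2}. map_prod (sg_map i) (sg_map i) ` sg_edges m) \<subseteq> sg_edges (Suc m)"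
  proof
    fix e assume "e \<in> (\<Union>i\<in>{0, 1, 2}. map_prod (sg_map i) (sg_map i) ` sg_edges m)"
    then obtain k d where "k \<in> {0, 1, 2}" "d \<in> sg_edges m" "e = map_prod (sg_map k) (sg_map k) d"
      by (metis (no_types, lifting) UN_E imageE)
    then have "e = (sg_map k (fst d), sg_map k (snd d))" "(fst d, snd d) \<in> sg_edges m" "k \<in> {0, 1, 2}"
      by (simp_all add: map_prod_def case_prod_beta)
    then show "e \<in> sg_edges (Suc m)" unfolding sg_edges.simps by blast
  qed
qed

lemma sg_edges_subset: "sg_edges m \<subseteq> sg_verts m \<times> sg_verts m"
proof (induction m)
  case (Suc m)
  then show ?case by auto
qed auto

lemma inj_sg_map: "inj (sg_map i)"
  using dist_sg_map by (intro injI) (metis dist_eq_0_iff divide_eq_0_iff zero_neq_numeral)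

lemma finite_sg_edges: "finite (sg_edges m)"
proof (induction m)
  case 0
  have "sg_edges 0 = (sg_vertex ` {0, 1, 2}) \<times> (sg_vertex ` {0, 1, 2})" by auto
  then show ?case by simp
next
  case (Suc m)
  then show ?case unfolding sg_edges_Suc by simp
qed

lemma sg_level_energy_0:
  "sg_level_energy 0 u = triangle_energy (u (sg_vertex 0)) (u (sg_vertex 1)) (u (sg_vertex 2))"
proof -
  have inj: "inj_on sg_vertex {0, 1, 2}" by (auto simp: inj_on_def sg_vertex_def)
  have "sg_edges 0 = (sg_vertex ` {0, 1, 2}) \<times> (sg_vertex ` {0, 1, 2})" by auto
  then have "(\<Sum>(p, q)\<in>sg_edges 0. \<bar>u p - u q\<bar>\<^sup>2)
      = (\<Sum>i\<in>{0, 1, 2}. \<Sum>j\<in>{0, 1, 2}. (u (sg_vertex i) - u (sg_vertex j))\<^sup>2)"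
    by (simp only: sum.cartesian_product[symmetric] sum.reindex[OF inj] o_def power2_abs)
  then show ?thesis
    by (simp add: sg_level_energy_def triangle_energy_def power2_commute)
qed

lemma sg_level_energy_nonneg: "0 \<le> sg_level_energy m u"
  unfolding sg_level_energy_def by (intro mult_nonneg_nonneg sum_nonneg) auto

lemma sg_level_energy_cong:
  assumes "\<And>z. z \<in> sierpinski_gasket \<Longrightarrow> u z = v z"
  shows "sg_level_energy m u = sg_level_energy m v"
proof -
  have "(\<Sum>(p, q)\<in>sg_edges m. \<bar>u p - u q\<bar>\<^sup>2) = (\<Sum>(p, q)\<in>sg_edges m. \<bar>v p - v q\<bar>\<^sup>2)"
    using assms sg_edges_subset[of m] sg_verts_subset_gasket[of m]
    by (intro sum.cong refl) (auto simp: subset_iff)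
  then show ?thesis by (simp add: sg_level_energy_def)
qed

text \<open>Distinct cells share at most one vertex, so a nondegenerate edge belongs to exactly one of
  the three subcells and the sum over the edge set splits; the degenerate edges contribute zero.\<close>

lemma sg_level_energy_Suc:
  "sg_level_energy (Suc m) u = 5 / 3 * (\<Sum>i\<in>{0, 1, 2}. sg_level_energy m (u \<circ> sg_map i))"
proof -
  define off where "off m = sg_edges m - Id" for m
  define G where "G i = map_prod (sg_map i) (sg_map i)" for i
  define h where "h u e = (case e of (p, q) \<Rightarrow> \<bar>u p - u q\<bar>\<^sup>2)"
    for u :: "real \<times> real \<Rightarrow> real" and e
  have fin: "finite (off m)" for m by (simp add: off_def finite_sg_edges)
  have sum_off: "(\<Sum>(p, q)\<in>sg_edges m. \<bar>u p - u q\<bar>\<^sup>2) = sum (h u) (off m)" for m u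
    unfolding h_def by (rule sum.mono_neutral_right) (auto simp: off_def finite_sg_edges)
  have inj: "inj_on (G i) S" for i S
    using inj_sg_map[of i] by (auto simp: G_def inj_on_def)
  have off_Suc: "off (Suc m) = (\<Union>i\<in>{0, 1, 2}. G i ` off m)"
  proof -
    have Id_iff: "G i x \<in> Id \<longleftrightarrow> x \<in> Id" for i x
      by (cases x) (simp add: G_def inj_eq[OF inj_sg_map])
    have "G i ` sg_edges m - Id = G i ` (sg_edges m - Id)" for i
    proof (intro set_eqI iffI)
      fix y assume "y \<in> G i ` sg_edges m - Id"
      then obtain x where "x \<in> sg_edges m" "y = G i x" "y \<notin> Id" by (metis DiffE imageE)
      then have "x \<in> sg_edges m - Id" using Id_iff[of i x] by (metis DiffI)
      then show "y \<in> G i ` (sg_edges m - Id)" unfolding \<open>y = G i x\<close> by (rule imageI)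
    next
      fix y assume "y \<in> G i ` (sg_edges m - Id)"
      then obtain x where x: "x \<in> sg_edges m - Id" "y = G i x" by (metis imageE)
      then have "y \<notin> Id" "y \<in> G i ` sg_edges m" using Id_iff[of i x] by (metis DiffE, metis DiffE imageI)
      then show "y \<in> G i ` sg_edges m - Id" by (metis DiffI)
    qed
    moreover have "off (Suc m) = (\<Union>i\<in>{0, 1, 2}. G i ` sg_edges m - Id)"
      unfolding off_def sg_edges_Suc G_def by (simp only: UN_simps)
    ultimately show ?thesis by (simp only: off_def)
  qed
  have disj: "G i ` off m \<inter> G j ` off m = {}" if "i \<in> {0, 1, 2}" "j \<in> {0, 1, 2}" "i \<noteq> j" for i j
  proof (rule ccontr)
    assume "G i ` off m \<inter> G j ` off m \<noteq> {}"
    then obtain y where y: "y \<in> G i ` off m" "y \<in> G j ` off m" by (meson disjoint_iff)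
    obtain x where x: "x \<in> off m" "y = G i x" using y(1) by (rule imageE)
    obtain x' where x': "x' \<in> off m" "y = G j x'" using y(2) by (rule imageE)
    have "G i x = G j x'" using x x' by simp
    then have eq: "sg_map i (fst x) = sg_map j (fst x')" "sg_map i (snd x) = sg_map j (snd x')"
      by (simp_all add: G_def map_prod_def case_prod_beta)
    have "off m \<subseteq> triangle \<times> triangle"
      using sg_edges_subset[of m] sg_verts_subset_triangle[of m] by (auto simp: off_def)
    from subsetD[OF this x(1)] subsetD[OF this x'(1)]
    have "fst x \<in> triangle" "fst x' \<in> triangle" "snd x \<in> triangle" "snd x' \<in> triangle"
      by (simp_all only: mem_Times_iff)
    then have "fst x = snd x"
      using sg_map_overlap[OF that _ _ eq(1)] sg_map_overlap[OF that _ _ eq(2)] by simp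
    then have "x \<in> Id" by (metis pair_in_Id_conv prod.collapse)
    then show False using x by (simp add: off_def)
  qed
  have "sum (h u) (off (Suc m)) = (\<Sum>i\<in>{0, 1, 2}. sum (h u) (G i ` off m))"
    unfolding off_Suc by (rule sum.UNION_disjoint) (use fin disj in auto)
  also have "\<dots> = (\<Sum>i\<in>{0, 1, 2}. sum (h (u \<circ> sg_map i)) (off m))"
  proof (rule sum.cong[OF refl])
    fix i
    have "sum (h u) (G i ` off m) = sum (h u \<circ> G i) (off m)" by (rule sum.reindex[OF inj])
    also have "h u \<circ> G i = h (u \<circ> sg_map i)" by (auto simp: h_def G_def)
    finally show "sum (h u) (G i ` off m) = sum (h (u \<circ> sg_map i)) (off m)" .
  qed
  finally show ?thesis
    unfolding sg_level_energy_def sum_off sum_distrib_left[symmetric] by simp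
qed

text \<open>The right-hand side is a quadratic polynomial in the values \<open>x, y, z\<close> at the midpoints.  It is
  minimal at the harmonic values, where it equals the left-hand side, and the excess is an energy
  of the deviations from these values.\<close>

lemma triangle_energy_subdivision:
  "triangle_energy a b c \<le> 5 / 3 *
     (triangle_energy a x z + triangle_energy x b y + triangle_energy z y c)"
proof -
  \<comment> \<open>The deviations from the harmonic midpoint values.\<close>
  define \<xi> where "\<xi> = x - (2 * a + 2 * b + c) / 5"
  define \<eta> where "\<eta> = y - (a + 2 * b + 2 * c) / 5"
  define \<zeta> where "\<zeta> = z - (2 * a + b + 2 * c) / 5"
  have "5 / 3 * (triangle_energy a x z + triangle_energy x b y + triangle_energy z y c)
    = triangle_energy a b c
      + 5 / 3 * (triangle_energy 0 \<xi> \<zeta> + triangle_energy \<xi> 0 \<eta> + triangle_energy \<zeta> \<eta> 0)"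
    by (simp add: triangle_energy_def \<xi>_def \<eta>_def \<zeta>_def power2_eq_square field_simps)
  moreover have "0 \<le> 5 / 3 * (triangle_energy 0 \<xi> \<zeta> + triangle_energy \<xi> 0 \<eta> + triangle_energy \<zeta> \<eta> 0)"
    by (intro mult_nonneg_nonneg add_nonneg_nonneg triangle_energy_nonneg) simp
  ultimately show ?thesis by (simp only: le_add_same_cancel1)
qed

lemma sg_level_energy_mono_Suc: "sg_level_energy m u \<le> sg_level_energy (Suc m) u"
proof (induction m arbitrary: u)
  case 0
  have "sg_level_energy (Suc 0) u = 5 / 3 *
    (triangle_energy (u (sg_vertex 0)) (u (sg_map 0 (sg_vertex 1))) (u (sg_map 0 (sg_vertex 2)))
    + triangle_energy (u (sg_map 0 (sg_vertex 1))) (u (sg_vertex 1)) (u (sg_map 1 (sg_vertex 2)))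
    + triangle_energy (u (sg_map 0 (sg_vertex 2))) (u (sg_map 1 (sg_vertex 2))) (u (sg_vertex 2)))"
    unfolding sg_level_energy_Suc sg_level_energy_0
    using sg_map_vertex_swap[of 1 0] sg_map_vertex_swap[of 2 0] sg_map_vertex_swap[of 2 1]
    by (simp add: sg_map_vertex_self)
  then show ?case by (simp only: sg_level_energy_0 triangle_energy_subdivision)
next
  case (Suc m)
  show ?case
    by (subst sg_level_energy_Suc[of m u], subst sg_level_energy_Suc[of "Suc m" u])
      (intro mult_left_mono sum_mono Suc.IH, simp)
qed

lemma incseq_sg_level_energy: "incseq (\<lambda>m. sg_level_energy m u)"
  by (intro incseq_SucI sg_level_energy_mono_Suc)

text \<open>The level energies increase, so boundedness is enough for convergence.\<close>

lemma sg_domI: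
  assumes "continuous_on sierpinski_gasket u" "\<And>m. sg_level_energy m u \<le> B"
  shows "u \<in> sg_dom" "sg_energy u \<le> B"
proof -
  obtain L where L: "(\<lambda>m. sg_level_energy m u) \<longlonglongrightarrow> L"
    using incseq_convergent[OF incseq_sg_level_energy, of u B] assms(2) by blast
  then show "u \<in> sg_dom" using assms(1) by (auto simp: sg_dom_def convergent_def)
  show "sg_energy u \<le> B"
    using LIMSEQ_le_const2[OF L, of B] limI[OF L] assms(2) by (auto simp: sg_energy_def)
qed

lemma sg_dom_tendsto:
  assumes "u \<in> sg_dom"
  shows "(\<lambda>m. sg_level_energy m u) \<longlonglongrightarrow> sg_energy u"
  using assms by (simp add: sg_dom_def sg_energy_def convergent_LIMSEQ_iff)

lemma sg_level_energy_le_sg_energy: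
  assumes "u \<in> sg_dom"
  shows "sg_level_energy m u \<le> sg_energy u"
  using incseq_le[OF incseq_sg_level_energy sg_dom_tendsto[OF assms]] .

lemma sg_energy_nonneg: "u \<in> sg_dom \<Longrightarrow> 0 \<le> sg_energy u"
  using sg_level_energy_le_sg_energy sg_level_energy_nonneg order_trans by blast

lemma sg_dom_sg_map:
  assumes "u \<in> sg_dom" "i \<in> {0, 1, 2}"
  shows "u \<circ> sg_map i \<in> sg_dom" 
proof (rule sg_domI)
  show "continuous_on sierpinski_gasket (u \<circ> sg_map i)"
    using assms sg_map_in_gasket
    by (intro continuous_on_compose continuous_on_sg_map)
      (auto simp: sg_dom_def intro: continuous_on_subset)
  fix m
  have "sg_level_energy m (u \<circ> sg_map i) \<le> (\<Sum>i\<in>{0, 1, 2}. sg_level_energy m (u \<circ> sg_map i))"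
    by (rule member_le_sum[of i]) (use assms sg_level_energy_nonneg in auto)
  also have "\<dots> = 3 / 5 * sg_level_energy (Suc m) u" by (simp add: sg_level_energy_Suc)
  also have "\<dots> \<le> 3 / 5 * sg_energy u"
    using sg_level_energy_le_sg_energy[OF assms(1)] by (intro mult_left_mono) auto
  finally show "sg_level_energy m (u \<circ> sg_map i) \<le> 3 / 5 * sg_energy u" .
qed

lemma sg_energy_decomp:
  assumes "u \<in> sg_dom"
  shows "sg_energy u = 5 / 3 * (\<Sum>i\<in>{0, 1, 2}. sg_energy (u \<circ> sg_map i))"
proof -
  have "(\<lambda>m. 5 / 3 * (\<Sum>i\<in>{0, 1, 2}. sg_level_energy m (u \<circ> sg_map i)))
    \<longlonglongrightarrow> 5 / 3 * (\<Sum>i\<in>{0, 1, 2}. sg_energy (u \<circ> sg_map i))"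
    by (intro tendsto_intros sg_dom_tendsto sg_dom_sg_map assms)
  then have "(\<lambda>m. sg_level_energy (Suc m) u) \<longlonglongrightarrow> 5 / 3 * (\<Sum>i\<in>{0, 1, 2}. sg_energy (u \<circ> sg_map i))"
    by (simp only: sg_level_energy_Suc)
  moreover have "(\<lambda>m. sg_level_energy (Suc m) u) \<longlonglongrightarrow> sg_energy u"
    by (rule LIMSEQ_Suc[OF sg_dom_tendsto[OF assms]])
  ultimately show ?thesis using LIMSEQ_unique by blast
qed

section \<open>Functions on the gasket from self-similar boundary data\<close>

definition dyadic_half :: "nat \<Rightarrow> (real \<Rightarrow> real) \<Rightarrow> real \<Rightarrow> real" where
  "dyadic_half i u = (\<lambda>x. u ((x + real i) / 2))"

definition avg :: "(real \<Rightarrow> real) \<Rightarrow> real" where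
  "avg u = integral {0..1} u"

text \<open>Prescriptions for a function on a cell that are inherited by the three subcells.
  \<open>Bottom u\<close> stands for the extension of \<open>u\<close>, given on the bottom edge, and \<open>Harm a b c\<close> for the
  harmonic function with the given corner values.  Treating both together gives the existence and
  continuity of the extension in one construction.\<close>

datatype boundary_data = Bottom "real \<Rightarrow> real" | Harm real real real

fun corner_val :: "nat \<Rightarrow> boundary_data \<Rightarrow> real" where
  "corner_val i (Bottom u) = (if i = 0 then u 0 else if i = 1 then u 1 else avg u)"
| "corner_val i (Harm a b c) = (if i = 0 then a else if i = 1 then b else c)"

text \<open>The prescription on the \<open>i\<close>-th subcell.  In the harmonic case the midpoint values follow
  the \<open>2/5, 2/5, 1/5\<close> rule.  The upper subcell of a bottom cell has the top vertices of the two lower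
  subcells as its lower corners, whence the three means.\<close>

fun sub_data :: "nat \<Rightarrow> boundary_data \<Rightarrow> boundary_data" where
  "sub_data i (Bottom u) = (if i = 0 then Bottom (dyadic_half 0 u) else if i = 1 then Bottom (dyadic_half 1 u)
     else Harm (avg (dyadic_half 0 u)) (avg (dyadic_half 1 u)) (avg u))"
| "sub_data i (Harm a b c) =
     (let x = (2 * a + 2 * b + c) / 5; y = (a + 2 * b + 2 * c) / 5; z = (2 * a + b + 2 * c) / 5
      in if i = 0 then Harm a x z else if i = 1 then Harm x b y else Harm z y c)"

fun cont_data :: "boundary_data \<Rightarrow> bool" where
  "cont_data (Bottom u) = continuous_on UNIV u"
| "cont_data (Harm a b c) = True"

text \<open>Bounds for the data that are inherited by subcells and also bound the function that the data
  describe.\<close>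

fun values_in :: "boundary_data \<Rightarrow> real \<Rightarrow> real \<Rightarrow> bool" where
  "values_in (Bottom u) l h = (\<forall>x\<in>{0..1}. l \<le> u x \<and> u x \<le> h)"
| "values_in (Harm a b c) l h = (a \<in> {l..h} \<and> b \<in> {l..h} \<and> c \<in> {l..h})"

text \<open>A qualitative substitute for a rate of convergence, which is all that the arbitrary modulus of
  continuity of a function on the bottom edge allows.\<close>

fun narrow :: "nat \<Rightarrow> boundary_data \<Rightarrow> real \<Rightarrow> bool" where
  "narrow 0 d e = (\<exists>l h. values_in d l h \<and> h - l \<le> e)"
| "narrow (Suc n) d e = (\<forall>i\<in>{0, 1, 2}. narrow n (sub_data i d) e)"

lemma continuous_on_dyadic_half:
  "continuous_on UNIV u \<Longrightarrow> continuous_on UNIV (dyadic_half i u)"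
  unfolding dyadic_half_def
  by (rule continuous_on_compose2[of UNIV u]) (auto intro!: continuous_intros)

lemma half_mem: "x \<in> {0..1} \<Longrightarrow> i \<in> {0, 1} \<Longrightarrow> (x + real i) / 2 \<in> {0..1}"
  by auto

lemma avg_bounds:
  assumes "continuous_on UNIV u" "\<And>x. x \<in> {0..1} \<Longrightarrow> l \<le> u x \<and> u x \<le> h"
  shows "l \<le> avg u" "avg u \<le> h"
proof -
  have i: "u integrable_on {0..1}"
    by (rule integrable_continuous_interval, rule continuous_on_subset[OF assms(1)]) simp
  have "integral {0..1} (\<lambda>x::real. l) \<le> avg u"
    unfolding avg_def by (rule integral_le) (use assms(2) i in auto)
  moreover have "avg u \<le> integral {0..1} (\<lambda>x::real. h)"
    unfolding avg_def by (rule integral_le) (use assms(2) i in auto)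
  ultimately show "l \<le> avg u" "avg u \<le> h" by simp_all
qed

lemma cont_sub_data: "cont_data d \<Longrightarrow> cont_data (sub_data i d)"
  by (cases d) (auto simp: continuous_on_dyadic_half Let_def)

lemma values_in_corner: "cont_data d \<Longrightarrow> values_in d l h \<Longrightarrow> corner_val i d \<in> {l..h}"
  by (cases d) (auto intro!: avg_bounds)

lemma values_in_sub_data:
  assumes "cont_data d" "values_in d l h"
  shows "values_in (sub_data i d) l h"
proof (cases d)
  case (Bottom u)
  have u: "continuous_on UNIV u" "\<And>x. x \<in> {0..1} \<Longrightarrow> l \<le> u x \<and> u x \<le> h" using assms Bottom by auto
  have h: "l \<le> dyadic_half j u x \<and> dyadic_half j u x \<le> h" if "x \<in> {0..1}" "j \<in> {0, 1}" for x j
    unfolding dyadic_half_def by (rule u(2), rule half_mem) (use that in auto)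
  have "l \<le> avg (dyadic_half j u) \<and> avg (dyadic_half j u) \<le> h" if "j \<in> {0, 1}" for j
    using avg_bounds[of "dyadic_half j u" l h] continuous_on_dyadic_half[OF u(1)] h that by blast
  moreover have "l \<le> avg u \<and> avg u \<le> h" using avg_bounds[of u l h] u by blast
  ultimately show ?thesis using h by (simp add: Bottom)
next
  case (Harm a b c)
  then show ?thesis using assms by (auto simp: Let_def)
qed

lemma corner_val_sub_data_self: "i \<in> {0, 1, 2} \<Longrightarrow> corner_val i (sub_data i d) = corner_val i d"
  by (cases d) (auto simp: Let_def dyadic_half_def)

text \<open>The compatibility that makes pieces on neighbouring cells agree at their common vertex.\<close>

lemma corner_val_sub_data_swap: "i \<in> {0, 1, 2} \<Longrightarrow> j \<in> {0, 1, 2} \<Longrightarrow> corner_val j (sub_data i d) = corner_val i (sub_data j d)"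
  by (cases d) (auto simp: Let_def dyadic_half_def)

lemma narrow_Suc: "cont_data d \<Longrightarrow> narrow n d e \<Longrightarrow> narrow (Suc n) d e"
proof (induction n arbitrary: d)
  case 0
  then show ?case using values_in_sub_data by (auto; blast)
next
  case (Suc n)
  then show ?case using cont_sub_data by (metis narrow.simps(2))
qed

lemma narrow_mono:
  assumes "cont_data d" "narrow n d e" "n \<le> m"
  shows "narrow m d e"
  using assms(3) by (induction m rule: dec_induct) (use assms narrow_Suc in blast)+

lemma narrow_Harm:
  assumes "values_in (Harm a b c) l h" "(3 / 5) ^ n * (h - l) \<le> e"
  shows "narrow n (Harm a b c) e"
  using assms
proof (induction n arbitrary: a b c l h)
  case 0
  then show ?case by auto
next
  case (Suc n)
  have abc: "a \<in> {l..h}" "b \<in> {l..h}" "c \<in> {l..h}" using Suc.prems by auto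
  have step: "narrow n (Harm a' b' c') e" if "values_in (Harm a' b' c') l' h'" "h' - l' = 3 / 5 * (h - l)"
    for a' b' c' l' h'
  proof (rule Suc.IH[OF that(1)])
    have "(3 / 5) ^ n * (h' - l') = (3 / 5) ^ Suc n * (h - l)" unfolding that(2) by simp
    then show "(3 / 5) ^ n * (h' - l') \<le> e" using Suc.prems(2) by (simp only:)
  qed
  \<comment> \<open>The values at the midpoints put weight 2/5 on the common corner_val.\<close>
  have "narrow n (sub_data 0 (Harm a b c)) e"
    unfolding sub_data.simps Let_def
    by (simp, rule step[of _ _ _ "2 / 5 * a + 3 / 5 * l" "2 / 5 * a + 3 / 5 * h"]) (use abc in auto)
  moreover have "narrow n (sub_data (Suc 0) (Harm a b c)) e"
    unfolding sub_data.simps Let_def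
    by (simp, rule step[of _ _ _ "2 / 5 * b + 3 / 5 * l" "2 / 5 * b + 3 / 5 * h"]) (use abc in auto)
  moreover have "narrow n (sub_data 2 (Harm a b c)) e"
    unfolding sub_data.simps Let_def
    by (simp, rule step[of _ _ _ "2 / 5 * c + 3 / 5 * l" "2 / 5 * c + 3 / 5 * h"]) (use abc in auto)
  ultimately show ?case by auto
qed

text \<open>After \<open>N\<close> halvings the bottom cells are narrow by the modulus of continuity of \<open>u\<close>.  A harmonic
  cell split off at an earlier stage starts with values in the range of \<open>u\<close> and shrinks by the
  factor \<open>3/5\<close> in each of the remaining steps, of which there are at least \<open>k\<close>.\<close>

lemma narrow_Bottom:
  assumes "continuous_on UNIV u"
    and "\<And>x y. x \<in> {0..1} \<Longrightarrow> y \<in> {0..1} \<Longrightarrow> \<bar>x - y\<bar> \<le> 1 / 2 ^ N \<Longrightarrow> \<bar>u x - u y\<bar> \<le> e"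
    and "values_in (Bottom u) l h" "(3 / 5) ^ k * (h - l) \<le> e"
  shows "narrow (N + k) (Bottom u) (2 * e)"
  using assms
proof (induction N arbitrary: u)
  case 0
  have "values_in (Bottom u) (u 0 - e) (u 0 + e)"
    unfolding values_in.simps
  proof
    fix x :: real assume "x \<in> {0..1}"
    then show "u 0 - e \<le> u x \<and> u x \<le> u 0 + e" using 0(2)[of x 0] by auto
  qed
  then have "narrow 0 (Bottom u) (2 * e)" unfolding narrow.simps
    by (intro exI[of _ "u 0 - e"] exI[of _ "u 0 + e"]) simp
  then show ?case using 0(1) narrow_mono[of "Bottom u" 0 "2 * e" k] by simp
next
  case (Suc N)
  have "h \<ge> l" using Suc.prems(3) by fastforce
  have "0 \<le> (3 / 5 :: real) ^ k * (h - l)" using \<open>h \<ge> l\<close> by simp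
  then have "e \<ge> 0" using Suc.prems(4) by linarith
  have b: "narrow (N + k) (Bottom (dyadic_half i u)) (2 * e)" if i: "i \<in> {0, 1}" for i
  proof (rule Suc.IH)
    show "continuous_on UNIV (dyadic_half i u)" by (rule continuous_on_dyadic_half) fact
    show "values_in (Bottom (dyadic_half i u)) l h"
      using values_in_sub_data[of "Bottom u" l h i] Suc.prems i by (auto split: if_splits)
    fix x y :: real
    assume xy: "x \<in> {0..1}" "y \<in> {0..1}" "\<bar>x - y\<bar> \<le> 1 / 2 ^ N"
    have "\<bar>(x + real i) / 2 - (y + real i) / 2\<bar> = \<bar>x - y\<bar> / 2"
      by (simp add: diff_divide_distrib[symmetric])
    then show "\<bar>dyadic_half i u x - dyadic_half i u y\<bar> \<le> e"
      unfolding dyadic_half_def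
      by (intro Suc.prems(2) half_mem) (use xy i in auto)
  qed (use Suc.prems in auto)
  have "(3 / 5) ^ (N + k) * (h - l) \<le> (3 / 5) ^ k * (h - l)"
    using \<open>h \<ge> l\<close> by (intro mult_right_mono power_decreasing) auto
  then have "(3 / 5) ^ (N + k) * (h - l) \<le> 2 * e" using Suc.prems(4) \<open>e \<ge> 0\<close> by linarith
  then have "narrow (N + k) (sub_data 2 (Bottom u)) (2 * e)"
    using values_in_sub_data[of "Bottom u" l h 2] Suc.prems(1,3) narrow_Harm by (simp del: values_in.simps(2))
  then show ?case using b[of 0] b[of 1] by auto
qed

lemma narrow_exists:
  assumes "cont_data d" "e > 0"
  obtains n where "narrow n d e"
proof (cases d)
  case (Bottom u)
  have u: "continuous_on UNIV u" using assms Bottom by simp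
  then have c: "continuous_on {0..1} u" by (rule continuous_on_subset) simp
  have "uniformly_continuous_on {0..1} u"
    by (rule compact_uniformly_continuous[OF c]) simp
  then obtain \<delta> where \<delta>: "\<delta> > 0" "\<And>x y. x \<in> {0..1} \<Longrightarrow> y \<in> {0..1} \<Longrightarrow> dist x y < \<delta> \<Longrightarrow> dist (u x) (u y) < e / 2"
    unfolding uniformly_continuous_on_def using \<open>e > 0\<close> by (metis half_gt_zero)
  have "(\<lambda>N. 1 / 2 ^ N :: real) \<longlonglongrightarrow> 0" by real_asymp
  then have "eventually (\<lambda>N. 1 / 2 ^ N < \<delta>) sequentially" using \<delta>(1) order_tendstoD(2) by blast
  then obtain N :: nat where N: "1 / 2 ^ N < \<delta>" by (auto simp: eventually_sequentially)
  have "compact (u ` {0..1})" using c by (intro compact_continuous_image) auto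
  then have "bounded (u ` {0..1})" by (rule compact_imp_bounded)
  then obtain B where "\<forall>x\<in>{0..1}. \<bar>u x\<bar> \<le> B" by (auto simp: bounded_iff)
  then have B: "- B \<le> u x \<and> u x \<le> B" if "x \<in> {0..1}" for x using that by (meson abs_le_D1 abs_le_D2 minus_le_iff)
  have "(\<lambda>k. (3 / 5) ^ k * (B - - B)) \<longlonglongrightarrow> 0" by real_asymp
  then have "eventually (\<lambda>k. (3 / 5) ^ k * (B - - B) < e / 2) sequentially"
    using \<open>e > 0\<close> order_tendstoD(2) half_gt_zero by blast
  then obtain k :: nat where k: "(3 / 5) ^ k * (B - - B) < e / 2"
    by (auto simp: eventually_sequentially)
  have "narrow (N + k) (Bottom u) (2 * (e / 2))"
  proof (rule narrow_Bottom[OF u])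
    show "values_in (Bottom u) (- B) B" using B by simp
    fix x y :: real
    assume "x \<in> {0..1}" "y \<in> {0..1}" "\<bar>x - y\<bar> \<le> 1 / 2 ^ N"
    then show "\<bar>u x - u y\<bar> \<le> e / 2" using \<delta>(2)[of x y] N by (auto simp: dist_real_def)
  qed (use k in auto)
  then show ?thesis using that Bottom by auto
next
  case (Harm a b c)
  define l where "l = min a (min b c)"
  define h where "h = max a (max b c)"
  have "(\<lambda>k. (3 / 5) ^ k * (h - l)) \<longlonglongrightarrow> 0" by real_asymp
  then have "eventually (\<lambda>k. (3 / 5) ^ k * (h - l) < e) sequentially"
    using \<open>e > 0\<close> order_tendstoD(2) by blast
  then obtain k where "(3 / 5) ^ k * (h - l) < e" by (auto simp: eventually_sequentially)
  moreover have "values_in (Harm a b c) l h" by (auto simp: l_def h_def min_def max_def)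
  ultimately show ?thesis using that narrow_Harm[of a b c l h k e] Harm by simp
qed

definition expand :: "nat \<Rightarrow> real \<times> real \<Rightarrow> real \<times> real" where
  "expand i z = 2 *\<^sub>R z - sg_vertex i"

lemma expand_sg_map: "expand i (sg_map i z) = z"
  by (simp add: expand_def sg_map_eq)

text \<open>The function that follows the data for \<open>n\<close> levels and is affine on each cell of level \<open>n\<close>.\<close>

primrec approx :: "nat \<Rightarrow> boundary_data \<Rightarrow> real \<times> real \<Rightarrow> real" where
  "approx 0 d z = (\<Sum>i\<in>{0, 1, 2}. bary i z * corner_val i d)"
| "approx (Suc n) d z =
    (if 1 / 2 \<le> bary 0 z then approx n (sub_data 0 d) (expand 0 z)
     else if 1 / 2 \<le> bary 1 z then approx n (sub_data 1 d) (expand 1 z)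
     else approx n (sub_data 2 d) (expand 2 z))"

text \<open>A point can lie in two subcells only if it is their common vertex, and there the two branches
  agree by \<open>corner_val_sub_data_swap\<close>.\<close>

lemma approx_Suc_sg_map_aux:
  assumes "\<And>i d. i \<in> {0, 1, 2} \<Longrightarrow> approx n d (sg_vertex i) = corner_val i d"
    and i: "i \<in> {0, 1, 2}" and z: "z \<in> triangle"
  shows "approx (Suc n) d (sg_map i z) = approx n (sub_data i d) z"
proof -
  have nn: "bary k z \<ge> 0" if "k \<in> {0, 1, 2}" for k using z that by (auto simp: triangle_def)
  have exp: "expand j (sg_map i z) = sg_vertex i \<and> z = sg_vertex j"
    if "j \<in> {0, 1, 2}" "i \<noteq> j" "1 / 2 \<le> bary j (sg_map i z)" for j
  proof (rule conjI[OF _ conjunct1])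
    have "1 \<le> bary j z" using that i by (simp add: bary_sg_map)
    then have "bary k z = of_bool (j = k)" if "k \<in> {0, 1, 2}" for k
      using that nn[of 0] nn[of 1] nn[of 2] bary_sum[of z] \<open>j \<in> {0, 1, 2}\<close> by auto
    then show "z = sg_vertex j \<and> z = sg_vertex j"
      using that by (auto intro!: bary_eqI simp: bary_sg_vertex)
    then show "expand j (sg_map i z) = sg_vertex i"
      using sg_map_vertex_swap[of i j] by (simp add: expand_sg_map)
  qed
  have other: "approx n (sub_data j d) (expand j (sg_map i z)) = approx n (sub_data i d) z"
    if "j \<in> {0, 1, 2}" "1 / 2 \<le> bary j (sg_map i z)" for j
  proof (cases "i = j")
    case False
    then have e: "expand j (sg_map i z) = sg_vertex i" "z = sg_vertex j"
      using exp[OF that(1) _ that(2)] by blast+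
    show ?thesis unfolding e(1) unfolding e(2) assms(1)[OF i] assms(1)[OF that(1)]
      by (rule corner_val_sub_data_swap) (use i that in auto)
  qed (simp add: expand_sg_map)
  have self: "1 / 2 \<le> bary i (sg_map i z)" using nn[OF i] i by (simp add: bary_sg_map)
  then show ?thesis
    using other[of 0] other[of 1] other[of 2] i by auto
qed

lemma approx_vertex:
  assumes "i \<in> {0, 1, 2}"
  shows "approx n d (sg_vertex i) = corner_val i d"
  using assms
proof (induction n arbitrary: d i)
  case 0
  then show ?case by (auto simp: bary_sg_vertex)
next
  case (Suc n)
  have "sg_vertex i \<in> triangle" using Suc.prems sg_verts_subset_triangle[of 0] by auto
  then have "approx (Suc n) d (sg_map i (sg_vertex i)) = approx n (sub_data i d) (sg_vertex i)"
    using approx_Suc_sg_map_aux[of n i "sg_vertex i" d] Suc by blast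
  then show ?case using Suc by (simp only: sg_map_vertex_self corner_val_sub_data_self)
qed

lemma approx_Suc_sg_map:
  assumes "i \<in> {0, 1, 2}" "z \<in> sierpinski_gasket"
  shows "approx (Suc n) d (sg_map i z) = approx n (sub_data i d) z"
  using approx_Suc_sg_map_aux approx_vertex assms gasket_subset_triangle by blast

lemma continuous_on_approx: "continuous_on sierpinski_gasket (approx n d)"
proof (induction n arbitrary: d)
  case 0
  then show ?case by (simp add: continuous_on_bary continuous_intros)
next
  case (Suc n)
  have "continuous_on (sg_map i ` sierpinski_gasket) (approx (Suc n) d)" if i: "i \<in> {0, 1, 2}" for i
  proof -
    have "continuous_on (sg_map i ` sierpinski_gasket) (\<lambda>z. approx n (sub_data i d) (expand i z))"
      by (rule continuous_on_compose2[OF Suc.IH])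
        (auto simp: expand_sg_map, auto simp: expand_def intro!: continuous_intros)
    then show ?thesis
      by (rule continuous_on_eq) (auto simp: expand_sg_map approx_Suc_sg_map[OF i] simp del: approx.simps)
  qed
  then have "continuous_on (\<Union>i\<in>{0, 1, 2}. sg_map i ` sierpinski_gasket) (approx (Suc n) d)"
    by (intro continuous_on_closed_Union)
      (auto intro!: compact_imp_closed compact_continuous_image continuous_on_sg_map compact_gasket)
  then show ?case using gasket_decomp by simp
qed

lemma approx_bounds:
  assumes "cont_data d" "values_in d l h" "z \<in> sierpinski_gasket"
  shows "l \<le> approx n d z \<and> approx n d z \<le> h"
  using assms
proof (induction n arbitrary: d z)
  case 0
  have b: "bary i z \<ge> 0" if "i \<in> {0, 1, 2}" for i
    using 0 gasket_subset_triangle that by (auto simp: triangle_def)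
  have c: "l \<le> corner_val i d" "corner_val i d \<le> h" for i using values_in_corner 0 by auto
  have "l * 1 \<le> approx 0 d z"
    unfolding bary_sum[of z, symmetric] using mult_right_mono[OF c(1) b] by (simp add: algebra_simps add_mono)
  moreover have "approx 0 d z \<le> h * 1"
    unfolding bary_sum[of z, symmetric] using mult_right_mono[OF c(2) b] by (simp add: algebra_simps add_mono)
  ultimately show ?case by simp
next
  case (Suc n)
  obtain i z' where z: "i \<in> {0, 1, 2}" "z' \<in> sierpinski_gasket" "z = sg_map i z'"
    using gasket_cases Suc.prems by blast
  then show ?case using Suc.IH[of "sub_data i d" z'] Suc.prems cont_sub_data values_in_sub_data
    by (simp only: approx_Suc_sg_map)
qed

text \<open>From level \<open>n\<close> on, all approximations stay within the bounds of the same narrow data.\<close>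

lemma approx_Cauchy:
  assumes "cont_data d" "narrow n d e" "n \<le> m" "n \<le> k" "z \<in> sierpinski_gasket"
  shows "\<bar>approx m d z - approx k d z\<bar> \<le> e"
  using assms
proof (induction n arbitrary: d m k z)
  case 0
  then obtain l h where "values_in d l h" "h - l \<le> e" by auto
  then show ?case using approx_bounds[of d l h z m] approx_bounds[of d l h z k] 0 by linarith
next
  case (Suc n)
  obtain i z' where z: "i \<in> {0, 1, 2}" "z' \<in> sierpinski_gasket" "z = sg_map i z'"
    using gasket_cases Suc.prems by blast
  obtain m' k' where mk: "m = Suc m'" "k = Suc k'" using Suc.prems by (cases m; cases k) auto
  have "\<bar>approx m' (sub_data i d) z' - approx k' (sub_data i d) z'\<bar> \<le> e"
    by (rule Suc.IH) (use Suc.prems cont_sub_data z mk in auto)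
  then show ?case using z mk by (simp only: approx_Suc_sg_map)
qed

definition data_ext :: "boundary_data \<Rightarrow> real \<times> real \<Rightarrow> real" where
  "data_ext d z = lim (\<lambda>n. approx n d z)"

lemma approx_tendsto_data_ext:
  assumes "cont_data d" "z \<in> sierpinski_gasket"
  shows "(\<lambda>n. approx n d z) \<longlonglongrightarrow> data_ext d z"
proof -
  have "Cauchy (\<lambda>n. approx n d z)"
  proof (rule metric_CauchyI)
    fix e :: real assume "e > 0"
    then obtain n where "narrow n d (e / 2)" using narrow_exists[of d "e / 2"] assms by auto
    then have "dist (approx m d z) (approx k d z) < e" if "m \<ge> n" "k \<ge> n" for m k
      using approx_Cauchy[of d n "e / 2" m k z] that assms \<open>e > 0\<close> by (auto simp: dist_real_def)
    then show "\<exists>M. \<forall>m\<ge>M. \<forall>k\<ge>M. dist (approx m d z) (approx k d z) < e" by blast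
  qed
  then show ?thesis by (simp add: data_ext_def Cauchy_convergent_iff convergent_LIMSEQ_iff)
qed

lemma continuous_on_data_ext:
  assumes "cont_data d"
  shows "continuous_on sierpinski_gasket (data_ext d)"
proof (rule uniform_limit_theorem)
  show "uniform_limit sierpinski_gasket (\<lambda>n. approx n d) (data_ext d) sequentially"
  proof (rule uniform_limitI)
    fix e :: real assume "e > 0"
    then obtain n where n: "narrow n d (e / 2)" using narrow_exists[of d "e / 2"] assms by auto
    have "dist (approx m d z) (data_ext d z) < e" if "m \<ge> n" "z \<in> sierpinski_gasket" for m z
    proof -
      have "(\<lambda>k. \<bar>approx m d z - approx k d z\<bar>) \<longlonglongrightarrow> \<bar>approx m d z - data_ext d z\<bar>"
        by (intro tendsto_intros approx_tendsto_data_ext assms that)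
      moreover have "\<forall>k\<ge>n. \<bar>approx m d z - approx k d z\<bar> \<le> e / 2"
        using approx_Cauchy[OF assms n] that by blast
      ultimately have "\<bar>approx m d z - data_ext d z\<bar> \<le> e / 2" using LIMSEQ_le_const2 by blast
      then show ?thesis using \<open>e > 0\<close> by (simp add: dist_real_def)
    qed
    then show "\<forall>\<^sub>F m in sequentially. \<forall>z\<in>sierpinski_gasket. dist (approx m d z) (data_ext d z) < e"
      unfolding eventually_sequentially by blast
  qed
qed (simp_all add: continuous_on_approx)

lemma data_ext_corner: "i \<in> {0, 1, 2} \<Longrightarrow> data_ext d (sg_vertex i) = corner_val i d"
  by (simp add: data_ext_def approx_vertex)

lemma data_ext_sg_map:
  assumes "cont_data d" "i \<in> {0, 1, 2}" "z \<in> sierpinski_gasket"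
  shows "data_ext d (sg_map i z) = data_ext (sub_data i d) z"
proof -
  have "(\<lambda>n. approx (Suc n) d (sg_map i z)) \<longlonglongrightarrow> data_ext d (sg_map i z)"
    by (intro LIMSEQ_Suc approx_tendsto_data_ext sg_map_in_gasket assms)
  then have "(\<lambda>n. approx n (sub_data i d) z) \<longlonglongrightarrow> data_ext d (sg_map i z)"
    by (simp only: approx_Suc_sg_map[OF assms(2,3)])
  then show ?thesis using approx_tendsto_data_ext[OF cont_sub_data[OF assms(1)] assms(3)] LIMSEQ_unique by blast
qed

lemma data_ext_bounds:
  assumes "cont_data d" "values_in d l h" "z \<in> sierpinski_gasket"
  shows "l \<le> data_ext d z \<and> data_ext d z \<le> h"
  using approx_bounds[OF assms] approx_tendsto_data_ext[OF assms(1,3)]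
  by (meson LIMSEQ_le_const LIMSEQ_le_const2)

text \<open>On the bottom edge \<open>u\<close> and the extension obey the same recursion, and both lie within the bounds
  of the data; so they differ by at most \<open>e\<close> as soon as the data are narrow at some level.\<close>

lemma data_ext_bottom:
  assumes "continuous_on UNIV u" "x \<in> {0..1}"
  shows "data_ext (Bottom u) (x, 0) = u x"
proof -
  have *: "\<bar>data_ext (Bottom u) (x, 0) - u x\<bar> \<le> e"
    if "narrow n (Bottom u) e" "continuous_on UNIV u" "x \<in> {0..1}" for n e u x
    using that
  proof (induction n arbitrary: u x)
    case 0
    then obtain l h where lh: "values_in (Bottom u) l h" "h - l \<le> e" by auto
    then have "l \<le> u x" "u x \<le> h" using 0 by auto
    moreover have "l \<le> data_ext (Bottom u) (x, 0) \<and> data_ext (Bottom u) (x, 0) \<le> h"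
      using data_ext_bounds[of "Bottom u" l h "(x, 0)"] lh 0 bottom_in_gasket[of x] by simp
    ultimately show ?case using lh(2) by linarith
  next
    case (Suc n)
    have rec: ?case if i: "i \<in> {0, 1}" "y \<in> {0..1}" "x = (y + real i) / 2" for i y
    proof -
      have "\<bar>data_ext (Bottom (dyadic_half i u)) (y, 0) - dyadic_half i u y\<bar> \<le> e"
        by (rule Suc.IH) (use Suc.prems i continuous_on_dyadic_half in auto)
      moreover have "(x, 0) = sg_map i (y, 0)" using i by (auto simp: sg_map_bottom)
      moreover have "data_ext (Bottom u) (sg_map i (y, 0)) = data_ext (Bottom (dyadic_half i u)) (y, 0)"
        using data_ext_sg_map[of "Bottom u" i "(y, 0)"] Suc.prems(2) i bottom_in_gasket[of y] by auto
      moreover have "dyadic_half i u y = u x" unfolding i(3) dyadic_half_def ..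
      ultimately show ?thesis by (simp only:)
    qed
    show ?case
    proof (cases "x \<le> 1 / 2")
      case True
      then show ?thesis using rec[of 0 "2 * x"] Suc.prems by auto
    next
      case False
      then show ?thesis using rec[of 1 "2 * x - 1"] Suc.prems by auto
    qed
  qed
  have "\<bar>data_ext (Bottom u) (x, 0) - u x\<bar> \<le> 0 + e" if "e > 0" for e
  proof -
    have "cont_data (Bottom u)" using assms(1) by simp
    from narrow_exists[OF this that] obtain n where "narrow n (Bottom u) e" .
    then show ?thesis using *[of n u e x] assms by simp
  qed
  then have "\<bar>data_ext (Bottom u) (x, 0) - u x\<bar> \<le> 0" by (rule field_le_epsilon)
  then show ?thesis by simp
qed

lemma sg_level_energy_data_ext_Suc:
  assumes "cont_data d"
  shows "sg_level_energy (Suc m) (data_ext d) = 5 / 3 * (\<Sum>i\<in>{0, 1, 2}. sg_level_energy m (data_ext (sub_data i d)))"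
proof -
  have "sg_level_energy m (data_ext d \<circ> sg_map i) = sg_level_energy m (data_ext (sub_data i d))" if "i \<in> {0, 1, 2}" for i
    by (rule sg_level_energy_cong) (use data_ext_sg_map[OF assms that] in auto)
  then show ?thesis by (simp add: sg_level_energy_Suc)
qed

text \<open>At every level, since the harmonic subdivision preserves the energy exactly.\<close>

lemma sg_level_energy_data_ext_Harm:
  "sg_level_energy m (data_ext (Harm a b c)) = triangle_energy a b c"
proof (induction m arbitrary: a b c)
  case 0
  then show ?case by (simp add: sg_level_energy_0 data_ext_corner)
next
  case (Suc m)
  show ?case
    by (simp add: sg_level_energy_data_ext_Suc Suc.IH Let_def)
      (simp add: triangle_energy_def power2_eq_square field_simps)
qed

section \<open>The dyadic form\<close>

text \<open>The mean of \<open>(p x - q y)\<^sup>2\<close> over independent uniform \<open>x\<close> and \<open>y\<close>, that is, the two variances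
  plus the squared difference of the means.  The formula in terms of moments keeps
  double integrals out of the estimates; \<open>nn_integral_rectangle\<close> makes the connection.\<close>

definition mean_sqdiff :: "(real \<Rightarrow> real) \<Rightarrow> (real \<Rightarrow> real) \<Rightarrow> real" where
  "mean_sqdiff p q = avg (\<lambda>x. (p x)\<^sup>2) + avg (\<lambda>x. (q x)\<^sup>2) - 2 * avg p * avg q"

text \<open>The integral of \<open>(u x - u y)\<^sup>2\<close> over \<open>0 < x < 1/2 < y < 1\<close>; this rectangle has area \<open>1/4\<close>.\<close>

definition cross :: "(real \<Rightarrow> real) \<Rightarrow> real" where
  "cross u = mean_sqdiff (dyadic_half 0 u) (dyadic_half 1 u) / 4"

primrec level_form :: "nat \<Rightarrow> (real \<Rightarrow> real) \<Rightarrow> real" where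
  "level_form 0 u = cross u"
| "level_form (Suc n) u = 5 / 3 * (level_form n (dyadic_half 0 u) + level_form n (dyadic_half 1 u))"

definition dyadic_form :: "(real \<Rightarrow> real) \<Rightarrow> real" where
  "dyadic_form u = (\<Sum>n. level_form n u)"

lemma integrable_unit: "continuous_on UNIV u \<Longrightarrow> u integrable_on {0..1::real}" for u :: "real \<Rightarrow> real"
  by (rule integrable_continuous_interval) (rule continuous_on_subset, auto)

lemma integral_rescale:
  fixes f :: "real \<Rightarrow> real"
  assumes f: "continuous_on UNIV f" and "a < b"
  shows "integral {a..b} f = (b - a) * avg (\<lambda>x. f (a + (b - a) * x))"
proof -
  have "f integrable_on {a..b}"
    by (rule integrable_continuous_interval) (rule continuous_on_subset[OF f], simp)
  then have "(f has_integral integral {a..b} f) (cbox a b)" by auto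
  from has_integral_affinity[OF this, of "b - a" a]
  have "((\<lambda>x. f (a + (b - a) * x)) has_integral integral {a..b} f / (b - a))
      ((\<lambda>x. (x - a) / (b - a)) ` {a..b})"
    using \<open>a < b\<close> by (simp add: diff_divide_distrib add.commute)
  moreover have "(\<lambda>x. (x - a) / (b - a)) ` {a..b} = {0..1}"
  proof (intro equalityI subsetI)
    fix y :: real assume y: "y \<in> {0..1}"
    have "(b - a) * y \<le> (b - a) * 1" "0 \<le> (b - a) * y"
      using y \<open>a < b\<close> by (intro mult_left_mono mult_nonneg_nonneg; simp)+
    then show "y \<in> (\<lambda>x. (x - a) / (b - a)) ` {a..b}"
      using \<open>a < b\<close> by (intro image_eqI[of _ _ "a + (b - a) * y"]) (auto simp: field_simps)
  qed (use \<open>a < b\<close> in \<open>auto simp: field_simps\<close>)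
  ultimately show ?thesis using \<open>a < b\<close> by (simp add: avg_def integral_unique)
qed

lemma avg_dyadic_half:
  assumes "continuous_on UNIV u"
  shows "avg u = (avg (dyadic_half 0 u) + avg (dyadic_half 1 u)) / 2"
proof -
  have "avg u = integral {0..1 / 2} u + integral {1 / 2..1} u"
    unfolding avg_def
    by (rule Henstock_Kurzweil_Integration.integral_combine[symmetric]) (use assms integrable_unit in auto)
  then show ?thesis
    using integral_rescale[OF assms, of 0 "1 / 2"] integral_rescale[OF assms, of "1 / 2" 1]
    by (simp add: dyadic_half_def add_divide_distrib add.commute)
qed

lemma avg_add: "continuous_on UNIV f \<Longrightarrow> continuous_on UNIV g \<Longrightarrow> avg (\<lambda>x. f x + g x) = avg f + avg g"
  by (simp add: avg_def integral_add integrable_unit)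

lemma avg_mult: "avg (\<lambda>x. c * f x) = c * avg f"
  by (simp add: avg_def)

lemma avg_const: "avg (\<lambda>x. c) = c"
  by (simp add: avg_def)

lemma avg_mono:
  assumes "continuous_on UNIV f" "continuous_on UNIV g" "\<And>x. x \<in> {0..1} \<Longrightarrow> f x \<le> g x"
  shows "avg f \<le> avg g"
  unfolding avg_def by (rule integral_le) (use assms integrable_unit in auto)

lemma avg_square_shift:
  assumes u: "continuous_on UNIV u"
  shows "avg (\<lambda>x. (u x - a)\<^sup>2) = avg (\<lambda>x. (u x)\<^sup>2) - 2 * a * avg u + a\<^sup>2"
proof -
  have "avg (\<lambda>x. (u x - a)\<^sup>2) = avg (\<lambda>x. ((u x)\<^sup>2 + (- 2 * a) * u x) + a\<^sup>2)"
    by (rule arg_cong[of _ _ avg]) (auto simp: power2_eq_square algebra_simps)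
  also have "\<dots> = avg (\<lambda>x. (u x)\<^sup>2) + (- 2 * a) * avg u + a\<^sup>2"
    by (subst avg_add avg_mult avg_const; (intro continuous_intros u)?)+ simp
  finally show ?thesis by simp
qed

lemma avg_nonneg:
  assumes "continuous_on UNIV f" "\<And>x. 0 \<le> f x"
  shows "0 \<le> avg f"
  using avg_mono[of "\<lambda>x. 0" f] assms by (simp add: avg_const)

lemma avg_square_ge:
  assumes u: "continuous_on UNIV u"
  shows "(avg u)\<^sup>2 \<le> avg (\<lambda>x. (u x)\<^sup>2)"
proof -
  have "0 \<le> avg (\<lambda>x. (u x - avg u)\<^sup>2)" by (intro avg_nonneg continuous_intros u) simp
  then show ?thesis unfolding avg_square_shift[OF u] by (simp add: power2_eq_square)
qed

text \<open>The variances are nonnegative.\<close>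

lemma cross_ge:
  assumes u: "continuous_on UNIV u"
  shows "(avg (dyadic_half 0 u) - avg (dyadic_half 1 u))\<^sup>2 \<le> 4 * cross u"
  using avg_square_ge[OF continuous_on_dyadic_half[OF u], of 0]
    avg_square_ge[OF continuous_on_dyadic_half[OF u], of 1]
  by (simp add: cross_def mean_sqdiff_def power2_diff)

lemma cross_nonneg: "continuous_on UNIV u \<Longrightarrow> 0 \<le> cross u"
  using cross_ge[of u] zero_le_power2[of "avg (dyadic_half 0 u) - avg (dyadic_half 1 u)"] by linarith

lemma avg_square_shift_halves:
  assumes u: "continuous_on UNIV u"
  shows "avg (\<lambda>x. (u x - a)\<^sup>2)
    = (avg (\<lambda>x. (dyadic_half 0 u x - a)\<^sup>2) + avg (\<lambda>x. (dyadic_half 1 u x - a)\<^sup>2)) / 2"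
proof -
  have "continuous_on UNIV (\<lambda>x. (u x - a)\<^sup>2)" by (intro continuous_intros u)
  from avg_dyadic_half[OF this] show ?thesis by (simp add: dyadic_half_def)
qed

text \<open>Relative to \<open>a\<close>, the integral is at most half the sum of the second moments on the two halves,
  as \<open>- 2 m\<^sub>0 m\<^sub>1 \<le> m\<^sub>0\<^sup>2 + m\<^sub>1\<^sup>2\<close> and a squared mean is at most the second moment.\<close>

lemma cross_le:
  assumes u: "continuous_on UNIV u"
  shows "cross u \<le> avg (\<lambda>x. (u x - a)\<^sup>2)"
proof -
  define m0 where "m0 = avg (dyadic_half 0 u)"
  define m1 where "m1 = avg (dyadic_half 1 u)"
  define q0 where "q0 = avg (\<lambda>x. (dyadic_half 0 u x)\<^sup>2)"
  define q1 where "q1 = avg (\<lambda>x. (dyadic_half 1 u x)\<^sup>2)"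
  have c: "cross u = (q0 + q1 - 2 * m0 * m1) / 4"
    by (simp add: cross_def mean_sqdiff_def q0_def q1_def m0_def m1_def)
  have s: "avg (\<lambda>x. (u x - a)\<^sup>2) = (q0 - 2 * a * m0 + a\<^sup>2 + (q1 - 2 * a * m1 + a\<^sup>2)) / 2"
    unfolding avg_square_shift_halves[OF u]
    by (simp add: avg_square_shift continuous_on_dyadic_half u q0_def q1_def m0_def m1_def)
  have "m0\<^sup>2 \<le> q0" "m1\<^sup>2 \<le> q1"
    unfolding m0_def m1_def q0_def q1_def by (intro avg_square_ge continuous_on_dyadic_half u)+
  moreover have "4 * avg (\<lambda>x. (u x - a)\<^sup>2) - 4 * cross u
      = (q0 - m0\<^sup>2) + (q1 - m1\<^sup>2) + ((m0 + m1 - 2 * a)\<^sup>2)"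
    unfolding c s by (simp add: power2_eq_square field_simps)
  ultimately show ?thesis using zero_le_power2[of "m0 + m1 - 2 * a"] by linarith
qed

lemma level_form_nonneg: "continuous_on UNIV u \<Longrightarrow> 0 \<le> level_form n u"
  by (induction n arbitrary: u) (simp_all add: cross_nonneg continuous_on_dyadic_half)

lemma level_form_half_le:
  assumes "continuous_on UNIV u" "i \<in> {0, 1}"
  shows "level_form n (dyadic_half i u) \<le> 3 / 5 * level_form (Suc n) u"
  using assms level_form_nonneg[OF continuous_on_dyadic_half[OF assms(1)], of n 0]
    level_form_nonneg[OF continuous_on_dyadic_half[OF assms(1)], of n 1] by auto

lemma summable_level_form_half:
  assumes "continuous_on UNIV u" "summable (\<lambda>n. level_form n u)" "i \<in> {0, 1}"
  shows "summable (\<lambda>n. level_form n (dyadic_half i u))"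
proof (rule summable_comparison_test')
  show "summable (\<lambda>n. 3 / 5 * level_form (Suc n) u)"
    by (intro summable_mult) (use assms(2) summable_Suc_iff[of "\<lambda>n. level_form n u"] in blast)
  fix n show "norm (level_form n (dyadic_half i u)) \<le> 3 / 5 * level_form (Suc n) u"
    using level_form_half_le[OF assms(1,3)]
      level_form_nonneg[OF continuous_on_dyadic_half[OF assms(1)]] by simp
qed

lemma dyadic_form_decomp:
  assumes "continuous_on UNIV u" "summable (\<lambda>n. level_form n u)"
  shows "dyadic_form u
    = cross u + 5 / 3 * (dyadic_form (dyadic_half 0 u) + dyadic_form (dyadic_half 1 u))"
proof -
  have s: "summable (\<lambda>n. level_form n (dyadic_half i u))" if "i \<in> {0, 1}" for i
    using summable_level_form_half[OF assms that] .
  have "dyadic_form u = (\<Sum>n. level_form (Suc n) u) + level_form 0 u"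
    unfolding dyadic_form_def using suminf_split_head[OF assms(2)] by simp
  also have "(\<Sum>n. level_form (Suc n) u)
      = 5 / 3 * (dyadic_form (dyadic_half 0 u) + dyadic_form (dyadic_half 1 u))"
    using s[of 0] s[of 1] unfolding dyadic_form_def level_form.simps
    by (simp only: suminf_mult summable_add suminf_add insert_iff simp_thms)
  finally show ?thesis by simp
qed

lemma dyadic_form_nonneg:
  assumes "continuous_on UNIV u" "summable (\<lambda>n. level_form n u)"
  shows "0 \<le> dyadic_form u"
  unfolding dyadic_form_def using assms by (intro suminf_nonneg level_form_nonneg)

lemma cross_le_dyadic_form:
  assumes "continuous_on UNIV u" "summable (\<lambda>n. level_form n u)"
  shows "cross u \<le> dyadic_form u"
  using dyadic_form_decomp[OF assms] assms
  by (simp add: dyadic_form_nonneg continuous_on_dyadic_half summable_level_form_half)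

lemma dyadic_form_half_le:
  assumes "continuous_on UNIV u" "summable (\<lambda>n. level_form n u)" "i \<in> {0, 1}"
  shows "dyadic_form (dyadic_half i u) \<le> 3 / 5 * dyadic_form u"
proof -
  have "3 * dyadic_form u
      = 3 * cross u + 5 * dyadic_form (dyadic_half 0 u) + 5 * dyadic_form (dyadic_half 1 u)"
    using dyadic_form_decomp[OF assms(1,2)] by (simp add: field_simps)
  then show ?thesis
    using assms(3) cross_nonneg[OF assms(1)]
    dyadic_form_nonneg[OF continuous_on_dyadic_half summable_level_form_half, OF assms(1) assms(1,2), of 0]
    dyadic_form_nonneg[OF continuous_on_dyadic_half summable_level_form_half, OF assms(1) assms(1,2), of 1]
  by auto
qed

section \<open>Extension to the gasket\<close>

text \<open>Passing to a subcell multiplies an energy by at most \<open>3/5\<close>, hence its square root by a factor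
  below one; \<open>4/5\<close> is a rational bound for it.\<close>

lemma sqrt_three_fifths: "0 \<le> E \<Longrightarrow> E' \<le> 3 / 5 * E \<Longrightarrow> sqrt E' \<le> 4 / 5 * sqrt E"
proof -
  assume E: "0 \<le> E" "E' \<le> 3 / 5 * E"
  have "E' \<le> (4 / 5)\<^sup>2 * E" using E by (simp add: power2_eq_square)
  then have "sqrt E' \<le> sqrt ((4 / 5)\<^sup>2 * E)" by (rule real_sqrt_le_mono)
  then show ?thesis by (simp add: real_sqrt_mult)
qed

lemma avg_half_step:
  assumes u: "continuous_on UNIV u" "summable (\<lambda>n. level_form n u)" and i: "i \<in> {0, 1}"
  shows "\<bar>avg (dyadic_half i u) - avg u\<bar> \<le> sqrt (dyadic_form u)"
proof -
  have "\<bar>avg (dyadic_half i u) - avg u\<bar> = \<bar>avg (dyadic_half 0 u) - avg (dyadic_half 1 u)\<bar> / 2"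
    using i by (auto simp: avg_dyadic_half[OF u(1)] field_simps abs_if)
  also have "(\<bar>avg (dyadic_half 0 u) - avg (dyadic_half 1 u)\<bar> / 2)\<^sup>2 \<le> dyadic_form u"
    using cross_ge[OF u(1)] cross_le_dyadic_form[OF u] by (simp add: power_divide)
  then have "\<bar>avg (dyadic_half 0 u) - avg (dyadic_half 1 u)\<bar> / 2 \<le> sqrt (dyadic_form u)"
    by (rule real_le_rsqrt)
  finally show ?thesis .
qed

text \<open>A geometric series: the first halving moves the mean by at most the square root \<open>r\<close> of the
  form and multiplies \<open>r\<close> by at most \<open>4/5\<close>, and \<open>1 + 5 \<cdot> 4/5 = 5\<close>.\<close>

lemma avg_iterated_half_bound:
  assumes "continuous_on UNIV u" "summable (\<lambda>n. level_form n u)" "i \<in> {0, 1}"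
  shows "\<bar>avg ((dyadic_half i ^^ n) u) - avg u\<bar> \<le> 5 * sqrt (dyadic_form u)"
  using assms(1,2)
proof (induction n arbitrary: u)
  case 0
  then show ?case using dyadic_form_nonneg by simp
next
  case (Suc n)
  define v where "v = dyadic_half i u"
  have v: "continuous_on UNIV v" "summable (\<lambda>n. level_form n v)"
    unfolding v_def using Suc.prems assms(3) continuous_on_dyadic_half summable_level_form_half by blast+
  have "avg ((dyadic_half i ^^ Suc n) u) = avg ((dyadic_half i ^^ n) v)"
    unfolding v_def by (simp only: funpow_Suc_right o_apply)
  moreover have "\<bar>avg ((dyadic_half i ^^ n) v) - avg v\<bar> \<le> 5 * sqrt (dyadic_form v)"
    by (rule Suc.IH[OF v])
  moreover have "sqrt (dyadic_form v) \<le> 4 / 5 * sqrt (dyadic_form u)"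
    unfolding v_def
    by (intro sqrt_three_fifths dyadic_form_nonneg dyadic_form_half_le Suc.prems assms(3))
  moreover have "\<bar>avg v - avg u\<bar> \<le> sqrt (dyadic_form u)"
    unfolding v_def by (rule avg_half_step[OF Suc.prems assms(3)])
  ultimately show ?case by linarith
qed

text \<open>The means over the dyadic intervals that shrink to an end point converge to the value there,
  by continuity.\<close>

lemma endpoint_bound:
  assumes u: "continuous_on UNIV u" "summable (\<lambda>n. level_form n u)" and i: "i \<in> {0, 1}"
  shows "\<bar>u (real i) - avg u\<bar> \<le> 5 * sqrt (dyadic_form u)"
proof -
  \<comment> \<open>Iterating the half map with index \<open>i\<close> contracts towards the end point \<open>i\<close>.\<close>
  have iter: "(dyadic_half i ^^ n) u = (\<lambda>x. u (real i + (x - real i) / 2 ^ n))" for n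
  proof (induction n)
    case (Suc n)
    then show ?case by (auto simp: dyadic_half_def field_simps)
  qed simp
  have cont: "continuous_on UNIV ((dyadic_half i ^^ n) u)" for n
    by (induction n) (simp_all add: u continuous_on_dyadic_half)
  have "(\<lambda>n. avg ((dyadic_half i ^^ n) u)) \<longlonglongrightarrow> u (real i)"
  proof (rule LIMSEQ_I)
    fix e :: real assume "e > 0"
    have "isCont u (real i)" using u(1) by (simp add: continuous_on_eq_continuous_at)
    then obtain d where d: "d > 0" "\<And>y. \<bar>y - real i\<bar> < d \<Longrightarrow> \<bar>u y - u (real i)\<bar> < e / 2"
      unfolding continuous_at_eps_delta dist_real_def using \<open>e > 0\<close> by (metis half_gt_zero)
    have "(\<lambda>n. 1 / 2 ^ n :: real) \<longlonglongrightarrow> 0" by real_asymp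
    then have "eventually (\<lambda>n. 1 / 2 ^ n < d) sequentially" using d(1) order_tendstoD(2) by blast
    then obtain N where N: "\<And>n. n \<ge> N \<Longrightarrow> 1 / 2 ^ n < d" by (auto simp: eventually_sequentially)
    have "norm (avg ((dyadic_half i ^^ n) u) - u (real i)) < e" if "n \<ge> N" for n
    proof -
      have b: "u (real i) - e / 2 \<le> (dyadic_half i ^^ n) u x \<and> (dyadic_half i ^^ n) u x \<le> u (real i) + e / 2"
        if x: "x \<in> {0..1}" for x
      proof -
        have "\<bar>x - real i\<bar> \<le> 1" using x i by auto
        then have "\<bar>x - real i\<bar> / 2 ^ n \<le> 1 / 2 ^ n" by (intro divide_right_mono) auto
        then have "\<bar>(real i + (x - real i) / 2 ^ n) - real i\<bar> < d" using N[OF \<open>n \<ge> N\<close>] by simp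
        from d(2)[OF this] show ?thesis unfolding iter by (simp only: abs_less_iff) linarith
      qed
      show ?thesis
        using avg_bounds[OF cont b] \<open>e > 0\<close> by (auto simp: abs_less_iff)
    qed
    then show "\<exists>no. \<forall>n\<ge>no. norm (avg ((dyadic_half i ^^ n) u) - u (real i)) < e" by blast
  qed
  then have "(\<lambda>n. \<bar>avg ((dyadic_half i ^^ n) u) - avg u\<bar>) \<longlonglongrightarrow> \<bar>u (real i) - avg u\<bar>"
    by (intro tendsto_intros)
  then show ?thesis
    by (rule LIMSEQ_le_const2) (use avg_iterated_half_bound[OF u i] in blast)
qed

lemma triangle_energy_le:
  "triangle_energy a b c \<le> 3 * ((a - c)\<^sup>2 + (b - c)\<^sup>2)"
proof -
  have "3 * ((a - c)\<^sup>2 + (b - c)\<^sup>2) - triangle_energy a b c = (a + b - 2 * c)\<^sup>2"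
    by (simp add: triangle_energy_def power2_eq_square algebra_simps)
  then show ?thesis by (smt (verit) zero_le_power2)
qed

text \<open>The recursions for the energy of the extension and for \<open>dyadic_form\<close> differ only in the energy
  of the upper harmonic cell and in \<open>cross u\<close>.  With its lower corners at the means of the halves and
  its top at their average, this cell has energy at most \<open>6 cross u\<close>.  Level zero involves point values
  and is where \<open>endpoint_bound\<close> enters.\<close>

lemma sg_level_energy_data_ext_bottom:
  assumes "continuous_on UNIV u" "summable (\<lambda>n. level_form n u)"
  shows "sg_level_energy m (data_ext (Bottom u)) \<le> 150 * dyadic_form u"
  using assms
proof (induction m arbitrary: u)
  case 0
  have sq: "(u (real i) - avg u)\<^sup>2 \<le> 25 * dyadic_form u" if "i \<in> {0, 1}" for i
  proof -
    have "\<bar>u (real i) - avg u\<bar>\<^sup>2 \<le> (5 * sqrt (dyadic_form u))\<^sup>2"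
      using endpoint_bound[OF 0 that] by (intro power_mono) auto
    then show ?thesis using dyadic_form_nonneg[OF 0] by (simp add: power_mult_distrib)
  qed
  show ?case
    using triangle_energy_le[of "u 0" "u 1" "avg u"] sq[of 0] sq[of 1]
    by (simp add: sg_level_energy_0 data_ext_corner)
next
  case (Suc m)
  define t0 where "t0 = avg (dyadic_half 0 u)"
  define t1 where "t1 = avg (dyadic_half 1 u)"
  have b: "sg_level_energy m (data_ext (Bottom (dyadic_half i u))) \<le> 150 * dyadic_form (dyadic_half i u)"
    if "i \<in> {0, 1}" for i
    by (rule Suc.IH) (use Suc.prems that continuous_on_dyadic_half summable_level_form_half in blast)+
  have "avg u = (t0 + t1) / 2" unfolding t0_def t1_def by (rule avg_dyadic_half[OF Suc.prems(1)])
  then have "triangle_energy t0 t1 (avg u) = 3 / 2 * (t0 - t1)\<^sup>2"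
    by (simp add: triangle_energy_def power2_eq_square field_simps)
  also have "\<dots> \<le> 6 * cross u" using cross_ge[OF Suc.prems(1)] by (simp add: t0_def t1_def)
  finally have h: "triangle_energy t0 t1 (avg u) \<le> 6 * cross u" .
  have "sg_level_energy (Suc m) (data_ext (Bottom u))
    = 5 / 3 * (sg_level_energy m (data_ext (Bottom (dyadic_half 0 u)))
       + sg_level_energy m (data_ext (Bottom (dyadic_half 1 u))) + triangle_energy t0 t1 (avg u))"
    using Suc.prems(1) by (simp add: sg_level_energy_data_ext_Suc sg_level_energy_data_ext_Harm t0_def t1_def)
  also have "\<dots> \<le> 5 / 3 * (150 * dyadic_form (dyadic_half 0 u) + 150 * dyadic_form (dyadic_half 1 u)
      + 6 * cross u)"
    by (intro mult_left_mono add_mono b h) auto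
  also have "\<dots> \<le> 150 * dyadic_form u"
    using dyadic_form_decomp[OF Suc.prems] cross_nonneg[OF Suc.prems(1)] by (simp add: algebra_simps)
  finally show ?case .
qed

lemma trace_extension:
  assumes "continuous_on UNIV u" "summable (\<lambda>n. level_form n u)"
  shows "u \<in> trace_dom" "trace_energy u \<le> 150 * dyadic_form u"
proof -
  have "data_ext (Bottom u) \<in> sg_dom" "sg_energy (data_ext (Bottom u)) \<le> 150 * dyadic_form u"
    using sg_domI[OF continuous_on_data_ext sg_level_energy_data_ext_bottom[OF assms]] assms(1) by simp_all
  then have e: "data_ext (Bottom u) \<in> sg_extensions u"
    by (simp add: sg_extensions_def data_ext_bottom assms(1))
  then show "u \<in> trace_dom" by (auto simp: trace_dom_def)
  have "bdd_below (sg_energy ` sg_extensions u)"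
    by (rule bdd_belowI[of _ 0]) (auto simp: sg_extensions_def intro: sg_energy_nonneg)
  then have "trace_energy u \<le> sg_energy (data_ext (Bottom u))"
    unfolding trace_energy_def using e by (intro cInf_lower) auto
  then show "trace_energy u \<le> 150 * dyadic_form u"
    using \<open>sg_energy (data_ext (Bottom u)) \<le> _\<close> by simp
qed

section \<open>Restriction to the bottom edge\<close>

text \<open>The top vertices of the whole cell and of a lower subcell are both corners of the upper
  subcell.\<close>

lemma restriction_step:
  assumes U: "U \<in> sg_dom" and i: "i \<in> {0, 1}"
  shows "(U (sg_map i (sg_vertex 2)) - U (sg_vertex 2))\<^sup>2 \<le> sg_energy (U \<circ> sg_map 2)"
proof -
  have "U \<circ> sg_map 2 \<in> sg_dom" by (rule sg_dom_sg_map[OF U]) simp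
  then have "sg_level_energy 0 (U \<circ> sg_map 2) \<le> sg_energy (U \<circ> sg_map 2)"
    by (rule sg_level_energy_le_sg_energy)
  then have *: "triangle_energy (U (sg_map 0 (sg_vertex 2))) (U (sg_map 1 (sg_vertex 2))) (U (sg_vertex 2))
      \<le> sg_energy (U \<circ> sg_map 2)"
    using sg_map_vertex_swap[of 2 0] sg_map_vertex_swap[of 2 1]
    by (simp add: sg_level_energy_0 sg_map_vertex_self)
  have "(U (sg_map i (sg_vertex 2)) - U (sg_vertex 2))\<^sup>2
      \<le> triangle_energy (U (sg_map 0 (sg_vertex 2))) (U (sg_map 1 (sg_vertex 2))) (U (sg_vertex 2))"
    using i by (auto simp: triangle_energy_def power2_commute)
  with * show ?thesis by linarith
qed

lemma sg_energy_sg_map_le: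
  assumes "U \<in> sg_dom" "i \<in> {0, 1, 2}"
  shows "sg_energy (U \<circ> sg_map i) \<le> 3 / 5 * sg_energy U"
proof -
  have "sg_energy (U \<circ> sg_map i) \<le> (\<Sum>i\<in>{0, 1, 2}. sg_energy (U \<circ> sg_map i))"
    by (rule member_le_sum[of i]) (use assms sg_energy_nonneg sg_dom_sg_map in auto)
  then show ?thesis using sg_energy_decomp[OF assms(1)] by simp
qed

text \<open>Descend from the top vertex towards \<open>(x, 0)\<close> through the cells that contain it.  The steps are
  bounded by \<open>restriction_step\<close> and form a geometric series with ratio \<open>4/5\<close> and first term
  \<open>4/5\<close> times the square root of the energy, and the remainder tends to zero by uniform continuity.\<close>

lemma bottom_apex_bound:
  assumes U: "U \<in> sg_dom" and x: "x \<in> {0..1}"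
  shows "\<bar>U (x, 0) - U (sg_vertex 2)\<bar> \<le> 4 * sqrt (sg_energy U)"
proof -
  obtain M where M: "M > 0" "\<And>z z'. z \<in> sierpinski_gasket \<Longrightarrow> z' \<in> sierpinski_gasket \<Longrightarrow> dist z z' \<le> M"
    using compact_imp_bounded[OF compact_gasket] unfolding bounded_two_points
    by (metis (no_types, opaque_lifting) gt_ex less_eq_real_def order_trans less_le_trans linorder_not_le)
  have *: "\<bar>U (x, 0) - U (sg_vertex 2)\<bar> \<le> 4 * sqrt (sg_energy U) + e"
    if "U \<in> sg_dom" "x \<in> {0..1}"
      "\<And>z z'. z \<in> sierpinski_gasket \<Longrightarrow> z' \<in> sierpinski_gasket \<Longrightarrow> dist z z' \<le> M / 2 ^ n
        \<Longrightarrow> \<bar>U z - U z'\<bar> \<le> e" for n U x e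
    using that
  proof (induction n arbitrary: U x)
    case 0
    have "\<bar>U (x, 0) - U (sg_vertex 2)\<bar> \<le> e"
      by (rule "0.prems"(3)) (use M(2) bottom_in_gasket[OF "0.prems"(2)] sg_vertex_in_gasket[of 2] in auto)
    then show ?case using sg_energy_nonneg[OF "0.prems"(1)] by (smt (verit) real_sqrt_ge_zero)
  next
    case (Suc n)
    have rec: ?case if i: "i \<in> {0, 1}" "y \<in> {0..1}" "(x, 0) = sg_map i (y, 0)" for i y
    proof -
      define V where "V = U \<circ> sg_map i"
      have V: "V \<in> sg_dom" "sg_energy V \<le> 3 / 5 * sg_energy U"
        unfolding V_def using Suc.prems(1) i(1) sg_dom_sg_map[of U i] sg_energy_sg_map_le[of U i] by auto
      have "\<bar>V (y, 0) - V (sg_vertex 2)\<bar> \<le> 4 * sqrt (sg_energy V) + e"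
      proof (rule Suc.IH[OF V(1) i(2)])
        fix z z' assume z: "z \<in> sierpinski_gasket" "z' \<in> sierpinski_gasket" "dist z z' \<le> M / 2 ^ n"
        show "\<bar>V z - V z'\<bar> \<le> e"
          unfolding V_def o_apply
          by (rule Suc.prems(3)[OF sg_map_in_gasket[OF _ z(1)] sg_map_in_gasket[OF _ z(2)]])
            (use z(3) i(1) in \<open>auto simp: dist_sg_map\<close>)
      qed
      moreover have "sqrt (sg_energy V) \<le> 4 / 5 * sqrt (sg_energy U)"
        by (rule sqrt_three_fifths[OF sg_energy_nonneg[OF Suc.prems(1)] V(2)])
      moreover have "\<bar>V (sg_vertex 2) - U (sg_vertex 2)\<bar> \<le> 4 / 5 * sqrt (sg_energy U)"
      proof -
        have "(V (sg_vertex 2) - U (sg_vertex 2))\<^sup>2 \<le> sg_energy (U \<circ> sg_map 2)"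
          using restriction_step[OF Suc.prems(1) i(1)] by (simp only: V_def o_apply)
        then have "\<bar>V (sg_vertex 2) - U (sg_vertex 2)\<bar> \<le> sqrt (sg_energy (U \<circ> sg_map 2))"
          using real_sqrt_le_mono by fastforce
        also have "\<dots> \<le> 4 / 5 * sqrt (sg_energy U)"
          by (rule sqrt_three_fifths[OF sg_energy_nonneg[OF Suc.prems(1)] sg_energy_sg_map_le])
            (use Suc.prems(1) in auto)
        finally show ?thesis .
      qed
      moreover have "V (y, 0) = U (x, 0)" using i(3) by (simp add: V_def)
      ultimately show ?thesis by linarith
    qed
    show ?case
    proof (cases "x \<le> 1 / 2")
      case True
      then show ?thesis using rec[of 0 "2 * x"] Suc.prems(2) by (simp add: sg_map_bottom)
    next
      case False
      then show ?thesis using rec[of 1 "2 * x - 1"] Suc.prems(2) by (simp add: sg_map_bottom)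
    qed
  qed
  have "uniformly_continuous_on sierpinski_gasket U"
    using U compact_gasket by (intro compact_uniformly_continuous) (auto simp: sg_dom_def)
  have "\<bar>U (x, 0) - U (sg_vertex 2)\<bar> \<le> 4 * sqrt (sg_energy U) + e" if "e > 0" for e
  proof -
    obtain d where d: "d > 0" "\<And>z z'. z \<in> sierpinski_gasket \<Longrightarrow> z' \<in> sierpinski_gasket \<Longrightarrow> dist z z' < d
        \<Longrightarrow> dist (U z) (U z') < e"
      using \<open>uniformly_continuous_on sierpinski_gasket U\<close> \<open>e > 0\<close>
      unfolding uniformly_continuous_on_def by metis
    have "(\<lambda>n. M / 2 ^ n) \<longlonglongrightarrow> 0" by real_asymp
    then have "eventually (\<lambda>n. M / 2 ^ n < d) sequentially" using d(1) order_tendstoD(2) by blast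
    then obtain n :: nat where n: "M / 2 ^ n < d" by (auto simp: eventually_sequentially)
    show ?thesis
    proof (rule *[OF U x, of n])
      fix z z' assume z: "z \<in> sierpinski_gasket" "z' \<in> sierpinski_gasket" "dist z z' \<le> M / 2 ^ n"
      then have "dist (U z) (U z') < e" using d(2) n by (meson le_less_trans)
      then show "\<bar>U z - U z'\<bar> \<le> e" by (simp add: dist_real_def)
    qed
  qed
  then show ?thesis by (rule field_le_epsilon)
qed

lemma partial_form_Suc:
  "(\<Sum>k<Suc n. level_form k v) = cross v
    + 5 / 3 * ((\<Sum>k<n. level_form k (dyadic_half 0 v)) + (\<Sum>k<n. level_form k (dyadic_half 1 v)))"
  unfolding sum.lessThan_Suc_shift level_form.simps sum_distrib_left[symmetric] sum.distrib ..

text \<open>The second summand makes the induction work.  With \<open>P\<close> for the mean square distance from the value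
  at the top, \<open>cross v\<close> is at most \<open>P\<close> (\<open>cross_le\<close>), and \<open>P\<close> is at most the sum of its values for the two
  halves plus twice the energy of the upper cell.  So with the coefficient \<open>3/2\<close> the halves are
  needed with coefficient \<open>1 + 3/2 = 5/3 \<cdot> 3/2\<close>, exactly what the induction hypothesis provides.
  The constant \<open>24 = 3/2 \<cdot> 4\<^sup>2\<close> comes from level zero and \<open>bottom_apex_bound\<close>.\<close>

lemma restriction_partial_bound:
  assumes "U \<in> sg_dom" "continuous_on UNIV v" "\<And>x. x \<in> {0..1} \<Longrightarrow> U (x, 0) = v x"
  shows "(\<Sum>k<n. level_form k v) + 3 / 2 * avg (\<lambda>x. (v x - U (sg_vertex 2))\<^sup>2) \<le> 24 * sg_energy U"
  using assms
proof (induction n arbitrary: U v)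
  case 0
  have "(v x - U (sg_vertex 2))\<^sup>2 \<le> 16 * sg_energy U" if "x \<in> {0..1}" for x
  proof -
    have "\<bar>v x - U (sg_vertex 2)\<bar>\<^sup>2 \<le> (4 * sqrt (sg_energy U))\<^sup>2"
      using bottom_apex_bound[OF "0.prems"(1) that] "0.prems"(3)[OF that] by (intro power_mono) auto
    then show ?thesis using sg_energy_nonneg[OF "0.prems"(1)] by (simp add: power_mult_distrib)
  qed
  then have "avg (\<lambda>x. (v x - U (sg_vertex 2))\<^sup>2) \<le> 16 * sg_energy U"
    by (intro avg_bounds[of _ 0]) (auto intro!: continuous_intros "0.prems")
  then show ?case by simp
next
  case (Suc n)
  define V where "V i = U \<circ> sg_map i" for i
  define w where "w i = dyadic_half i v" for i
  define a where "a = U (sg_vertex 2)"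
  define b where "b i = V i (sg_vertex 2)" for i
  define P where "P i = avg (\<lambda>x. (w i x - b i)\<^sup>2)" for i
  have w: "continuous_on UNIV (w i)" for i
    unfolding w_def by (rule continuous_on_dyadic_half[OF Suc.prems(2)])
  have V: "V i \<in> sg_dom" if "i \<in> {0, 1, 2}" for i
    unfolding V_def by (rule sg_dom_sg_map[OF Suc.prems(1) that])
  have IH: "(\<Sum>k<n. level_form k (w i)) + 3 / 2 * P i \<le> 24 * sg_energy (V i)" if i: "i \<in> {0, 1}" for i
    unfolding P_def b_def
  proof (rule Suc.IH)
    show "V i \<in> sg_dom" by (rule V) (use i in auto)
    show "V i (x, 0) = w i x" if "x \<in> {0..1}" for x
    proof -
      have "V i (x, 0) = U ((x + real i) / 2, 0)" using i by (auto simp: V_def sg_map_bottom)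
      also have "\<dots> = w i x" unfolding w_def dyadic_half_def
        by (rule Suc.prems(3), rule half_mem[OF that i])
      finally show ?thesis .
    qed
  qed (rule w)
  have step: "(b i - a)\<^sup>2 \<le> sg_energy (V 2)" if "i \<in> {0, 1}" for i
    using restriction_step[OF Suc.prems(1) that] by (simp only: b_def a_def V_def o_apply)
  have shift: "avg (\<lambda>x. (w i x - a)\<^sup>2) \<le> 2 * P i + 2 * (b i - a)\<^sup>2" for i
  proof -
    have "avg (\<lambda>x. (w i x - a)\<^sup>2) \<le> avg (\<lambda>x. 2 * (w i x - b i)\<^sup>2 + 2 * (b i - a)\<^sup>2)"
    proof (rule avg_mono)
      fix x
      have "0 \<le> ((w i x - b i) - (b i - a))\<^sup>2" by simp
      then show "(w i x - a)\<^sup>2 \<le> 2 * (w i x - b i)\<^sup>2 + 2 * (b i - a)\<^sup>2"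
        by (simp add: power2_eq_square algebra_simps)
    qed (intro continuous_intros w)+
    also have "\<dots> = 2 * P i + 2 * (b i - a)\<^sup>2"
      unfolding P_def by (subst avg_add avg_mult avg_const; (intro continuous_intros w)?)+ simp
    finally show ?thesis .
  qed
  define A where "A = avg (\<lambda>x. (v x - a)\<^sup>2)"
  have A: "A = (avg (\<lambda>x. (w 0 x - a)\<^sup>2) + avg (\<lambda>x. (w 1 x - a)\<^sup>2)) / 2"
    unfolding A_def w_def by (rule avg_square_shift_halves[OF Suc.prems(2)])
  have "cross v \<le> A" unfolding A_def by (rule cross_le[OF Suc.prems(2)])
  have E: "sg_energy U = 5 / 3 * (sg_energy (V 0) + sg_energy (V 1) + sg_energy (V 2))"
    using sg_energy_decomp[OF Suc.prems(1)] by (simp add: V_def)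
  have "(\<Sum>k<Suc n. level_form k v) + 3 / 2 * A
      \<le> 5 / 3 * ((\<Sum>k<n. level_form k (w 0)) + (\<Sum>k<n. level_form k (w 1))) + 5 / 2 * A"
    unfolding partial_form_Suc w_def using \<open>cross v \<le> A\<close> by simp
  also have "\<dots> \<le> 5 / 3 * ((\<Sum>k<n. level_form k (w 0)) + (\<Sum>k<n. level_form k (w 1)))
      + 5 / 2 * (P 0 + P 1 + 2 * sg_energy (V 2))"
    using A shift[of 0] shift[of 1] step[of 0] step[of 1] by simp
  also have "\<dots> \<le> 24 * sg_energy U"
    using IH[of 0] IH[of 1] sg_energy_nonneg[OF V, of 2] E by (simp add: field_simps)
  finally show ?case unfolding A_def a_def .
qed

lemma trace_restriction:
  assumes "U \<in> sg_dom" "continuous_on UNIV v" "\<And>x. x \<in> {0..1} \<Longrightarrow> U (x, 0) = v x"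
  shows "summable (\<lambda>n. level_form n v)" "dyadic_form v \<le> 24 * sg_energy U"
proof -
  have b: "(\<Sum>k<n. level_form k v) \<le> 24 * sg_energy U" for n
  proof -
    have "0 \<le> avg (\<lambda>x. (v x - U (sg_vertex 2))\<^sup>2)"
      by (intro avg_nonneg continuous_intros assms(2)) simp
    then show ?thesis using restriction_partial_bound[OF assms, of n] by linarith
  qed
  show s: "summable (\<lambda>n. level_form n v)"
    by (rule summableI_nonneg_bounded[OF level_form_nonneg[OF assms(2)] b])
  show "dyadic_form v \<le> 24 * sg_energy U"
    unfolding dyadic_form_def by (rule suminf_le_const[OF s b])
qed

lemma trace_domD:
  assumes "v \<in> trace_dom" "continuous_on UNIV v'" "\<And>x. x \<in> {0..1} \<Longrightarrow> v' x = v x"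
  shows "summable (\<lambda>n. level_form n v')" "dyadic_form v' \<le> 24 * trace_energy v"
proof -
  have ne: "sg_extensions v \<noteq> {}" using assms(1) by (simp add: trace_dom_def)
  have U: "summable (\<lambda>n. level_form n v') \<and> dyadic_form v' \<le> 24 * sg_energy U" if "U \<in> sg_extensions v" for U
    using trace_restriction[of U v'] that assms(2,3) by (auto simp: sg_extensions_def)
  show "summable (\<lambda>n. level_form n v')" using ne U by blast
  have "dyadic_form v' / 24 \<le> trace_energy v"
    unfolding trace_energy_def using ne U by (intro cInf_greatest) fastforce+
  then show "dyadic_form v' \<le> 24 * trace_energy v" by simp
qed

section \<open>Binary expansions\<close>

definition digits :: "(nat \<Rightarrow> real) \<Rightarrow> bool" where
  "digits \<omega> \<longleftrightarrow> (\<forall>j. \<omega> j \<in> {0, 1})"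

lemma digits_Suc: "digits \<omega> \<Longrightarrow> digits (\<lambda>j. \<omega> (Suc j))"
  by (simp add: digits_def)

lemma digits_case: "digits \<omega> \<Longrightarrow> a \<in> {0, 1} \<Longrightarrow> digits (case_nat a \<omega>)"
  by (simp add: digits_def split: nat.split)

lemma summable_digits:
  assumes "digits \<omega>"
  shows "summable (\<lambda>j. \<omega> j / 2 ^ Suc j)"
proof (rule summable_comparison_test')
  show "summable (\<lambda>j. (1 / 2 :: real) ^ Suc j)"
    by (subst summable_Suc_iff) (simp add: summable_geometric)
  fix j
  have "\<omega> j = 0 \<or> \<omega> j = 1" using assms by (simp add: digits_def)
  then show "norm (\<omega> j / 2 ^ Suc j) \<le> (1 / 2) ^ Suc j" by (auto simp: power_divide)
qed

lemma binary_val_bounds: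
  assumes "digits \<omega>"
  shows "0 \<le> binary_val \<omega>" "binary_val \<omega> \<le> 1"
proof -
  have d: "\<omega> j = 0 \<or> \<omega> j = 1" for j using assms by (simp add: digits_def)
  have "0 \<le> \<omega> j / 2 ^ Suc j" for j using d[of j] by auto
  then show "0 \<le> binary_val \<omega>"
    unfolding binary_val_def by (intro suminf_nonneg summable_digits assms)
  have "(\<Sum>j. \<omega> j / 2 ^ Suc j) \<le> (\<Sum>j. (1 / 2) ^ Suc j)"
  proof (rule suminf_le)
    show "summable (\<lambda>j. (1 / 2 :: real) ^ Suc j)"
      by (subst summable_Suc_iff) (simp add: summable_geometric)
    show "\<omega> j / 2 ^ Suc j \<le> (1 / 2) ^ Suc j" for j using d[of j] by (auto simp: power_divide)
  qed (rule summable_digits[OF assms])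
  also have "\<dots> = 1" using power_half_series by (rule sums_unique[symmetric])
  finally show "binary_val \<omega> \<le> 1" by (simp add: binary_val_def)
qed

lemma binary_val_split:
  assumes "digits \<omega>"
  shows "binary_val \<omega> = (\<omega> 0 + binary_val (\<lambda>j. \<omega> (Suc j))) / 2"
proof -
  have "binary_val \<omega> = \<omega> 0 / 2 + (\<Sum>j. \<omega> (Suc j) / 2 ^ Suc (Suc j))"
    unfolding binary_val_def using suminf_split_head[OF summable_digits[OF assms]] by simp
  also have "(\<Sum>j. \<omega> (Suc j) / 2 ^ Suc (Suc j)) = (\<Sum>j. 1 / 2 * (\<omega> (Suc j) / 2 ^ Suc j))"
    by simp
  also have "\<dots> = 1 / 2 * binary_val (\<lambda>j. \<omega> (Suc j))"
    unfolding binary_val_def by (rule suminf_mult[OF summable_digits[OF digits_Suc[OF assms]]])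
  finally show ?thesis by simp
qed

lemma binary_expansions_eq: "binary_expansions x = {\<omega>. digits \<omega> \<and> binary_val \<omega> = x}"
  by (simp add: binary_expansions_def digits_def)

lemma binary_expansions_nonempty:
  assumes "0 \<le> x" "x < 1"
  shows "binary_expansions x \<noteq> {}"
proof -
  \<comment> \<open>These digits make the partial sums telescope.\<close>
  define \<omega> where "\<omega> j = real_of_int (\<lfloor>2 ^ Suc j * x\<rfloor> - 2 * \<lfloor>2 ^ j * x\<rfloor>)" for j
  have "\<omega> j \<in> {0, 1}" for j
  proof -
    define t where "t = 2 ^ j * x"
    have "\<omega> j = real_of_int (\<lfloor>2 * t\<rfloor> - 2 * \<lfloor>t\<rfloor>)" by (simp add: \<omega>_def t_def mult.assoc)
    moreover have "\<lfloor>2 * t\<rfloor> - 2 * \<lfloor>t\<rfloor> = 0 \<or> \<lfloor>2 * t\<rfloor> - 2 * \<lfloor>t\<rfloor> = 1" by linarith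
    ultimately show ?thesis by (elim disjE) simp_all
  qed
  then have "digits \<omega>" by (simp add: digits_def)
  have partial: "(\<Sum>j<n. \<omega> j / 2 ^ Suc j) = \<lfloor>2 ^ n * x\<rfloor> / 2 ^ n" for n
  proof (induction n)
    case 0
    have "\<lfloor>x\<rfloor> = 0" using assms by linarith
    then show ?case by simp
  next
    case (Suc n)
    have "\<lfloor>2 ^ n * x\<rfloor> / 2 ^ n + \<omega> n / 2 ^ Suc n = \<lfloor>2 ^ Suc n * x\<rfloor> / 2 ^ Suc n"
      unfolding \<omega>_def by (simp add: field_simps)
    then show ?case using Suc by simp
  qed
  have "(\<lambda>n. \<lfloor>2 ^ n * x\<rfloor> / 2 ^ n) \<longlonglongrightarrow> x"
  proof (rule tendsto_sandwich[of "\<lambda>n. x - 1 / 2 ^ n" _ _ "\<lambda>n. x"])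
    show "\<forall>\<^sub>F n in sequentially. x - 1 / 2 ^ n \<le> \<lfloor>2 ^ n * x\<rfloor> / 2 ^ n"
    proof (rule always_eventually, rule allI)
      fix n :: nat
      have "2 ^ n * x - 1 \<le> \<lfloor>2 ^ n * x\<rfloor>" by linarith
      then have "(2 ^ n * x - 1) / 2 ^ n \<le> \<lfloor>2 ^ n * x\<rfloor> / 2 ^ n" by (rule divide_right_mono) simp
      then show "x - 1 / 2 ^ n \<le> \<lfloor>2 ^ n * x\<rfloor> / 2 ^ n" by (simp add: diff_divide_distrib)
    qed
    show "\<forall>\<^sub>F n in sequentially. \<lfloor>2 ^ n * x\<rfloor> / 2 ^ n \<le> x"
    proof (rule always_eventually, rule allI)
      fix n :: nat
      have "\<lfloor>2 ^ n * x\<rfloor> \<le> 2 ^ n * x" by linarith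
      then show "\<lfloor>2 ^ n * x\<rfloor> / 2 ^ n \<le> x" by (simp add: field_simps)
    qed
    show "(\<lambda>n. x - 1 / 2 ^ n) \<longlonglongrightarrow> x" by real_asymp
  qed simp
  then have "(\<lambda>j. \<omega> j / 2 ^ Suc j) sums x" unfolding sums_def partial .
  then have "binary_val \<omega> = x" unfolding binary_val_def by (rule sums_unique[symmetric])
  then show ?thesis using \<open>digits \<omega>\<close> by (auto simp: binary_expansions_eq)
qed

lemma binary_expansions_below_half:
  assumes "x < 1 / 2"
  shows "binary_expansions x = case_nat 0 ` binary_expansions (2 * x)"
proof (intro set_eqI iffI)
  fix \<omega> assume "\<omega> \<in> binary_expansions x"
  then have \<omega>: "digits \<omega>" "binary_val \<omega> = x" by (auto simp: binary_expansions_eq)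
  have "\<omega> 0 = 0 \<or> \<omega> 0 = 1" using \<omega>(1) by (simp add: digits_def)
  then have 0: "\<omega> 0 = 0"
    using binary_val_split[OF \<omega>(1)] binary_val_bounds[OF digits_Suc[OF \<omega>(1)]] assms \<omega>(2) by auto
  have "(\<lambda>j. \<omega> (Suc j)) \<in> binary_expansions (2 * x)"
    using binary_val_split[OF \<omega>(1)] digits_Suc[OF \<omega>(1)] \<omega>(2) 0 by (simp add: binary_expansions_eq)
  moreover have "\<omega> = case_nat 0 (\<lambda>j. \<omega> (Suc j))" using 0 by (auto split: nat.split)
  ultimately show "\<omega> \<in> case_nat 0 ` binary_expansions (2 * x)" by (metis image_eqI)
next
  fix \<omega> assume "\<omega> \<in> case_nat 0 ` binary_expansions (2 * x)"
  then obtain \<xi> where \<xi>: "digits \<xi>" "binary_val \<xi> = 2 * x" "\<omega> = case_nat 0 \<xi>"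
    by (auto simp: binary_expansions_eq)
  have "digits \<omega>" unfolding \<xi>(3) by (rule digits_case) (use \<xi> in auto)
  then show "\<omega> \<in> binary_expansions x"
    using binary_val_split[OF \<open>digits \<omega>\<close>] \<xi> by (simp add: binary_expansions_eq)
qed

lemma binary_expansions_above_half:
  assumes "1 / 2 < x"
  shows "binary_expansions x = case_nat 1 ` binary_expansions (2 * x - 1)"
proof (intro set_eqI iffI)
  fix \<omega> assume "\<omega> \<in> binary_expansions x"
  then have \<omega>: "digits \<omega>" "binary_val \<omega> = x" by (auto simp: binary_expansions_eq)
  have "\<omega> 0 = 0 \<or> \<omega> 0 = 1" using \<omega>(1) by (simp add: digits_def)
  then have 0: "\<omega> 0 = 1"
    using binary_val_split[OF \<omega>(1)] binary_val_bounds[OF digits_Suc[OF \<omega>(1)]] assms \<omega>(2) by auto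
  have "(\<lambda>j. \<omega> (Suc j)) \<in> binary_expansions (2 * x - 1)"
    using binary_val_split[OF \<omega>(1)] digits_Suc[OF \<omega>(1)] \<omega>(2) 0 by (simp add: binary_expansions_eq)
  moreover have "\<omega> = case_nat 1 (\<lambda>j. \<omega> (Suc j))" using 0 by (auto split: nat.split)
  ultimately show "\<omega> \<in> case_nat 1 ` binary_expansions (2 * x - 1)" by (metis image_eqI)
next
  fix \<omega> assume "\<omega> \<in> case_nat 1 ` binary_expansions (2 * x - 1)"
  then obtain \<xi> where \<xi>: "digits \<xi>" "binary_val \<xi> = 2 * x - 1" "\<omega> = case_nat 1 \<xi>"
    by (auto simp: binary_expansions_eq)
  have "digits \<omega>" unfolding \<xi>(3) by (rule digits_case) (use \<xi> in auto)
  then show "\<omega> \<in> binary_expansions x"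
    using binary_val_split[OF \<open>digits \<omega>\<close>] \<xi> by (simp add: binary_expansions_eq)
qed

definition prefixes :: "real \<Rightarrow> real \<Rightarrow> nat set" where
  "prefixes x y = {common_prefix \<omega> \<xi> | \<omega> \<xi>. \<omega> \<in> binary_expansions x \<and> \<xi> \<in> binary_expansions y}"

lemma n_star_eq: "n_star x y = Max (prefixes x y)"
  by (simp add: n_star_def prefixes_def)

lemma binary_val_dist:
  assumes "digits \<omega>" "digits \<xi>" "\<And>j. j < n \<Longrightarrow> \<omega> j = \<xi> j"
  shows "\<bar>binary_val \<omega> - binary_val \<xi>\<bar> \<le> 1 / 2 ^ n"
  using assms
proof (induction n arbitrary: \<omega> \<xi>)
  case 0
  then show ?case using binary_val_bounds[of \<omega>] binary_val_bounds[of \<xi>] by simp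
next
  case (Suc n)
  have "\<bar>binary_val (\<lambda>j. \<omega> (Suc j)) - binary_val (\<lambda>j. \<xi> (Suc j))\<bar> \<le> 1 / 2 ^ n"
    by (rule Suc.IH) (use Suc.prems in \<open>auto intro: digits_Suc\<close>)
  moreover have "binary_val \<omega> - binary_val \<xi>
      = (binary_val (\<lambda>j. \<omega> (Suc j)) - binary_val (\<lambda>j. \<xi> (Suc j))) / 2"
    using binary_val_split[OF Suc.prems(1)] binary_val_split[OF Suc.prems(2)] Suc.prems(3)[of 0] by simp
  ultimately show ?case by (simp add: abs_divide)
qed

lemma finite_prefixes:
  assumes "x \<noteq> y"
  shows "finite (prefixes x y)"
proof -
  have "(\<lambda>N. 1 / 2 ^ N :: real) \<longlonglongrightarrow> 0" by real_asymp
  then have "eventually (\<lambda>N. 1 / 2 ^ N < \<bar>x - y\<bar>) sequentially"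
    using assms by (intro order_tendstoD(2)) auto
  then obtain N :: nat where N: "\<And>n. n \<ge> N \<Longrightarrow> 1 / 2 ^ n < \<bar>x - y\<bar>"
    by (auto simp: eventually_sequentially)
  have "k < N" if k: "k \<in> prefixes x y" for k
  proof -
    obtain \<omega> \<xi> where *: "digits \<omega>" "digits \<xi>" "binary_val \<omega> = x" "binary_val \<xi> = y" "k = common_prefix \<omega> \<xi>"
      using k unfolding prefixes_def binary_expansions_eq by blast
    have "\<omega> j = \<xi> j" if "j < k" for j
      using not_less_Least[of j "\<lambda>j. \<omega> j \<noteq> \<xi> j"] that *(5) by (auto simp: common_prefix_def)
    then have "\<bar>x - y\<bar> \<le> 1 / 2 ^ k" using binary_val_dist[OF *(1,2), of k] * by blast
    then show "k < N" using N[of k] by (meson leI linorder_not_less)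
  qed
  then show ?thesis by (meson finite_nat_iff_bounded lessThan_iff subsetI)
qed

lemma prefixes_nonempty:
  assumes "0 \<le> x" "x < 1" "0 \<le> y" "y < 1"
  shows "prefixes x y \<noteq> {}"
  using binary_expansions_nonempty[OF assms(1,2)] binary_expansions_nonempty[OF assms(3,4)]
  by (auto simp: prefixes_def)

lemma common_prefix_case:
  assumes "\<omega> \<noteq> \<xi>"
  shows "common_prefix (case_nat a \<omega>) (case_nat a \<xi>) = Suc (common_prefix \<omega> \<xi>)"
proof -
  obtain j where "\<omega> j \<noteq> \<xi> j" using assms by auto
  then show ?thesis
    unfolding common_prefix_def
    using Least_Suc[of "\<lambda>j. case_nat a \<omega> j \<noteq> case_nat a \<xi> j" "Suc j"] by simp
qed

text \<open>If all expansions of both numbers start with the same digit, removing it shortens every common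
  prefix by one.  Distinct numbers have boundedly long common prefixes, so the maximum is taken over
  a finite nonempty set and commutes with \<open>Suc\<close>.\<close>

lemma n_star_Suc:
  assumes ex: "binary_expansions x = case_nat a ` binary_expansions x'"
      "binary_expansions y = case_nat a ` binary_expansions y'"
    and x: "0 \<le> x'" "x' < y'" "y' < 1"
  shows "n_star x y = Suc (n_star x' y')"
proof -
  have ne: "\<omega> \<noteq> \<xi>" if "\<omega> \<in> binary_expansions x'" "\<xi> \<in> binary_expansions y'" for \<omega> \<xi>
    using that x by (auto simp: binary_expansions_eq)
  have "prefixes x y = Suc ` prefixes x' y'"
    unfolding prefixes_def ex using common_prefix_case[OF ne] by (auto simp: image_iff) (metis)+
  moreover have "finite (prefixes x' y')" "prefixes x' y' \<noteq> {}"
    using x finite_prefixes[of x' y'] prefixes_nonempty[of x' y'] by auto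
  ultimately show ?thesis
    unfolding n_star_eq by (simp add: mono_Max_commute[symmetric] mono_Suc)
qed

lemma n_star_0:
  assumes "0 \<le> x" "x < 1 / 2" "1 / 2 < y" "y < 1"
  shows "n_star x y = 0"
proof -
  have "prefixes x y \<subseteq> {0}"
    unfolding prefixes_def binary_expansions_below_half[OF assms(2)] binary_expansions_above_half[OF assms(3)]
    by (auto simp: common_prefix_def intro!: Least_equality)
  then have "prefixes x y = {0}" using prefixes_nonempty[of x y] assms by auto
  then show ?thesis by (simp add: n_star_eq)
qed

section \<open>The blocks above the diagonal\<close>

text \<open>The union over all dyadic squares of level \<open>n\<close> on the diagonal of the rescaled copies of \<open>X\<close>.
  The recursion is on preimages under the two expanding maps, which makes measurability and the
  change of variables immediate.\<close>

primrec blocks :: "(real \<times> real) set \<Rightarrow> nat \<Rightarrow> (real \<times> real) set" where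
  "blocks X 0 = X"
| "blocks X (Suc n) = {z. (2 * fst z, 2 * snd z) \<in> blocks X n} \<union> {z. (2 * fst z - 1, 2 * snd z - 1) \<in> blocks X n}"

definition top_block :: "(real \<times> real) set" where
  "top_block = {0<..<1 / 2} \<times> {1 / 2<..<1}"

text \<open>The part of the block that the exceptional set leaves untouched, up to boundary lines.\<close>

definition visible_block :: "real \<Rightarrow> (real \<times> real) set" where
  "visible_block s = {z \<in> top_block. fst z < s / 2 \<or> 1 - s / 2 < snd z}"

lemma blocks_mono: "X \<subseteq> Y \<Longrightarrow> blocks X n \<subseteq> blocks Y n"
  by (induction n) auto

lemma blocks_bounds:
  assumes "z \<in> blocks top_block n"
  shows "0 < fst z \<and> fst z < snd z \<and> snd z < 1"
  using assms
proof (induction n arbitrary: z)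
  case 0
  then show ?case by (auto simp: top_block_def)
next
  case (Suc n)
  then consider "(2 * fst z, 2 * snd z) \<in> blocks top_block n" | "(2 * fst z - 1, 2 * snd z - 1) \<in> blocks top_block n"
    by auto
  then show ?case by cases (use Suc.IH in fastforce)+
qed

lemma n_star_blocks: "(x, y) \<in> blocks top_block n \<Longrightarrow> n_star x y = n"
proof (induction n arbitrary: x y)
  case 0
  then show ?case by (intro n_star_0) (auto simp: top_block_def)
next
  case (Suc n)
  then consider "(2 * x, 2 * y) \<in> blocks top_block n" | "(2 * x - 1, 2 * y - 1) \<in> blocks top_block n"
    by auto
  then show ?case
  proof cases
    case 1
    with blocks_bounds[OF 1] have "n_star x y = Suc (n_star (2 * x) (2 * y))"
      by (intro n_star_Suc[of _ 0] binary_expansions_below_half) auto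
    then show ?thesis using Suc.IH[OF 1] by simp
  next
    case 2
    with blocks_bounds[OF 2] have "n_star x y = Suc (n_star (2 * x - 1) (2 * y - 1))"
      by (intro n_star_Suc[of _ 1] binary_expansions_above_half) auto
    then show ?thesis using Suc.IH[OF 2] by simp
  qed
qed

lemma half_map_eq: "half_map a z = ((fst z + a) / 2, (snd z + a) / 2)"
  by (simp add: half_map_def case_prod_beta field_simps)

lemma N_set_cases:
  assumes s: "0 < s" "s < 1" and z: "z \<in> N_set s"
  shows "z \<in> {0..1} \<times> {0..1} \<and>
    (z \<in> D_set s \<or> (2 * fst z, 2 * snd z) \<in> N_set s \<or> (2 * fst z - 1, 2 * snd z - 1) \<in> N_set s)"
proof -
  obtain w d where w: "w \<in> lists {0, 1}" "d \<in> D_set s" "z = word_map w d"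
    using z by (auto simp: N_set_def)
  have sq: "word_map w d \<in> {0..1} \<times> {0..1}" if "w \<in> lists {0, 1}" for w
    using that
  proof (induction w)
    case Nil
    then show ?case using w(2) s by (auto simp: word_map_def D_set_def)
  next
    case (Cons a w)
    then show ?case by (auto simp: word_map_def half_map_eq mem_Times_iff)
  qed
  show ?thesis
  proof (cases w)
    case Nil
    then show ?thesis using w sq[of w] by (simp add: word_map_def)
  next
    case (Cons a w')
    then have "z = half_map a (word_map w' d)" using w(3) by (simp add: word_map_def)
    then have "(2 * fst z - a, 2 * snd z - a) = word_map w' d"
      by (simp add: half_map_eq prod_eq_iff field_simps)
    moreover have "word_map w' d \<in> N_set s" using w Cons by (auto simp: N_set_def)
    moreover have "a = 0 \<or> a = 1" using w(1) Cons by simp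
    ultimately show ?thesis using w sq[of w] by auto
  qed
qed

text \<open>A point of a block at level \<open>n + 1\<close> has both coordinates on the same side of \<open>1/2\<close>.  So
  it is not in \<open>D_set s\<close>, and it can belong only to the image of \<open>N_set s\<close> under the half map of that
  side; expanding reduces to level \<open>n\<close>.\<close>

lemma visible_blocks_disjoint_N_set:
  assumes s: "0 < s" "s < 1"
  shows "z \<in> blocks (visible_block s) n \<Longrightarrow> z \<notin> N_set s"
proof (induction n arbitrary: z)
  case 0
  then have z: "0 < fst z" "fst z < 1 / 2" "1 / 2 < snd z" "snd z < 1" "fst z < s / 2 \<or> 1 - s / 2 < snd z"
    by (auto simp: visible_block_def top_block_def)
  show ?case
  proof
    assume "z \<in> N_set s"
    from N_set_cases[OF s this] consider "z \<in> D_set s"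
      | "(2 * fst z, 2 * snd z) \<in> N_set s" | "(2 * fst z - 1, 2 * snd z - 1) \<in> N_set s" by blast
    then show False
    proof cases
      case 1
      then show ?thesis using z by (auto simp: D_set_def)
    next
      case 2
      then show ?thesis using N_set_cases[OF s 2] z by auto
    next
      case 3
      then show ?thesis using N_set_cases[OF s 3] z by auto
    qed
  qed
next
  case (Suc n)
  have sub: "blocks (visible_block s) n \<subseteq> blocks top_block n"
    by (rule blocks_mono) (auto simp: visible_block_def)
  from Suc.prems consider (l) "(2 * fst z, 2 * snd z) \<in> blocks (visible_block s) n"
    | (r) "(2 * fst z - 1, 2 * snd z - 1) \<in> blocks (visible_block s) n" by auto
  then show ?case
  proof cases
    case l
    then have z: "0 < fst z" "fst z < snd z" "snd z < 1 / 2" using blocks_bounds sub by fastforce+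
    show ?thesis
    proof
      assume "z \<in> N_set s"
      then show False
        using N_set_cases[OF s \<open>z \<in> N_set s\<close>] N_set_cases[OF s, of "(2 * fst z - 1, 2 * snd z - 1)"]
          Suc.IH[OF l] z by (auto simp: D_set_def)
    qed
  next
    case r
    then have z: "1 / 2 < fst z" "fst z < snd z" "snd z < 1" using blocks_bounds sub by fastforce+
    show ?thesis
    proof
      assume "z \<in> N_set s"
      then show False
        using N_set_cases[OF s \<open>z \<in> N_set s\<close>] N_set_cases[OF s, of "(2 * fst z, 2 * snd z)"]
          Suc.IH[OF r] z by (auto simp: D_set_def)
    qed
  qed
qed

definition dyadic :: "real set" where
  "dyadic = (\<lambda>(k, m). real_of_int k / 2 ^ m) ` (UNIV \<times> UNIV)"

lemma dyadicI: "x = real_of_int k / 2 ^ m \<Longrightarrow> x \<in> dyadic"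
  unfolding dyadic_def by (rule image_eqI[of _ _ "(k, m)"]) auto

lemma dyadic_double:
  assumes "2 * x - real_of_int a \<in> dyadic"
  shows "x \<in> dyadic"
proof -
  obtain k m where "2 * x - real_of_int a = real_of_int k / 2 ^ m" using assms by (auto simp: dyadic_def)
  then show ?thesis by (intro dyadicI[of _ "k + a * 2 ^ m" "Suc m"]) (simp add: field_simps)
qed

text \<open>Expand until the distance of the two points has grown to \<open>1/2\<close> or more; at the latest then
  \<open>1/2\<close> separates them.  For non-dyadic points it is never hit.\<close>

lemma blocks_exhaust:
  assumes "0 < x" "x < y" "y < 1" "x \<notin> dyadic" "y \<notin> dyadic"
  shows "\<exists>n. (x, y) \<in> blocks top_block n"
proof -
  have "(\<lambda>N. 1 / 2 ^ N :: real) \<longlonglongrightarrow> 0" by real_asymp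
  then have "eventually (\<lambda>N. 1 / 2 ^ N < y - x) sequentially"
    using assms by (intro order_tendstoD(2)) auto
  then obtain N :: nat where N: "1 / 2 ^ N < y - x" by (auto simp: eventually_sequentially)
  show ?thesis using N assms
  proof (induction N arbitrary: x y)
    case 0
    then show ?case by simp
  next
    case (Suc N)
    have half: "1 / 2 \<in> dyadic" by (rule dyadicI[of _ 1 1]) simp
    then have "x \<noteq> 1 / 2" "y \<noteq> 1 / 2" using Suc.prems by blast+
    then consider "x < 1 / 2" "1 / 2 < y" | "y < 1 / 2" | "1 / 2 < x" using Suc.prems by linarith
    then show ?case
    proof cases
      case 1
      then have "(x, y) \<in> blocks top_block 0" using Suc.prems by (simp add: top_block_def)
      then show ?thesis by blast
    next
      case 2
      have "\<exists>n. (2 * x, 2 * y) \<in> blocks top_block n"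
        by (rule Suc.IH) (use 2 Suc.prems dyadic_double[of x 0] dyadic_double[of y 0] in \<open>auto simp: field_simps\<close>)
      then obtain n where "(2 * x, 2 * y) \<in> blocks top_block n" by blast
      then have "(x, y) \<in> blocks top_block (Suc n)" by simp
      then show ?thesis by blast
    next
      case 3
      have "\<exists>n. (2 * x - 1, 2 * y - 1) \<in> blocks top_block n"
        by (rule Suc.IH) (use 3 Suc.prems dyadic_double[of x 1] dyadic_double[of y 1] in \<open>auto simp: field_simps\<close>)
      then obtain n where "(2 * x - 1, 2 * y - 1) \<in> blocks top_block n" by blast
      then have "(x, y) \<in> blocks top_block (Suc n)" by simp
      then show ?thesis by blast
    qed
  qed
qed

lemma AE_not_dyadic: "AE z in (lborel :: (real \<times> real) measure). fst z \<notin> dyadic \<and> snd z \<notin> dyadic"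
proof -
  have "countable dyadic" unfolding dyadic_def by (intro countable_image countable_SIGMA) auto
  then have 0: "emeasure lborel dyadic = 0" by (rule emeasure_lborel_countable)
  have m: "dyadic \<in> sets lborel" by (rule sets.countable[OF _ \<open>countable dyadic\<close>]) simp
  have 1: "emeasure lborel (dyadic \<times> (UNIV :: real set)) = 0"
    unfolding lborel_prod[symmetric] using m 0 by (subst lborel.emeasure_pair_measure_Times) auto
  have 2: "emeasure lborel ((UNIV :: real set) \<times> dyadic) = 0"
    unfolding lborel_prod[symmetric] using m 0 by (subst lborel.emeasure_pair_measure_Times) auto
  have s: "dyadic \<times> (UNIV :: real set) \<in> sets lborel" "(UNIV :: real set) \<times> dyadic \<in> sets lborel"
    unfolding lborel_prod[symmetric] using m by (intro pair_measureI; simp)+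
  have "AE z in lborel. z \<notin> dyadic \<times> (UNIV :: real set)" "AE z in lborel. z \<notin> (UNIV :: real set) \<times> dyadic"
    using 1 2 s by (intro AE_not_in; simp add: null_sets_def)+
  then show ?thesis by eventually_elim (auto simp: mem_Times_iff)
qed

section \<open>Integrals over the blocks\<close>

definition sqdiff :: "(real \<Rightarrow> real) \<Rightarrow> real \<times> real \<Rightarrow> ennreal" where
  "sqdiff u z = ennreal ((u (fst z) - u (snd z))\<^sup>2)"

lemma sqdiff_measurable:
  assumes "continuous_on UNIV u"
  shows "sqdiff u \<in> borel_measurable borel"
proof -
  have "continuous_on UNIV (\<lambda>z. (u (fst z) - u (snd z))\<^sup>2)"
    by (intro continuous_intros continuous_on_compose2[OF assms]) auto
  then have "(\<lambda>z. (u (fst z) - u (snd z))\<^sup>2) \<in> borel_measurable borel"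
    by (rule borel_measurable_continuous_onI)
  then show ?thesis unfolding sqdiff_def[abs_def] by measurable
qed

lemma blocks_borel: "X \<in> sets borel \<Longrightarrow> blocks X n \<in> sets borel"
proof (induction n)
  case (Suc n)
  have "(\<lambda>z. (2 * fst z - c, 2 * snd z - c)) -` blocks X n \<in> sets borel" for c :: real
  proof -
    have "continuous_on UNIV (\<lambda>z::real \<times> real. (2 * fst z - c, 2 * snd z - c))"
      by (intro continuous_intros)
    then have "(\<lambda>z::real \<times> real. (2 * fst z - c, 2 * snd z - c)) \<in> borel_measurable borel"
      by (rule borel_measurable_continuous_onI)
    from measurable_sets[OF this Suc.IH[OF Suc.prems]] show ?thesis by simp
  qed
  from this[of 0] this[of 1] show ?case by (simp add: vimage_def sets.Un)
qed simp

lemma top_block_borel [measurable]: "top_block \<in> sets borel"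
  unfolding top_block_def by (intro borel_open open_Times) auto

lemma visible_block_borel [measurable]: "visible_block s \<in> sets borel"
proof -
  have "visible_block s = top_block \<inter> ({z. fst z < s / 2} \<union> {z. 1 - s / 2 < snd z})"
    by (auto simp: visible_block_def)
  moreover have "open \<dots>"
    unfolding top_block_def
    by (intro open_Int open_Un open_Times open_Collect_less continuous_intros) auto
  ultimately show ?thesis by simp
qed

lemma nn_integral_contract:
  fixes h :: "real \<times> real \<Rightarrow> ennreal"
  assumes [measurable]: "h \<in> borel_measurable borel"
  shows "(\<integral>\<^sup>+ z. h z \<partial>lborel) = ennreal (1 / 4) * (\<integral>\<^sup>+ z. h (t + (1 / 2) *\<^sub>R z) \<partial>lborel)"
proof -
  have "(\<integral>\<^sup>+ z. h z \<partial>lborel)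
      = (\<integral>\<^sup>+ z. h z \<partial>density (distr lborel borel (\<lambda>x. t + (1 / 2) *\<^sub>R x)) (\<lambda>_. ennreal (\<bar>1 / 2\<bar> ^ DIM(real \<times> real))))"
    using lborel_affine[of "1 / 2" t] by simp
  also have "\<dots> = (\<integral>\<^sup>+ z. ennreal (1 / 4) * h (t + (1 / 2) *\<^sub>R z) \<partial>lborel)"
    by (subst nn_integral_density) (simp_all add: nn_integral_distr power2_eq_square)
  also have "\<dots> = ennreal (1 / 4) * (\<integral>\<^sup>+ z. h (t + (1 / 2) *\<^sub>R z) \<partial>lborel)"
    by (rule nn_integral_cmult) simp
  finally show ?thesis .
qed

definition block_form :: "(real \<times> real) set \<Rightarrow> nat \<Rightarrow> (real \<Rightarrow> real) \<Rightarrow> ennreal" where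
  "block_form X n u = (\<integral>\<^sup>+ z. ennreal ((20 / 3) ^ n) * (sqdiff u z * indicator (blocks X n) z) \<partial>lborel)"

text \<open>The weight grows by \<open>20/3\<close> and the area shrinks by \<open>1/4\<close>, which gives the factor \<open>5/3\<close>.\<close>

lemma block_form_Suc:
  assumes X[measurable]: "X \<in> sets borel" and sub: "X \<subseteq> top_block" and u: "continuous_on UNIV u"
  shows "block_form X (Suc n) u
    = ennreal (5 / 3) * (block_form X n (dyadic_half 0 u) + block_form X n (dyadic_half 1 u))"
proof -
  note [measurable] = sqdiff_measurable[OF u] sqdiff_measurable[OF continuous_on_dyadic_half[OF u]]
  define S where "S i = {z. (2 * fst z - real i, 2 * snd z - real i) \<in> blocks X n}" for i :: nat
  have S: "S i \<in> sets borel" for i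
  proof -
    have "continuous_on UNIV (\<lambda>z::real \<times> real. (2 * fst z - real i, 2 * snd z - real i))"
      by (intro continuous_intros)
    then have "(\<lambda>z::real \<times> real. (2 * fst z - real i, 2 * snd z - real i)) \<in> borel_measurable borel"
      by (rule borel_measurable_continuous_onI)
    from measurable_sets[OF this blocks_borel[OF X, of n]] show ?thesis by (simp add: S_def vimage_def)
  qed
  note [measurable] = S blocks_borel[OF X]
  have b: "blocks X (Suc n) = S 0 \<union> S 1" by (auto simp: S_def)
  have disj: "S 0 \<inter> S 1 = {}"
  proof (rule ccontr)
    assume "S 0 \<inter> S 1 \<noteq> {}"
    then obtain z where z: "(2 * fst z, 2 * snd z) \<in> blocks X n" "(2 * fst z - 1, 2 * snd z - 1) \<in> blocks X n"
      by (auto simp: S_def)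
    show False
      using blocks_bounds[OF subsetD[OF blocks_mono[OF sub] z(1)]]
        blocks_bounds[OF subsetD[OF blocks_mono[OF sub] z(2)]] by simp
  qed
  have part: "(\<integral>\<^sup>+ z. sqdiff u z * indicator (S i) z \<partial>lborel)
      = ennreal (1 / 4) * (\<integral>\<^sup>+ z. sqdiff (dyadic_half i u) z * indicator (blocks X n) z \<partial>lborel)" for i
  proof -
    have "(\<integral>\<^sup>+ z. sqdiff u z * indicator (S i) z \<partial>lborel)
      = ennreal (1 / 4) * (\<integral>\<^sup>+ z. sqdiff u ((real i / 2, real i / 2) + (1 / 2) *\<^sub>R z)
          * indicator (S i) ((real i / 2, real i / 2) + (1 / 2) *\<^sub>R z) \<partial>lborel)"
      by (rule nn_integral_contract) measurable
    moreover have "sqdiff u ((real i / 2, real i / 2) + (1 / 2) *\<^sub>R z) = sqdiff (dyadic_half i u) z" for z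
      by (simp add: sqdiff_def dyadic_half_def add_divide_distrib add.commute)
    moreover have "indicator (S i) ((real i / 2, real i / 2) + (1 / 2) *\<^sub>R z) = (indicator (blocks X n) z :: ennreal)" for z
      by (auto simp: indicator_def S_def algebra_simps)
    ultimately show ?thesis by (simp only:)
  qed
  have cm: "block_form X n v = ennreal ((20 / 3) ^ n) * (\<integral>\<^sup>+ z. sqdiff v z * indicator (blocks X n) z \<partial>lborel)"
    if "continuous_on UNIV v" for v n
  proof -
    note [measurable] = sqdiff_measurable[OF that]
    show ?thesis unfolding block_form_def by (rule nn_integral_cmult) measurable
  qed
  have "(\<integral>\<^sup>+ z. sqdiff u z * indicator (blocks X (Suc n)) z \<partial>lborel)
      = (\<integral>\<^sup>+ z. sqdiff u z * indicator (S 0) z + sqdiff u z * indicator (S 1) z \<partial>lborel)"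
    unfolding b using disj by (intro nn_integral_cong) (auto simp: indicator_def)
  also have "\<dots> = (\<integral>\<^sup>+ z. sqdiff u z * indicator (S 0) z \<partial>lborel) + (\<integral>\<^sup>+ z. sqdiff u z * indicator (S 1) z \<partial>lborel)"
    by (rule nn_integral_add) measurable
  finally have "block_form X (Suc n) u = ennreal ((20 / 3) ^ Suc n) * (ennreal (1 / 4) *
      ((\<integral>\<^sup>+ z. sqdiff (dyadic_half 0 u) z * indicator (blocks X n) z \<partial>lborel)
       + (\<integral>\<^sup>+ z. sqdiff (dyadic_half 1 u) z * indicator (blocks X n) z \<partial>lborel)))"
    unfolding cm[OF u] part by (simp only: distrib_left)
  moreover have "ennreal ((20 / 3) ^ Suc n) * ennreal (1 / 4) = ennreal (5 / 3) * ennreal ((20 / 3) ^ n)"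
    by (simp add: ennreal_mult[symmetric])
  ultimately show ?thesis
    by (simp add: cm continuous_on_dyadic_half u distrib_left mult.assoc[symmetric])
qed

lemma nn_integral_interval:
  fixes f :: "real \<Rightarrow> real"
  assumes f: "continuous_on UNIV f" "\<And>x. 0 \<le> f x" and "a < b"
  shows "(\<integral>\<^sup>+ x. ennreal (f x) * indicator {a<..<b} x \<partial>lborel)
    = ennreal ((b - a) * avg (\<lambda>x. f (a + (b - a) * x)))"
proof (rule nn_integral_has_integral_lebesgue')
  have "f integrable_on {a..b}"
    by (rule integrable_continuous_interval) (rule continuous_on_subset[OF f(1)], simp)
  then show "(f has_integral (b - a) * avg (\<lambda>x. f (a + (b - a) * x))) {a<..<b}"
    unfolding integral_rescale[OF f(1) \<open>a < b\<close>, symmetric]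
    by (simp add: has_integral_Icc_iff_Ioo[symmetric] integrable_integral)
qed (use f in auto)

lemma nn_integral_rectangle:
  fixes u :: "real \<Rightarrow> real"
  assumes u: "continuous_on UNIV u" and "a < b" "c < d"
  defines "p \<equiv> \<lambda>x. u (a + (b - a) * x)" and "q \<equiv> \<lambda>x. u (c + (d - c) * x)"
  shows "(\<integral>\<^sup>+ z. sqdiff u z * indicator ({a<..<b} \<times> {c<..<d}) z \<partial>lborel)
    = ennreal ((b - a) * (d - c) * mean_sqdiff p q)"
proof -
  have pq: "continuous_on UNIV p" "continuous_on UNIV q"
    unfolding p_def q_def by (intro continuous_on_compose2[OF u] continuous_intros; simp)+
  note [measurable] = sqdiff_measurable[OF u] borel_measurable_continuous_onI[OF u]
  have [measurable]: "({a<..<b} \<times> {c<..<d}) \<in> sets borel" by (intro borel_open open_Times) auto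
  have inner_avg: "avg (\<lambda>y. (x - r y)\<^sup>2) = x\<^sup>2 + (- 2 * avg r) * x + avg (\<lambda>y. (r y)\<^sup>2)"
    if r: "continuous_on UNIV r" for r x
    using avg_square_shift[OF r, of x] by (simp add: power2_commute)
  have inner: "(\<integral>\<^sup>+ y. sqdiff u (x, y) * indicator ({a<..<b} \<times> {c<..<d}) (x, y) \<partial>lborel)
      = ennreal (d - c) * (ennreal (avg (\<lambda>y. (u x - q y)\<^sup>2)) * indicator {a<..<b} x)" for x
  proof -
    have "(\<integral>\<^sup>+ y. sqdiff u (x, y) * indicator ({a<..<b} \<times> {c<..<d}) (x, y) \<partial>lborel)
      = (\<integral>\<^sup>+ y. indicator {a<..<b} x * (ennreal ((u x - u y)\<^sup>2) * indicator {c<..<d} y) \<partial>lborel)"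
      by (intro nn_integral_cong) (auto simp: sqdiff_def indicator_def)
    also have "\<dots> = indicator {a<..<b} x * (\<integral>\<^sup>+ y. ennreal ((u x - u y)\<^sup>2) * indicator {c<..<d} y \<partial>lborel)"
      by (rule nn_integral_cmult) measurable
    also have "(\<integral>\<^sup>+ y. ennreal ((u x - u y)\<^sup>2) * indicator {c<..<d} y \<partial>lborel)
      = ennreal ((d - c) * avg (\<lambda>y. (u x - q y)\<^sup>2))"
      unfolding q_def by (intro nn_integral_interval continuous_intros u \<open>c < d\<close>) simp
    finally show ?thesis
      using \<open>c < d\<close> avg_nonneg[of "\<lambda>y. (u x - q y)\<^sup>2"]
      by (simp add: ennreal_mult pq continuous_intros ac_simps)
  qed
  have g: "continuous_on UNIV (\<lambda>x. avg (\<lambda>y. (u x - q y)\<^sup>2))"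
    unfolding inner_avg[OF pq(2)] by (intro continuous_intros u)
  have "(\<integral>\<^sup>+ z. sqdiff u z * indicator ({a<..<b} \<times> {c<..<d}) z \<partial>lborel)
      = (\<integral>\<^sup>+ x. \<integral>\<^sup>+ y. sqdiff u (x, y) * indicator ({a<..<b} \<times> {c<..<d}) (x, y) \<partial>lborel \<partial>lborel)"
    unfolding lborel_prod[symmetric]
    by (rule lborel.nn_integral_fst[symmetric]) (simp add: lborel_prod)
  also have "\<dots> = ennreal (d - c) * (\<integral>\<^sup>+ x. ennreal (avg (\<lambda>y. (u x - q y)\<^sup>2)) * indicator {a<..<b} x \<partial>lborel)"
    unfolding inner by (rule nn_integral_cmult) (use borel_measurable_continuous_onI[OF g] in measurable)
  also have "(\<integral>\<^sup>+ x. ennreal (avg (\<lambda>y. (u x - q y)\<^sup>2)) * indicator {a<..<b} x \<partial>lborel)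
      = ennreal ((b - a) * avg (\<lambda>x. avg (\<lambda>y. (p x - q y)\<^sup>2)))"
    unfolding p_def
    by (intro nn_integral_interval g avg_nonneg continuous_intros pq \<open>a < b\<close>) simp
  also have "avg (\<lambda>x. avg (\<lambda>y. (p x - q y)\<^sup>2)) = mean_sqdiff p q"
  proof -
    have "avg (\<lambda>x. avg (\<lambda>y. (p x - q y)\<^sup>2)) = avg (\<lambda>x. (p x)\<^sup>2 + (- 2 * avg q) * p x + avg (\<lambda>y. (q y)\<^sup>2))"
      unfolding inner_avg[OF pq(2)] ..
    also have "\<dots> = avg (\<lambda>x. (p x)\<^sup>2) + (- 2 * avg q) * avg p + avg (\<lambda>y. (q y)\<^sup>2)"
      by (subst avg_add avg_mult avg_const; (intro continuous_intros pq)?)+ simp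
    finally show ?thesis by (simp add: mean_sqdiff_def)
  qed
  also have "ennreal (d - c) * ennreal ((b - a) * mean_sqdiff p q)
      = ennreal ((b - a) * (d - c) * mean_sqdiff p q)"
    using \<open>c < d\<close> by (simp add: ennreal_mult'[symmetric] ac_simps)
  finally show ?thesis .
qed

text \<open>Both sides are variances plus squared differences of means; every variance on the left occurs
  on the right, and \<open>(x + y + z)\<^sup>2 \<le> 3 (x\<^sup>2 + y\<^sup>2 + z\<^sup>2)\<close> applies to the differences.\<close>

lemma mean_sqdiff_triangle:
  assumes "continuous_on UNIV p" "continuous_on UNIV q" "continuous_on UNIV p'" "continuous_on UNIV q'"
  shows "mean_sqdiff p q \<le> 3 * (mean_sqdiff p q' + mean_sqdiff p' q' + mean_sqdiff p' q)"
proof -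
  define v where "v f = avg (\<lambda>x. (f x)\<^sup>2) - (avg f)\<^sup>2" for f
  have v: "0 \<le> v p" "0 \<le> v q" "0 \<le> v p'" "0 \<le> v q'"
    unfolding v_def using avg_square_ge assms by simp_all
  have m: "mean_sqdiff f g = v f + v g + (avg f - avg g)\<^sup>2" for f g
    by (simp add: mean_sqdiff_def v_def power2_diff)
  have sq: "(x + y + z)\<^sup>2 \<le> 3 * x\<^sup>2 + 3 * y\<^sup>2 + 3 * z\<^sup>2" for x y z :: real
  proof -
    have "3 * x\<^sup>2 + 3 * y\<^sup>2 + 3 * z\<^sup>2 - (x + y + z)\<^sup>2 = (x - y)\<^sup>2 + (y - z)\<^sup>2 + (z - x)\<^sup>2"
      by (simp add: power2_eq_square algebra_simps)
    moreover have "0 \<le> (x - y)\<^sup>2 + (y - z)\<^sup>2 + (z - x)\<^sup>2" by simp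
    ultimately show ?thesis by linarith
  qed
  have "(avg p - avg q)\<^sup>2 \<le> 3 * (avg p - avg q')\<^sup>2 + 3 * (avg p' - avg q')\<^sup>2 + 3 * (avg p' - avg q)\<^sup>2"
    using sq[of "avg p - avg q'" "avg q' - avg p'" "avg p' - avg q"] by (simp add: power2_commute)
  then show ?thesis unfolding m using v by (simp add: algebra_simps)
qed

lemma block_form_top: "continuous_on UNIV u \<Longrightarrow> block_form top_block n u = ennreal (level_form n u)"
proof (induction n arbitrary: u)
  case 0
  have "block_form top_block 0 u
      = ennreal (1 / 4 * mean_sqdiff (\<lambda>x. u (0 + (1 / 2 - 0) * x)) (\<lambda>x. u (1 / 2 + (1 - 1 / 2) * x)))"
    using nn_integral_rectangle[OF 0, of 0 "1 / 2" "1 / 2" 1]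
    by (simp add: block_form_def top_block_def)
  also have "1 / 4 * mean_sqdiff (\<lambda>x. u (0 + (1 / 2 - 0) * x)) (\<lambda>x. u (1 / 2 + (1 - 1 / 2) * x)) = cross u"
    by (simp add: cross_def mean_sqdiff_def dyadic_half_def add_divide_distrib add.commute)
  finally show ?case by simp
next
  case (Suc n)
  then show ?case
    by (simp add: block_form_Suc continuous_on_dyadic_half ennreal_mult' level_form_nonneg distrib_left)
      (simp add: ennreal_mult'[symmetric] ennreal_plus[symmetric] level_form_nonneg continuous_on_dyadic_half del: ennreal_plus)
qed

lemma block_form_mono: "X \<subseteq> Y \<Longrightarrow> block_form X n u \<le> block_form Y n u"
  unfolding block_form_def using blocks_mono[of X Y n]
  by (intro nn_integral_mono mult_left_mono) (auto simp: indicator_def)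

definition visible_const :: "real \<Rightarrow> real" where
  "visible_const s = 3 / 4 * (8 / s + 4 / s\<^sup>2)"

text \<open>The visible block contains three rectangles: left half times right end, left end times right
  end, and left end times right half, where the ends have length \<open>s/2\<close>.  Each mean over a rectangle is
  at most the integral over the visible block divided by the area, and the three means control the mean
  over the whole block by \<open>mean_sqdiff_triangle\<close>.\<close>

lemma top_le_visible_0:
  assumes s: "0 < s" "s < 1" and u: "continuous_on UNIV u"
  shows "block_form top_block 0 u \<le> ennreal (visible_const s) * block_form (visible_block s) 0 u"
proof -
  define P where "P a b = (\<lambda>x. u (a + (b - a) * x))" for a b
  have P: "continuous_on UNIV (P a b)" for a b
    unfolding P_def by (intro continuous_on_compose2[OF u] continuous_intros; simp)
  have rect: "block_form ({a<..<b} \<times> {c<..<d}) 0 u = ennreal ((b - a) * (d - c) * mean_sqdiff (P a b) (P c d))"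
    if "a < b" "c < d" for a b c d
    using nn_integral_rectangle[OF u that] by (simp add: block_form_def P_def)
  have "block_form (visible_block s) 0 u \<le> block_form top_block 0 u"
    by (rule block_form_mono) (auto simp: visible_block_def)
  also have "\<dots> < \<infinity>" using block_form_top[OF u, of 0] by simp
  finally obtain i where i: "0 \<le> i" "block_form (visible_block s) 0 u = ennreal i"
    by (cases "block_form (visible_block s) 0 u") auto
  have sub: "(b - a) * (d - c) * mean_sqdiff (P a b) (P c d) \<le> i"
    if "a < b" "c < d" "{a<..<b} \<times> {c<..<d} \<subseteq> visible_block s" for a b c d
    using block_form_mono[OF that(3), of 0 u] i rect[OF that(1,2)] by simp
  define A where "A = mean_sqdiff (P 0 (1 / 2)) (P (1 - s / 2) 1)"
  define B where "B = mean_sqdiff (P 0 (s / 2)) (P (1 - s / 2) 1)"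
  define C where "C = mean_sqdiff (P 0 (s / 2)) (P (1 / 2) 1)"
  have "(1 / 2 - 0) * (1 - (1 - s / 2)) * A \<le> i" unfolding A_def
    by (rule sub) (use s in \<open>auto simp: visible_block_def top_block_def\<close>)
  then have A: "A \<le> 4 / s * i" using s by (simp add: field_simps)
  have "(s / 2 - 0) * (1 - (1 - s / 2)) * B \<le> i" unfolding B_def
    by (rule sub) (use s in \<open>auto simp: visible_block_def top_block_def\<close>)
  then have B: "B \<le> 4 / s\<^sup>2 * i" using s by (simp add: field_simps power2_eq_square)
  have "(s / 2 - 0) * (1 - 1 / 2) * C \<le> i" unfolding C_def
    by (rule sub) (use s in \<open>auto simp: visible_block_def top_block_def\<close>)
  then have C: "C \<le> 4 / s * i" using s by (simp add: field_simps)
  have "block_form top_block 0 u = ennreal (1 / 4 * mean_sqdiff (P 0 (1 / 2)) (P (1 / 2) 1))"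
    using rect[of 0 "1 / 2" "1 / 2" 1] by (simp add: top_block_def)
  also have "1 / 4 * mean_sqdiff (P 0 (1 / 2)) (P (1 / 2) 1) \<le> 1 / 4 * (3 * (A + B + C))"
    unfolding A_def B_def C_def by (intro mult_left_mono mean_sqdiff_triangle P) simp
  also have "\<dots> = 3 / 4 * (A + B + C)" by simp
  also have "\<dots> \<le> 3 / 4 * (4 / s * i + 4 / s\<^sup>2 * i + 4 / s * i)"
    by (intro mult_left_mono add_mono A B C) simp
  also have "\<dots> = visible_const s * i" by (simp add: visible_const_def algebra_simps)
  finally have "block_form top_block 0 u \<le> ennreal (visible_const s * i)" by (simp add: ennreal_leI)
  moreover have "0 \<le> visible_const s" using s by (simp add: visible_const_def)
  ultimately show ?thesis unfolding i(2) by (simp only: ennreal_mult i(1))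
qed

lemma top_le_visible:
  assumes s: "0 < s" "s < 1"
  shows "continuous_on UNIV u \<Longrightarrow>
    block_form top_block n u \<le> ennreal (visible_const s) * block_form (visible_block s) n u"
proof (induction n arbitrary: u)
  case 0
  then show ?case by (rule top_le_visible_0[OF s])
next
  case (Suc n)
  have sub: "visible_block s \<subseteq> top_block" by (auto simp: visible_block_def)
  have "block_form top_block (Suc n) u
      \<le> ennreal (5 / 3) * (ennreal (visible_const s) * block_form (visible_block s) n (dyadic_half 0 u)
        + ennreal (visible_const s) * block_form (visible_block s) n (dyadic_half 1 u))"
    unfolding block_form_Suc[OF top_block_borel order_refl Suc.prems]
    by (intro mult_left_mono add_mono Suc.IH continuous_on_dyadic_half Suc.prems) simp
  also have "\<dots> = ennreal (visible_const s) * block_form (visible_block s) (Suc n) u"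
    unfolding block_form_Suc[OF visible_block_borel sub Suc.prems]
    by (simp add: distrib_left ac_simps)
  finally show ?case .
qed

section \<open>Comparison of the jump form with the dyadic form\<close>

definition kernel_sum :: "(real \<times> real) set \<Rightarrow> (real \<Rightarrow> real) \<Rightarrow> real \<times> real \<Rightarrow> ennreal" where
  "kernel_sum X u z = (\<Sum>n. ennreal ((20 / 3) ^ n) * (sqdiff u z * indicator (blocks X n) z))"

lemma kernel_sum_measurable:
  assumes "X \<in> sets borel" "continuous_on UNIV u"
  shows "kernel_sum X u \<in> borel_measurable borel"
proof -
  note [measurable] = blocks_borel[OF assms(1)] sqdiff_measurable[OF assms(2)]
  show ?thesis unfolding kernel_sum_def[abs_def] by measurable
qed

lemma ennreal_mult3:
  "0 \<le> a \<Longrightarrow> 0 \<le> b \<Longrightarrow> 0 \<le> c \<Longrightarrow> ennreal (a * (b * c)) = ennreal a * (ennreal b * ennreal c)"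
  by (simp only: ennreal_mult mult_nonneg_nonneg)

lemma nn_integral_kernel_sum:
  assumes X: "X \<in> sets borel" and u: "continuous_on UNIV u"
  shows "(\<integral>\<^sup>+ z. kernel_sum X u z \<partial>lborel) = (\<Sum>n. block_form X n u)"
proof -
  note [measurable] = blocks_borel[OF X] sqdiff_measurable[OF u]
  show ?thesis unfolding kernel_sum_def block_form_def by (rule nn_integral_suminf) measurable
qed

text \<open>Blocks of different levels are disjoint because \<open>n_star\<close> recovers the level.\<close>

lemma kernel_sum_eq:
  assumes "X \<subseteq> top_block" "z \<in> blocks X n"
  shows "kernel_sum X u z = ennreal ((20 / 3) ^ n) * sqdiff u z"
proof -
  have "m = n" if "z \<in> blocks X m" for m
    using n_star_blocks[of "fst z" "snd z"] blocks_mono[OF assms(1)] that assms(2)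
    by (metis prod.collapse subsetD)
  then have "kernel_sum X u z
      = (\<Sum>m\<in>{n}. ennreal ((20 / 3) ^ m) * (sqdiff u z * indicator (blocks X m) z))"
    unfolding kernel_sum_def by (intro suminf_finite) (auto simp: indicator_def)
  then show ?thesis using assms(2) by simp
qed

lemma kernel_sum_outside: "(\<And>n. z \<notin> blocks X n) \<Longrightarrow> kernel_sum X u z = 0"
  by (simp add: kernel_sum_def)

lemma J_star_bounds:
  assumes "n_star x y = n"
  shows "245 / 136 * (20 / 3) ^ n \<le> J_star x y" "J_star x y \<le> 35 / 16 * (20 / 3) ^ n"
proof -
  have "(1 :: real) \<le> (20 / 3) ^ n" by simp
  then show "245 / 136 * (20 / 3) ^ n \<le> J_star x y" "J_star x y \<le> 35 / 16 * (20 / 3) ^ n"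
    unfolding J_star_def assms by (simp_all add: field_simps)
qed

lemma nn_integral_swap:
  fixes f :: "real \<times> real \<Rightarrow> ennreal"
  assumes "f \<in> borel_measurable borel"
  shows "(\<integral>\<^sup>+ z. f (prod.swap z) \<partial>lborel) = (\<integral>\<^sup>+ z. f z \<partial>lborel)"
proof -
  have f: "f \<in> borel_measurable (lborel \<Otimes>\<^sub>M lborel)" using assms by (simp add: lborel_prod)
  have "(\<integral>\<^sup>+ z. f z \<partial>(lborel \<Otimes>\<^sub>M lborel))
      = (\<integral>\<^sup>+ z. f z \<partial>distr (lborel \<Otimes>\<^sub>M lborel) (lborel \<Otimes>\<^sub>M lborel) (\<lambda>(x, y). (y, x)))"
    by (rule arg_cong[OF lborel_pair.distr_pair_swap, where f = "\<lambda>M. integral\<^sup>N M f"])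
  also have "\<dots> = (\<integral>\<^sup>+ z. f (case z of (x, y) \<Rightarrow> (y, x)) \<partial>(lborel \<Otimes>\<^sub>M lborel))"
    by (rule nn_integral_distr) (use f measurable_pair_swap' in auto)
  finally show ?thesis by (simp add: lborel_prod prod.swap_def case_prod_beta)
qed

definition jump_integral :: "(real \<Rightarrow> real \<Rightarrow> real) \<Rightarrow> (real \<Rightarrow> real) \<Rightarrow> ennreal" where
  "jump_integral J u
     = (\<integral>\<^sup>+ (x, y). ennreal ((u x - u y)\<^sup>2 * J x y) \<partial>lebesgue_on ({0..1} \<times> {0..1}))"

lemma jump_integral_eq:
  "jump_integral J u = (\<integral>\<^sup>+ z. ennreal ((u (fst z) - u (snd z))\<^sup>2 * J (fst z) (snd z))
     * indicator ({0..1} \<times> {0..1}) z \<partial>lborel)"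
proof -
  have "({0..1} \<times> {0..1} :: (real \<times> real) set) \<in> sets lborel"
    by (auto intro!: borel_closed closed_Times)
  then have m: "({0..1} \<times> {0..1} :: (real \<times> real) set) \<inter> space lebesgue \<in> sets lebesgue"
    using sets_completionI_sets by fastforce
  show ?thesis
    unfolding jump_integral_def nn_integral_restrict_space[OF m] nn_integral_completion
    by (simp add: case_prod_beta)
qed

text \<open>Points below the diagonal are reflected, which doubles the constant \<open>35/16\<close>.\<close>

lemma jump_integral_upper:
  assumes u: "continuous_on UNIV u"
    and sym: "\<And>x y. x \<in> {0..1} \<Longrightarrow> y \<in> {0..1} \<Longrightarrow> x \<noteq> y \<Longrightarrow> J x y = J y x"
    and le: "\<And>x y. x \<in> {0..1} \<Longrightarrow> y \<in> {0..1} \<Longrightarrow> x \<noteq> y \<Longrightarrow> J x y \<le> J_star x y"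
  shows "jump_integral J u \<le> ennreal (35 / 8) * (\<Sum>n. ennreal (level_form n u))"
proof -
  define K where "K = kernel_sum top_block u"
  define F where "F x y = (u x - u y)\<^sup>2 * J x y" for x y
  have K[measurable]: "K \<in> borel_measurable borel"
    unfolding K_def by (rule kernel_sum_measurable[OF top_block_borel u])
  have lt: "ennreal (F x y) \<le> ennreal (35 / 16) * K (x, y)"
    if xy: "0 \<le> x" "x < y" "y \<le> 1" "x \<notin> dyadic" "y \<notin> dyadic" for x y
  proof -
    have "0 \<in> dyadic" "1 \<in> dyadic" by (rule dyadicI[of _ 0 0], simp, rule dyadicI[of _ 1 0], simp)
    then have "x \<noteq> 0" "y \<noteq> 1" using xy by blast+
    then obtain n where n: "(x, y) \<in> blocks top_block n"
      using blocks_exhaust[of x y] xy by fastforce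
    have "J x y \<le> J_star x y" using le xy by simp
    also have "\<dots> \<le> 35 / 16 * (20 / 3) ^ n" by (rule J_star_bounds(2)[OF n_star_blocks[OF n]])
    finally have "F x y \<le> (u x - u y)\<^sup>2 * (35 / 16 * (20 / 3) ^ n)"
      unfolding F_def by (rule mult_left_mono) simp
    then have "ennreal (F x y) \<le> ennreal ((35 / 16) * ((20 / 3) ^ n * (u x - u y)\<^sup>2))"
      by (intro ennreal_leI) (simp add: ac_simps)
    also have "\<dots> = ennreal (35 / 16) * K (x, y)"
      unfolding K_def kernel_sum_eq[OF order_refl n] sqdiff_def fst_conv snd_conv
      by (rule ennreal_mult3) simp_all
    finally show ?thesis .
  qed
  have "AE z in lborel. ennreal (F (fst z) (snd z)) * indicator ({0..1} \<times> {0..1}) z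
      \<le> ennreal (35 / 16) * (K z + K (prod.swap z))"
    using AE_not_dyadic
  proof eventually_elim
    case (elim z)
    obtain x y where z: "z = (x, y)" by (cases z)
    show ?case
    proof (cases "z \<in> {0..1} \<times> {0..1}")
      case True
      consider "x < y" | "x = y" | "y < x" by linarith
      then have "ennreal (F x y) \<le> ennreal (35 / 16) * (K (x, y) + K (y, x))"
      proof cases
        case 1
        have "ennreal (F x y) \<le> ennreal (35 / 16) * K (x, y)"
          by (rule lt) (use 1 True elim z in auto)
        also have "\<dots> \<le> ennreal (35 / 16) * (K (x, y) + K (y, x))" by (intro mult_left_mono) auto
        finally show ?thesis .
      next
        case 2
        then show ?thesis by (simp add: F_def)
      next
        case 3
        have "F x y = F y x" using sym[of x y] 3 True z by (simp add: F_def power2_commute)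
        also have "ennreal (F y x) \<le> ennreal (35 / 16) * K (y, x)"
          by (rule lt) (use 3 True elim z in auto)
        also have "\<dots> \<le> ennreal (35 / 16) * (K (x, y) + K (y, x))" by (intro mult_left_mono) auto
        finally show ?thesis .
      qed
      then show ?thesis using z True by simp
    qed simp
  qed
  then have "jump_integral J u \<le> (\<integral>\<^sup>+ z. ennreal (35 / 16) * (K z + K (prod.swap z)) \<partial>lborel)"
    unfolding jump_integral_eq F_def by (rule nn_integral_mono_AE)
  also have "\<dots> = ennreal (35 / 16) * ((\<integral>\<^sup>+ z. K z \<partial>lborel) + (\<integral>\<^sup>+ z. K (prod.swap z) \<partial>lborel))"
  proof -
    have "continuous_on UNIV (prod.swap :: real \<times> real \<Rightarrow> real \<times> real)" by (rule continuous_on_swap)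
    from borel_measurable_continuous_onI[OF this]
    have [measurable]: "(\<lambda>z. K (prod.swap z)) \<in> borel_measurable borel"
      by (rule measurable_compose) (rule K)
    show ?thesis by (simp add: nn_integral_cmult nn_integral_add)
  qed
  also have "\<dots> = ennreal (35 / 16) * (2 * (\<Sum>n. ennreal (level_form n u)))"
    unfolding nn_integral_swap[OF K] unfolding K_def nn_integral_kernel_sum[OF top_block_borel u]
    by (simp add: block_form_top u mult_2)
  also have "\<dots> = ennreal (35 / 8) * (\<Sum>n. ennreal (level_form n u))"
  proof -
    have "ennreal (35 / 16) * 2 = ennreal (35 / 8)"
      using ennreal_mult[of "35 / 16" 2] by simp
    then show ?thesis by (simp add: mult.assoc[symmetric])
  qed
  finally show ?thesis .
qed

text \<open>Only the visible parts of the blocks are used; there \<open>J\<close> equals \<open>J_star\<close>, which is at least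
  \<open>35/16 \<cdot> 14/17 \<cdot> (20/3)\<^sup>n = 245/136 \<cdot> (20/3)\<^sup>n\<close>.\<close>

lemma jump_integral_lower:
  assumes u: "continuous_on UNIV u" and s: "0 < s" "s < 1"
    and eq: "\<And>x y. x \<in> {0..1} \<Longrightarrow> y \<in> {0..1} \<Longrightarrow> x \<noteq> y \<Longrightarrow> (x, y) \<notin> N_set s \<Longrightarrow> J x y = J_star x y"
  shows "(\<Sum>n. ennreal (level_form n u)) \<le> ennreal (visible_const s * (136 / 245)) * jump_integral J u"
proof -
  have sub: "visible_block s \<subseteq> top_block" by (auto simp: visible_block_def)
  define K where "K = kernel_sum (visible_block s) u"
  have K[measurable]: "K \<in> borel_measurable borel"
    unfolding K_def by (rule kernel_sum_measurable[OF visible_block_borel u])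
  have le: "ennreal (245 / 136) * K z
      \<le> ennreal ((u (fst z) - u (snd z))\<^sup>2 * J (fst z) (snd z)) * indicator ({0..1} \<times> {0..1}) z" for z
  proof (cases "\<exists>n. z \<in> blocks (visible_block s) n")
    case True
    then obtain n where n: "z \<in> blocks (visible_block s) n" by blast
    obtain x y where z: "z = (x, y)" by (cases z)
    have top: "(x, y) \<in> blocks top_block n" using n blocks_mono[OF sub] z by blast
    then have xy: "0 < x" "x < y" "y < 1" using blocks_bounds[OF top] by auto
    have "J x y = J_star x y"
      using eq[of x y] xy visible_blocks_disjoint_N_set[OF s n] z by simp
    then have "(u x - u y)\<^sup>2 * (245 / 136 * (20 / 3) ^ n) \<le> (u x - u y)\<^sup>2 * J x y"
      using J_star_bounds(1)[OF n_star_blocks[OF top]] by (intro mult_left_mono) auto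
    then have "ennreal (245 / 136 * ((20 / 3) ^ n * (u x - u y)\<^sup>2)) \<le> ennreal ((u x - u y)\<^sup>2 * J x y)"
      by (intro ennreal_leI) (simp add: ac_simps)
    moreover have "ennreal (245 / 136 * ((20 / 3) ^ n * (u x - u y)\<^sup>2)) = ennreal (245 / 136) * K z"
      unfolding K_def kernel_sum_eq[OF sub n] sqdiff_def unfolding z fst_conv snd_conv
      by (rule ennreal_mult3) simp_all
    ultimately show ?thesis using xy z by simp
  next
    case False
    then show ?thesis by (simp add: K_def kernel_sum_outside)
  qed
  have "ennreal (245 / 136) * (\<Sum>n. block_form (visible_block s) n u) = (\<integral>\<^sup>+ z. ennreal (245 / 136) * K z \<partial>lborel)"
    by (simp add: nn_integral_cmult K_def nn_integral_kernel_sum[OF visible_block_borel u]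
        kernel_sum_measurable[OF visible_block_borel u])
  also have "\<dots> \<le> jump_integral J u"
    unfolding jump_integral_eq by (rule nn_integral_mono) (rule le)
  finally have lower: "ennreal (245 / 136) * (\<Sum>n. block_form (visible_block s) n u) \<le> jump_integral J u" .
  have c: "0 \<le> visible_const s" using s by (simp add: visible_const_def)
  have "(\<Sum>n. ennreal (level_form n u)) \<le> (\<Sum>n. ennreal (visible_const s) * block_form (visible_block s) n u)"
    using top_le_visible[OF s u] by (intro suminf_le) (auto simp: block_form_top[OF u])
  also have "\<dots> = ennreal (visible_const s) * (\<Sum>n. block_form (visible_block s) n u)"
    by (rule ennreal_suminf_cmult)
  also have "(\<Sum>n. block_form (visible_block s) n u)
      = ennreal (136 / 245) * (ennreal (245 / 136) * (\<Sum>n. block_form (visible_block s) n u))"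
    by (simp add: mult.assoc[symmetric] ennreal_mult'[symmetric])
  also have "ennreal (visible_const s) * \<dots> \<le> ennreal (visible_const s) * (ennreal (136 / 245) * jump_integral J u)"
    by (intro mult_left_mono lower) auto
  finally show ?thesis using ennreal_mult[OF c, of "136 / 245"] by (simp only: mult.assoc)
qed

lemma jump_form_eq_integral:
  assumes u: "continuous_on UNIV u"
    and J: "(\<lambda>(x, y). J x y) \<in> borel_measurable (lebesgue_on {(x, y). x \<in> {0..1} \<and> y \<in> {0..1} \<and> x \<noteq> y})"
    and nonneg: "\<And>x y. x \<in> {0..1} \<Longrightarrow> y \<in> {0..1} \<Longrightarrow> x \<noteq> y \<Longrightarrow> 0 \<le> J x y"
  shows "jump_form J u u = enn2real (jump_integral J u)"
proof -
  define Q where "Q = ({0..1} \<times> {0..1} :: (real \<times> real) set)"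
  define R where "R = {(x, y). x \<in> {0..1::real} \<and> y \<in> {0..1::real} \<and> x \<noteq> y}"
  have "Q \<in> sets borel" unfolding Q_def by (intro borel_closed closed_Times) auto
  moreover have "R = Q - {z. fst z = snd z}" by (auto simp: R_def Q_def)
  moreover have "closed {z :: real \<times> real. fst z = snd z}"
    by (intro closed_Collect_eq continuous_intros)
  ultimately have QR: "Q \<inter> space lebesgue \<in> sets lebesgue" "R \<inter> space lebesgue \<in> sets lebesgue"
    by (auto intro!: sets_completionI_sets)
  have JR: "(\<lambda>z. indicator R z *\<^sub>R J (fst z) (snd z)) \<in> borel_measurable lebesgue"
    using J unfolding R_def[symmetric] borel_measurable_restrict_space_iff[OF QR(2)]
    by (simp add: case_prod_beta)
  have "continuous_on UNIV (\<lambda>z. (u (fst z) - u (snd z))\<^sup>2)"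
    by (intro continuous_intros continuous_on_compose2[OF u]) auto
  then have "(\<lambda>z. (u (fst z) - u (snd z))\<^sup>2) \<in> borel_measurable lborel"
    using borel_measurable_continuous_onI by auto
  then have "(\<lambda>z. (u (fst z) - u (snd z))\<^sup>2) \<in> borel_measurable lebesgue"
    by (rule measurable_completion)
  from borel_measurable_times[OF this JR]
  have "(\<lambda>z. indicator Q z *\<^sub>R ((u (fst z) - u (snd z)) * (u (fst z) - u (snd z)) * J (fst z) (snd z)))
      \<in> borel_measurable lebesgue"
    by (rule measurable_cong[THEN iffD1, rotated])
      (auto simp: Q_def R_def indicator_def power2_eq_square)
  then have m: "(\<lambda>z. (u (fst z) - u (snd z)) * (u (fst z) - u (snd z)) * J (fst z) (snd z))
      \<in> borel_measurable (lebesgue_on Q)"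
    unfolding borel_measurable_restrict_space_iff[OF QR(1)] .
  have n: "0 \<le> (u (fst z) - u (snd z)) * (u (fst z) - u (snd z)) * J (fst z) (snd z)"
    if "z \<in> space (lebesgue_on Q)" for z
  proof (cases "fst z = snd z")
    case False
    then show ?thesis using that nonneg[of "fst z" "snd z"] by (auto simp: Q_def space_restrict_space)
  qed simp
  show ?thesis
    unfolding jump_form_def jump_integral_def Q_def[symmetric] case_prod_beta
    by (subst integral_eq_nn_integral[OF m]) (use n in \<open>auto simp: power2_eq_square\<close>)
qed

text \<open>Replaces a function that is continuous on the unit interval by one that is continuous on the whole
  line and has the same values there.\<close>

definition clamp :: "(real \<Rightarrow> real) \<Rightarrow> real \<Rightarrow> real" where
  "clamp u x = u (max 0 (min 1 x))"

lemma clamp_eq: "x \<in> {0..1} \<Longrightarrow> clamp u x = u x"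
  by (simp add: clamp_def)

lemma continuous_on_clamp: "continuous_on {0..1} u \<Longrightarrow> continuous_on UNIV (clamp u)"
  unfolding clamp_def by (rule continuous_on_compose2[of "{0..1}" u]) (auto intro!: continuous_intros)

lemma jump_integral_cong:
  assumes "\<And>x. x \<in> {0..1} \<Longrightarrow> u x = v x"
  shows "jump_integral J u = jump_integral J v"
  unfolding jump_integral_def
  by (rule nn_integral_cong) (use assms in \<open>auto simp: space_restrict_space\<close>)

lemma jump_form_cong:
  assumes "\<And>x. x \<in> {0..1} \<Longrightarrow> u x = v x"
  shows "jump_form J u u = jump_form J v v"
  unfolding jump_form_def
  by (rule Bochner_Integration.integral_cong) (use assms in \<open>auto simp: space_restrict_space\<close>)

lemma trace_dom_continuous:
  assumes "v \<in> trace_dom"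
  shows "continuous_on {0..1} v"
proof -
  obtain U where U: "U \<in> sg_dom" "\<forall>x\<in>{0..1}. U (x, 0) = v x"
    using assms by (auto simp: trace_dom_def sg_extensions_def)
  have "continuous_on {0..1} (\<lambda>x. U (x, 0))"
    by (rule continuous_on_compose2[of sierpinski_gasket U])
      (use U bottom_in_gasket in \<open>auto simp: sg_dom_def intro!: continuous_intros\<close>)
  then show ?thesis by (rule continuous_on_eq) (use U in auto)
qed

lemma trace_cong:
  assumes "\<And>x. x \<in> {0..1} \<Longrightarrow> u x = v x"
  shows "u \<in> trace_dom \<longleftrightarrow> v \<in> trace_dom" "trace_energy u = trace_energy v"
proof -
  have "sg_extensions u = sg_extensions v" using assms by (auto simp: sg_extensions_def)
  then show "u \<in> trace_dom \<longleftrightarrow> v \<in> trace_dom" "trace_energy u = trace_energy v"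
    by (simp_all add: trace_dom_def trace_energy_def)
qed

theorem theorem5p1:
  fixes s :: real and J :: "real \<Rightarrow> real \<Rightarrow> real"
  assumes "0 < s" and "s < 1"
    and "(\<lambda>(x, y). J x y) \<in> borel_measurable (lebesgue_on {(x, y). x \<in> {0..1} \<and> y \<in> {0..1} \<and> x \<noteq> y})"
    and "\<And>x y. x \<in> {0..1} \<Longrightarrow> y \<in> {0..1} \<Longrightarrow> x \<noteq> y \<Longrightarrow> J x y = J y x"
    and "\<And>x y. x \<in> {0..1} \<Longrightarrow> y \<in> {0..1} \<Longrightarrow> x \<noteq> y \<Longrightarrow> (x, y) \<in> N_set s \<Longrightarrow>
            0 \<le> J x y \<and> J x y \<le> J_star x y"
    and "\<And>x y. x \<in> {0..1} \<Longrightarrow> y \<in> {0..1} \<Longrightarrow> x \<noteq> y \<Longrightarrow> (x, y) \<notin> N_set s \<Longrightarrow>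
            J x y = J_star x y"
  shows "{u \<in> jump_dom J. continuous_on {0..1} u} = trace_dom \<and>
    (\<exists>c1 c2. 0 < c1 \<and> 0 < c2 \<and>
      (\<forall>u\<in>trace_dom. c1 * trace_energy u \<le> jump_form J u u \<and>
                      jump_form J u u \<le> c2 * trace_energy u))"
proof -
  have J_star_nonneg: "0 \<le> J_star x y" for x y
    unfolding J_star_def by (intro mult_nonneg_nonneg add_nonneg_nonneg) auto
  have nonneg: "0 \<le> J x y" and le: "J x y \<le> J_star x y"
    if "x \<in> {0..1}" "y \<in> {0..1}" "x \<noteq> y" for x y
    using assms(5)[OF that] assms(6)[OF that] J_star_nonneg[of x y] by force+
  define C where "C = visible_const s * (136 / 245)"
  have "0 < C" using assms(1) by (simp add: C_def visible_const_def add_pos_pos)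
  have finite_iff: "jump_integral J u < \<infinity> \<longleftrightarrow> summable (\<lambda>n. level_form n (clamp u))"
    and low: "summable (\<lambda>n. level_form n (clamp u)) \<Longrightarrow> dyadic_form (clamp u) \<le> C * jump_form J u u"
    and up: "summable (\<lambda>n. level_form n (clamp u)) \<Longrightarrow> jump_form J u u \<le> 35 / 8 * dyadic_form (clamp u)"
    if u: "continuous_on {0..1} u" for u
  proof -
    note c = continuous_on_clamp[OF u]
    have nn: "0 \<le> level_form n (clamp u)" for n by (rule level_form_nonneg[OF c])
    have I: "jump_integral J u = jump_integral J (clamp u)"
      by (rule jump_integral_cong) (simp add: clamp_eq)
    have F: "jump_form J u u = enn2real (jump_integral J u)"
    proof -
      have "jump_form J u u = jump_form J (clamp u) (clamp u)"
        by (rule jump_form_cong) (simp add: clamp_eq)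
      also have "\<dots> = enn2real (jump_integral J (clamp u))"
        by (rule jump_form_eq_integral[OF c assms(3)]) (rule nonneg)
      finally show ?thesis unfolding I .
    qed
    have U: "jump_integral J u \<le> ennreal (35 / 8) * (\<Sum>n. ennreal (level_form n (clamp u)))"
      unfolding I by (rule jump_integral_upper[OF c assms(4) le])
    have L: "(\<Sum>n. ennreal (level_form n (clamp u))) \<le> ennreal C * jump_integral J u"
      unfolding I C_def by (rule jump_integral_lower[OF c assms(1,2,6)])
    have sum: "(\<Sum>n. ennreal (level_form n (clamp u))) = ennreal (dyadic_form (clamp u))"
      if "summable (\<lambda>n. level_form n (clamp u))"
      unfolding dyadic_form_def by (rule suminf_ennreal2[OF nn that])
    have fin: "jump_integral J u < \<infinity>" if "summable (\<lambda>n. level_form n (clamp u))"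
      using U unfolding sum[OF that] by (rule le_less_trans) (simp add: ennreal_mult_less_top)
    show "jump_integral J u < \<infinity> \<longleftrightarrow> summable (\<lambda>n. level_form n (clamp u))"
    proof
      assume "jump_integral J u < \<infinity>"
      then have "(\<Sum>n. ennreal (level_form n (clamp u))) < top"
        using le_less_trans[OF L] by (simp add: ennreal_mult_less_top)
      then show "summable (\<lambda>n. level_form n (clamp u))"
        using nn by (intro summable_suminf_not_top) auto
    qed (rule fin)
    assume *: "summable (\<lambda>n. level_form n (clamp u))"
    have e: "0 \<le> dyadic_form (clamp u)" by (rule dyadic_form_nonneg[OF c *])
    have Jr: "jump_integral J u = ennreal (jump_form J u u)" "0 \<le> jump_form J u u"
      unfolding F using fin[OF *] by simp_all
    show "dyadic_form (clamp u) \<le> C * jump_form J u u"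
      using L \<open>0 < C\<close> Jr unfolding sum[OF *] by (simp add: ennreal_mult'[symmetric])
    show "jump_form J u u \<le> 35 / 8 * dyadic_form (clamp u)"
      using U Jr e unfolding sum[OF *] by (simp add: ennreal_mult'[symmetric])
  qed
  have dom: "u \<in> jump_dom J \<longleftrightarrow> jump_integral J u < \<infinity>" if u: "continuous_on {0..1} u" for u
  proof -
    have "u \<in> borel_measurable (lebesgue_on {0..1})"
      by (rule continuous_imp_measurable_on_sets_lebesgue[OF u]) simp
    moreover have "integrable (lebesgue_on {0..1}) (\<lambda>x. (u x)\<^sup>2)"
      by (intro continuous_imp_integrable_real continuous_intros u)
    ultimately show ?thesis by (simp add: jump_dom_def jump_integral_def)
  qed
  have tr: "summable (\<lambda>n. level_form n (clamp u))" "dyadic_form (clamp u) \<le> 24 * trace_energy u"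
    if "u \<in> trace_dom" for u
    using trace_domD[OF that continuous_on_clamp[OF trace_dom_continuous[OF that]]] by (simp_all add: clamp_eq)
  have ex: "u \<in> trace_dom" "trace_energy u \<le> 150 * dyadic_form (clamp u)"
    if "continuous_on {0..1} u" "summable (\<lambda>n. level_form n (clamp u))" for u
    using trace_extension[OF continuous_on_clamp[OF that(1)] that(2)] trace_cong[of "clamp u" u]
    by (simp_all add: clamp_eq)
  have "{u \<in> jump_dom J. continuous_on {0..1} u} = trace_dom"
  proof (intro set_eqI iffI)
    fix u assume "u \<in> {u \<in> jump_dom J. continuous_on {0..1} u}"
    then show "u \<in> trace_dom" using dom finite_iff ex(1) by blast
  next
    fix u assume "u \<in> trace_dom"
    then show "u \<in> {u \<in> jump_dom J. continuous_on {0..1} u}"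
      using trace_dom_continuous tr(1) dom finite_iff by blast
  qed
  \<comment> \<open>The constant 105 is the product of 35/8 for the jump form and 24 for the restriction.\<close>
  moreover have "1 / (150 * C) * trace_energy u \<le> jump_form J u u \<and> jump_form J u u \<le> 105 * trace_energy u"
    if u: "u \<in> trace_dom" for u
  proof
    note c = trace_dom_continuous[OF u]
    have "trace_energy u \<le> 150 * (C * jump_form J u u)"
      using ex(2)[OF c tr(1)[OF u]] low[OF c tr(1)[OF u]] by linarith
    then show "1 / (150 * C) * trace_energy u \<le> jump_form J u u"
      using \<open>0 < C\<close> by (simp add: field_simps)
    show "jump_form J u u \<le> 105 * trace_energy u"
      using up[OF c tr(1)[OF u]] tr(2)[OF u] by linarith
  qed
  moreover have "0 < 1 / (150 * C)" using \<open>0 < C\<close> by simp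
  ultimately show ?thesis
    by (intro conjI exI[of _ "1 / (150 * C)"] exI[of _ 105]) auto
qed

end
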